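(* Let $j\colon \Gamma_3\times\mathbb{R}\to\mathbb{R}$ satisfy: (a) $j(\cdot,r)$ is measurable on $\Gamma_3$ for all $r\in\mathbb{R}$; (b) $j(x,\cdot)$ is locally Lipschitz for a.e. $x\in\Gamma_3$; (c) there exist $c_0,c_1\ge 0$ such that $|\partial j(x,r)|\le c_0+c_1|r|$ for all $r\in\mathbb{R}$, a.e. $x\in\Gamma_3$; (d) $j^0(x,r;b-r)\le 0$ for all $r\in\mathbb{R}$, a.e. $x\in\Gamma_3$, with a constant $b\in\mathbb{R}$. Fix $\alpha>0$. For $\ell\in V^*$ consider the problem $$(P_\ell)\qquad \text{find } u\in V_0 \text{ such that } a(u,v)+\alpha\int_{\Gamma_3} j^0(x,u(x);v(x))\,d\Gamma\ \ge\ \ell(v)\ \text{ for all } v\in V_0 .$$ Let $L, L_n\in V^*$, $n\in\mathbb{N}$, be such that $$\lim_{n\to\infty} L_n(z_n)=L(z)\quad\text{whenever } z_n\to z \text{ weakly in } V \text{ as } n\to\infty ,$$ and let $u_n\in V_0$ be a solution of $(P_{L_n})$ for each $n\in\mathbb{N}$. (1) There exists a subsequence of $\{u_n\}$ which converges weakly in $V$ to a solution of $(P_L)$. (2) If, in addition, there is $m_j\ge 0$ such that $$j^0(x,r;s-r)+j^0(x,s;r-s)\le m_j|r-s|^2\quad\text{for all } r,s\in\mathbb{R},\ \text{a.e. } x\in\Gamma_3,$$ and $m_a>\alpha\, m_j\|\gamma\|^2$, then $(P_L)$ has a unique solution $u\in V_0$, each $(P_{L_n})$ has a unique solution $u_n\in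 V_0$, and the whole sequence $\{u_n\}$ converges to $u$ (strongly) in $V$ as $n\to\infty$.
   Context: Setting: $\Omega\subset\mathbb{R}^d$ is a bounded domain with regular boundary $\Gamma$ (in particular Lipschitz, so that the trace operator $\gamma\colon V\to L^2(\Gamma)$ is defined, bounded and compact). $\Gamma$ is the union of three disjoint measurable portions $\Gamma_1,\Gamma_2,\Gamma_3$, each of positive $(d-1)$-dimensional Hausdorff measure. $V=H^1(\Omega)$ with norm $\|v\|_V=(\|v\|^2_{L^2(\Omega)}+\|\nabla v\|^2_{L^2(\Omega;\mathbb{R}^d)})^{1/2}$, dual $V^*$, and $V_0=\{v\in V: v=0 \text{ on }\Gamma_1\}$ (trace sense). $a(u,v)=\int_\Omega \nabla u\cdot\nabla v\,dx$. $m_a>0$ is a coercivity constant of $a$ on $V_0$: $a(v,v)\ge m_a\|v\|_V^2$ for all $v\in V_0$ (it exists by the Poincaré inequality). $\|\gamma\|$ is the operator norm of the trace operator $\gamma\colon V\to L^2(\Gamma)$. In boundary integrals a function of $V$ is identified with its trace. Clarke calculus: for a locally Lipschitz $\varphi\colon\mathbb{R}\to\mathbb{R}$, $\varphi^0(r;s)=\limsup_{y\to r,\ \lambda\to0^+}\frac{\varphi(y+\lambda s)-\varphi(y)}{\lambda}$ and $\partial\varphi(r)=\{\zeta\in\mathbb{R}:\varphi^0(r;s)\ge\zeta s\ \text{for all } s\in\mathbb{R}\}$. For $j$ these are taken in the second variable, written $j^0(x,r;s)$ and $\partial j(x,r)$. The bound $|\partial j(x,r)|\le C$ means $|\zeta|\le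 C$ for every $\zeta\in\partial j(x,r)$. "For all $r$ (and $s$), a.e. $x\in\Gamma_3$" means: for a.e. $x\in\Gamma_3$ the condition holds for all $r$ (and $s$) in $\mathbb{R}$. *)

theory Defs
  imports "HOL-Analysis.Analysis"
begin

section \<open>Hausdorff measure\<close>

text \<open>
  The normalising factor makes the $k$-dimensional Hausdorff measure agree with Lebesgue measure
  on $k$-dimensional planes. Empty covering sets are weighted 0 also for $k = 0$, and boundedness
  is required because \<^const>\<open>diameter\<close> is unspecified on unbounded sets.
\<close>

definition hausdorff_pre :: "nat \<Rightarrow> real \<Rightarrow> 'a::metric_space set \<Rightarrow> ennreal" where
  "hausdorff_pre k \<delta> A =
     (INF C \<in> {C :: nat \<Rightarrow> 'a set. A \<subseteq> (\<Union>i. C i) \<and> (\<forall>i. bounded (C i) \<and> diameter (C i) \<le> \<delta>)}.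
        \<Sum>i. if C i = {} then 0 else ennreal (unit_ball_vol (real k) * (diameter (C i) / 2) ^ k))"

definition hausdorff_outer :: "nat \<Rightarrow> 'a::metric_space set \<Rightarrow> ennreal" where
  "hausdorff_outer k A = (SUP \<delta>\<in>{0<..}. hausdorff_pre k \<delta> A)"

text \<open>
  The measurable sets are those satisfying the Caratheodory criterion, so the measure is complete.
\<close>

definition hausdorff_measure :: "nat \<Rightarrow> 'a::metric_space measure" where
  "hausdorff_measure k =
     measure_of UNIV (lambda_system UNIV UNIV (hausdorff_outer k)) (hausdorff_outer k)"

text \<open>
  \<^const>\<open>measure_of\<close> yields the null measure unless it is given a countably additive function; the
  next two facts show that it does not degenerate here.
\<close>

lemma outer_measure_space_hausdorff_outer:
  "outer_measure_space UNIV (hausdorff_outer k :: 'a::metric_space set \<Rightarrow> ennreal)"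
proof -
  define w :: "'a set \<Rightarrow> ennreal"
    where "w = (\<lambda>C. if C = {} then 0 else ennreal (unit_ball_vol (real k) * (diameter C / 2) ^ k))"
  define cov :: "real \<Rightarrow> 'a set \<Rightarrow> (nat \<Rightarrow> 'a set) set"
    where "cov = (\<lambda>\<delta> A. {C. A \<subseteq> (\<Union>i. C i) \<and> (\<forall>i. bounded (C i) \<and> diameter (C i) \<le> \<delta>)})"
  have pre: "hausdorff_pre k \<delta> A = (INF C \<in> cov \<delta> A. \<Sum>i. w (C i))" for \<delta> A
    by (simp add: hausdorff_pre_def w_def cov_def)
  have pre_empty: "hausdorff_pre k \<delta> ({} :: 'a set) = 0" if "\<delta> > 0" for \<delta>
  proof -
    have "(\<lambda>_. {}) \<in> cov \<delta> {}" using that by (simp add: cov_def)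
    then have "hausdorff_pre k \<delta> ({} :: 'a set) \<le> (\<Sum>i::nat. w {})"
      unfolding pre by (rule INF_lower2) simp
    then show ?thesis by (simp add: w_def)
  qed
  have pre_mono: "hausdorff_pre k \<delta> A \<le> hausdorff_pre k \<delta> B" if "A \<subseteq> B" for \<delta> and A B :: "'a set"
    unfolding pre by (rule INF_superset_mono) (use that in \<open>auto simp: cov_def\<close>)
  have pre_sub: "hausdorff_pre k \<delta> (\<Union>i. A i) \<le> (\<Sum>i. hausdorff_pre k \<delta> (A i))"
    for \<delta> and A :: "nat \<Rightarrow> 'a set"
  proof (rule ennreal_le_epsilon)
    fix e :: real
    assume fin: "(\<Sum>i. hausdorff_pre k \<delta> (A i)) < top" and e: "0 < e"
    define e' where "e' = (\<lambda>n::nat. e * (1 / 2) ^ Suc n)"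
    have "\<exists>C \<in> cov \<delta> (A n). (\<Sum>i. w (C i)) \<le> hausdorff_pre k \<delta> (A n) + ennreal (e' n)" for n
    proof -
      have "hausdorff_pre k \<delta> (A n) < top"
        using fin ennreal_suminf_lessD by blast
      then have "hausdorff_pre k \<delta> (A n) < hausdorff_pre k \<delta> (A n) + ennreal (e' n)"
        using e ennreal_add_left_cancel_less[of "hausdorff_pre k \<delta> (A n)" 0 "ennreal (e' n)"]
        by (simp add: e'_def)
      then show ?thesis
        unfolding pre by (force simp: INF_less_iff intro: less_imp_le)
    qed
    then obtain C where C: "\<And>n. C n \<in> cov \<delta> (A n)"
      and le: "\<And>n. (\<Sum>i. w (C n i)) \<le> hausdorff_pre k \<delta> (A n) + ennreal (e' n)" by metis
    define D where "D = (\<lambda>m. case prod_decode m of (n, i) \<Rightarrow> C n i)"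
    have "D \<in> cov \<delta> (\<Union>i. A i)"
    proof -
      have "(\<Union>i. A i) \<subseteq> (\<Union>m. D m)"
      proof
        fix x assume "x \<in> (\<Union>i. A i)"
        then obtain n where "x \<in> A n" by blast
        then obtain i where "x \<in> C n i" using C[of n] by (auto simp: cov_def)
        then have "x \<in> D (prod_encode (n, i))" by (simp add: D_def)
        then show "x \<in> (\<Union>m. D m)" by blast
      qed
      then show ?thesis using C by (auto simp: cov_def D_def split: prod.split)
    qed
    then have "hausdorff_pre k \<delta> (\<Union>i. A i) \<le> (\<Sum>m. w (D m))"
      unfolding pre by (rule INF_lower)
    also have "\<dots> = (\<Sum>n. \<Sum>i. w (C n i))"
      using suminf_ennreal_2dimen[of "\<lambda>n. \<Sum>i. w (C n i)" "\<lambda>(n, i). w (C n i)"]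
      by (simp add: D_def o_def case_prod_beta')
    also have "\<dots> \<le> (\<Sum>n. hausdorff_pre k \<delta> (A n) + ennreal (e' n))"
      by (intro suminf_le le) auto
    also have "\<dots> = (\<Sum>n. hausdorff_pre k \<delta> (A n)) + (\<Sum>n. ennreal (e' n))"
      by (simp add: suminf_add[symmetric])
    also have "(\<Sum>n. ennreal (e' n)) = ennreal e"
    proof (rule suminf_ennreal_eq)
      show "e' sums e" unfolding e'_def using sums_mult[OF power_half_series, of e] by simp
    qed (use e in \<open>simp add: e'_def\<close>)
    finally show "hausdorff_pre k \<delta> (\<Union>i. A i) \<le> (\<Sum>i. hausdorff_pre k \<delta> (A i)) + ennreal e" .
  qed
  have "hausdorff_outer k (\<Union>i. A i) \<le> (\<Sum>i. hausdorff_outer k (A i))" for A :: "nat \<Rightarrow> 'a set"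
    unfolding hausdorff_outer_def[of k "\<Union>i. A i"]
  proof (rule SUP_least)
    fix \<delta> :: real assume "\<delta> \<in> {0<..}"
    then have "hausdorff_pre k \<delta> (A i) \<le> hausdorff_outer k (A i)" for i
      unfolding hausdorff_outer_def by (rule SUP_upper)
    then have "(\<Sum>i. hausdorff_pre k \<delta> (A i)) \<le> (\<Sum>i. hausdorff_outer k (A i))"
      by (intro suminf_le) auto
    with pre_sub show "hausdorff_pre k \<delta> (\<Union>i. A i) \<le> (\<Sum>i. hausdorff_outer k (A i))"
      by (rule order_trans)
  qed
  moreover have "hausdorff_outer k ({} :: 'a set) = 0"
    by (simp add: hausdorff_outer_def pre_empty)
  moreover have "hausdorff_outer k A \<le> hausdorff_outer k B" if "A \<subseteq> B" for A B :: "'a set"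
    unfolding hausdorff_outer_def by (intro SUP_mono) (use pre_mono[OF that] in blast)
  ultimately show ?thesis
    by (auto simp: outer_measure_space_def positive_def increasing_def countably_subadditive_def)
qed

lemma sets_hausdorff_measure:
    "sets (hausdorff_measure k :: 'a::metric_space measure) = lambda_system UNIV UNIV (hausdorff_outer k)"
  and emeasure_hausdorff_measure:
    "(A :: 'a set) \<in> sets (hausdorff_measure k) \<Longrightarrow> emeasure (hausdorff_measure k) A = hausdorff_outer k A"
proof -
  interpret sigma_algebra UNIV "UNIV :: 'a set set"
    using sigma_algebra_Pow[of "UNIV :: 'a set"] by simp
  have ms: "measure_space UNIV (lambda_system UNIV UNIV (hausdorff_outer k))
      (hausdorff_outer k :: 'a set \<Rightarrow> ennreal)"
    by (rule caratheodory_lemma) (rule outer_measure_space_hausdorff_outer)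
  then have sa: "sigma_algebra UNIV (lambda_system UNIV UNIV (hausdorff_outer k :: 'a set \<Rightarrow> ennreal))"
    by (simp add: measure_space_def)
  show *: "sets (hausdorff_measure k) = lambda_system UNIV UNIV (hausdorff_outer k :: 'a set \<Rightarrow> ennreal)"
    unfolding hausdorff_measure_def by (simp add: sigma_algebra.sets_measure_of_eq[OF sa])
  show "emeasure (hausdorff_measure k) A = hausdorff_outer k A"
    if "A \<in> sets (hausdorff_measure k)"
    using that ms unfolding * unfolding hausdorff_measure_def
    by (intro emeasure_measure_of_sigma) (auto simp: measure_space_def)
qed

definition surface_measure :: "'a::euclidean_space set \<Rightarrow> 'a measure" where
  "surface_measure S = restrict_space (hausdorff_measure (DIM('a) - 1)) S"


section \<open>Lipschitz domains\<close>

text \<open>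
  Near each boundary point the set is the strict epigraph, in some direction \<open>e\<close>, of a Lipschitz
  function of the component orthogonal to \<open>e\<close>.
\<close>

definition lipschitz_boundary :: "'a::euclidean_space set \<Rightarrow> bool" where
  "lipschitz_boundary \<Omega> \<longleftrightarrow>
     (\<forall>p \<in> frontier \<Omega>. \<exists>r > 0. \<exists>e C. \<exists>\<psi> :: 'a \<Rightarrow> real.
        norm e = 1 \<and> C-lipschitz_on {y. y \<bullet> e = 0} \<psi> \<and>
        \<Omega> \<inter> ball p r = {x \<in> ball p r. x \<bullet> e > \<psi> (x - (x \<bullet> e) *\<^sub>R e)})"

definition bounded_lipschitz_domain :: "'a::euclidean_space set \<Rightarrow> bool" where
  "bounded_lipschitz_domain \<Omega> \<longleftrightarrow>
     open \<Omega> \<and> connected \<Omega> \<and> \<Omega> \<noteq> {} \<and> bounded \<Omega> \<and> lipschitz_boundary \<Omega>"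


section \<open>The Sobolev space $H^1$\<close>

text \<open>
  Elements of $L^2$ and $H^1$ are represented by functions; equality in these spaces is equality
  almost everywhere.
\<close>

definition L2 :: "'a measure \<Rightarrow> ('a \<Rightarrow> 'b::euclidean_space) set" where
  "L2 M = {f. f \<in> borel_measurable M \<and> integrable M (\<lambda>x. (norm (f x))\<^sup>2)}"

definition l2_norm :: "'a measure \<Rightarrow> ('a \<Rightarrow> 'b::euclidean_space) \<Rightarrow> real" where
  "l2_norm M f = sqrt (\<integral>x. (norm (f x))\<^sup>2 \<partial>M)"

primrec Ck :: "nat \<Rightarrow> ('a::euclidean_space \<Rightarrow> real) \<Rightarrow> bool" where
  "Ck 0 \<phi> \<longleftrightarrow> continuous_on UNIV \<phi>"
| "Ck (Suc k) \<phi> \<longleftrightarrow>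
     (\<forall>x. \<phi> differentiable (at x)) \<and> (\<forall>i\<in>Basis. Ck k (\<lambda>x. frechet_derivative \<phi> (at x) i))"

definition test_functions :: "'a::euclidean_space set \<Rightarrow> ('a \<Rightarrow> real) set" where
  "test_functions \<Omega> =
     {\<phi>. (\<forall>k. Ck k \<phi>) \<and> (\<exists>K. compact K \<and> K \<subseteq> \<Omega> \<and> (\<forall>x. x \<notin> K \<longrightarrow> \<phi> x = 0))}"

definition has_weak_gradient ::
    "'a::euclidean_space set \<Rightarrow> ('a \<Rightarrow> real) \<Rightarrow> ('a \<Rightarrow> 'a) \<Rightarrow> bool" where
  "has_weak_gradient \<Omega> v g \<longleftrightarrow>
     v \<in> L2 (lebesgue_on \<Omega>) \<and> g \<in> L2 (lebesgue_on \<Omega>) \<and>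
     (\<forall>\<phi> \<in> test_functions \<Omega>. \<forall>i\<in>Basis.
        (\<integral>x. v x * frechet_derivative \<phi> (at x) i \<partial>lebesgue_on \<Omega>) =
        - (\<integral>x. (g x \<bullet> i) * \<phi> x \<partial>lebesgue_on \<Omega>))"

definition H1 :: "'a::euclidean_space set \<Rightarrow> ('a \<Rightarrow> real) set" where
  "H1 \<Omega> = {v. \<exists>g. has_weak_gradient \<Omega> v g}"

text \<open>The weak gradient is determined up to a null set, so the choice is immaterial.\<close>

definition weak_gradient :: "'a::euclidean_space set \<Rightarrow> ('a \<Rightarrow> real) \<Rightarrow> ('a \<Rightarrow> 'a)" where
  "weak_gradient \<Omega> v = (SOME g. has_weak_gradient \<Omega> v g)"

definition h1_norm :: "'a::euclidean_space set \<Rightarrow> ('a \<Rightarrow> real) \<Rightarrow> real" where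
  "h1_norm \<Omega> v =
     sqrt ((l2_norm (lebesgue_on \<Omega>) v)\<^sup>2 + (l2_norm (lebesgue_on \<Omega>) (weak_gradient \<Omega> v))\<^sup>2)"

definition dirichlet_form ::
    "'a::euclidean_space set \<Rightarrow> ('a \<Rightarrow> real) \<Rightarrow> ('a \<Rightarrow> real) \<Rightarrow> real" where
  "dirichlet_form \<Omega> u v = (\<integral>x. weak_gradient \<Omega> u x \<bullet> weak_gradient \<Omega> v x \<partial>lebesgue_on \<Omega>)"

text \<open>
  Boundedness makes a functional in the dual respect equality almost everywhere.
\<close>

definition h1_dual :: "'a::euclidean_space set \<Rightarrow> (('a \<Rightarrow> real) \<Rightarrow> real) set" where
  "h1_dual \<Omega> =
     {l. (\<forall>u\<in>H1 \<Omega>. \<forall>v\<in>H1 \<Omega>. l (\<lambda>x. u x + v x) = l u + l v) \<and>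
         (\<forall>c. \<forall>v\<in>H1 \<Omega>. l (\<lambda>x. c * v x) = c * l v) \<and>
         (\<exists>C. \<forall>v\<in>H1 \<Omega>. \<bar>l v\<bar> \<le> C * h1_norm \<Omega> v)}"

definition weakly_converges_h1 ::
    "'a::euclidean_space set \<Rightarrow> (nat \<Rightarrow> 'a \<Rightarrow> real) \<Rightarrow> ('a \<Rightarrow> real) \<Rightarrow> bool" where
  "weakly_converges_h1 \<Omega> z z0 \<longleftrightarrow>
     (\<forall>n. z n \<in> H1 \<Omega>) \<and> z0 \<in> H1 \<Omega> \<and> (\<forall>l\<in>h1_dual \<Omega>. (\<lambda>n. l (z n)) \<longlonglongrightarrow> l z0)"


section \<open>The trace operator\<close>

text \<open>
  The trace operator is the bounded linear operator from $H^1(\Omega)$ to $L^2$ of the boundary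
  that extends the restriction of functions continuous up to the boundary. For a Lipschitz domain
  these functions are dense in $H^1(\Omega)$, so it is unique up to equality almost everywhere.
\<close>

definition trace_operator ::
    "'a::euclidean_space set \<Rightarrow> (('a \<Rightarrow> real) \<Rightarrow> ('a \<Rightarrow> real)) \<Rightarrow> bool" where
  "trace_operator \<Omega> \<gamma> \<longleftrightarrow>
     (\<forall>v\<in>H1 \<Omega>. \<gamma> v \<in> L2 (surface_measure (frontier \<Omega>))) \<and>
     (\<forall>u\<in>H1 \<Omega>. \<forall>v\<in>H1 \<Omega>. AE x in surface_measure (frontier \<Omega>).
        \<gamma> (\<lambda>y. u y + v y) x = \<gamma> u x + \<gamma> v x) \<and>
     (\<forall>c. \<forall>v\<in>H1 \<Omega>. AE x in surface_measure (frontier \<Omega>). \<gamma> (\<lambda>y. c * v y) x = c * \<gamma> v x) \<and>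
     (\<exists>C. \<forall>v\<in>H1 \<Omega>. l2_norm (surface_measure (frontier \<Omega>)) (\<gamma> v) \<le> C * h1_norm \<Omega> v) \<and>
     (\<forall>v\<in>H1 \<Omega>. continuous_on (closure \<Omega>) v \<longrightarrow>
        (AE x in surface_measure (frontier \<Omega>). \<gamma> v x = v x))"

definition compact_trace ::
    "'a::euclidean_space set \<Rightarrow> (('a \<Rightarrow> real) \<Rightarrow> ('a \<Rightarrow> real)) \<Rightarrow> bool" where
  "compact_trace \<Omega> \<gamma> \<longleftrightarrow>
     (\<forall>v :: nat \<Rightarrow> 'a \<Rightarrow> real.
        (\<forall>n. v n \<in> H1 \<Omega>) \<and> (\<exists>B. \<forall>n. h1_norm \<Omega> (v n) \<le> B) \<longrightarrow>
        (\<exists>\<sigma> :: nat \<Rightarrow> nat. \<exists>g \<in> L2 (surface_measure (frontier \<Omega>)). strict_mono \<sigma> \<and>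
           (\<lambda>n. l2_norm (surface_measure (frontier \<Omega>)) (\<lambda>x. \<gamma> (v (\<sigma> n)) x - g x)) \<longlonglongrightarrow> 0))"

definition trace_norm ::
    "'a::euclidean_space set \<Rightarrow> (('a \<Rightarrow> real) \<Rightarrow> ('a \<Rightarrow> real)) \<Rightarrow> real" where
  "trace_norm \<Omega> \<gamma> =
     (SUP v \<in> {v \<in> H1 \<Omega>. h1_norm \<Omega> v \<le> 1}. l2_norm (surface_measure (frontier \<Omega>)) (\<gamma> v))"

definition V0 ::
    "'a::euclidean_space set \<Rightarrow> (('a \<Rightarrow> real) \<Rightarrow> ('a \<Rightarrow> real)) \<Rightarrow> 'a set \<Rightarrow> ('a \<Rightarrow> real) set" where
  "V0 \<Omega> \<gamma> \<Gamma>\<^sub>1 = {v \<in> H1 \<Omega>. AE x in surface_measure \<Gamma>\<^sub>1. \<gamma> v x = 0}"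


section \<open>Clarke calculus on the real line\<close>

definition locally_lipschitz :: "(real \<Rightarrow> real) \<Rightarrow> bool" where
  "locally_lipschitz \<phi> \<longleftrightarrow> (\<forall>r. \<exists>e > 0. \<exists>C. C-lipschitz_on (ball r e) \<phi>)"

text \<open>
  The upper limit is finite whenever \<open>\<phi>\<close> is locally Lipschitz, so that \<^const>\<open>real_of_ereal\<close>
  loses nothing.
\<close>

definition clarke_dd :: "(real \<Rightarrow> real) \<Rightarrow> real \<Rightarrow> real \<Rightarrow> real" where
  "clarke_dd \<phi> r s = real_of_ereal
     (Limsup (nhds r \<times>\<^sub>F at_right 0) (\<lambda>(y, t). ereal ((\<phi> (y + t * s) - \<phi> y) / t)))"

definition clarke_subdiff :: "(real \<Rightarrow> real) \<Rightarrow> real \<Rightarrow> real set" where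
  "clarke_subdiff \<phi> r = {\<zeta>. \<forall>s. clarke_dd \<phi> r s \<ge> \<zeta> * s}"


section \<open>The hemivariational inequality\<close>

definition hvi_solution ::
    "'a::euclidean_space set \<Rightarrow> (('a \<Rightarrow> real) \<Rightarrow> ('a \<Rightarrow> real)) \<Rightarrow> 'a set \<Rightarrow> 'a set \<Rightarrow>
     ('a \<Rightarrow> real \<Rightarrow> real) \<Rightarrow> real \<Rightarrow> (('a \<Rightarrow> real) \<Rightarrow> real) \<Rightarrow> ('a \<Rightarrow> real) \<Rightarrow> bool" where
  "hvi_solution \<Omega> \<gamma> \<Gamma>\<^sub>1 \<Gamma>\<^sub>3 j \<alpha> l u \<longleftrightarrow>
     u \<in> V0 \<Omega> \<gamma> \<Gamma>\<^sub>1 \<and>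
     (\<forall>v \<in> V0 \<Omega> \<gamma> \<Gamma>\<^sub>1.
        dirichlet_form \<Omega> u v + \<alpha> * (\<integral>x. clarke_dd (j x) (\<gamma> u x) (\<gamma> v x) \<partial>surface_measure \<Gamma>\<^sub>3)
        \<ge> l v)"

definition hvi_unique_solution ::
    "'a::euclidean_space set \<Rightarrow> (('a \<Rightarrow> real) \<Rightarrow> ('a \<Rightarrow> real)) \<Rightarrow> 'a set \<Rightarrow> 'a set \<Rightarrow>
     ('a \<Rightarrow> real \<Rightarrow> real) \<Rightarrow> real \<Rightarrow> (('a \<Rightarrow> real) \<Rightarrow> real) \<Rightarrow> ('a \<Rightarrow> real) \<Rightarrow> bool" where
  "hvi_unique_solution \<Omega> \<gamma> \<Gamma>\<^sub>1 \<Gamma>\<^sub>3 j \<alpha> l u \<longleftrightarrow>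
     hvi_solution \<Omega> \<gamma> \<Gamma>\<^sub>1 \<Gamma>\<^sub>3 j \<alpha> l u \<and>
     (\<forall>w. hvi_solution \<Omega> \<gamma> \<Gamma>\<^sub>1 \<Gamma>\<^sub>3 j \<alpha> l w \<longrightarrow> (AE x in lebesgue_on \<Omega>. w x = u x))"

end

theory Submission
  imports Defs "HOL-Library.Function_Algebras" "HOL-Complex_Analysis.Great_Picard"
begin

text \<open>
  Testing $(P_{L_n})$ with $-u_n$ and splitting $j^0(r; -r) \le j^0(r; b - r) + j^0(r; -b)$ bounds
  $u_n$ in $H^1$, because the assumption on $L_n$ amounts, by weak compactness of the unit ball, to
  convergence in the dual norm. Along a subsequence $u_n$ converges weakly and its traces converge
  in $L^2$ and almost everywhere; since $j^0(x, \cdot\,; s)$ is upper semicontinuous, Fatou's lemma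
  passes to the limit in the inequality. For the second part, testing two solutions against their
  difference gives a Lipschitz estimate of the solution in terms of the functional, which yields
  uniqueness and strong convergence.
\<close>

text \<open>Functions stand for their classes modulo null sets and no quotient is formed. With
  pointwise operations \<open>H1 \<Omega>\<close> and \<open>L2 M\<close> are subspaces of a
  function type, and their inner products are only positive semidefinite: a vector of norm 0
  vanishes almost everywhere, and limits are unique only up to such vectors. Hence the abstract
  theory is stated for semi-inner products on a carrier set. Weak compactness rests on completeness
  of $H^1$, which comes from two facts: weak gradients are unique almost everywhere (the fundamental
  lemma), and weak differentiation is closed in $L^2$. Another obstacle is measurability.
  \<open>clarke_dd\<close> is an upper limit over uncountably many pairs, and \<open>j x\<close> is
  locally Lipschitz only for almost every \<open>x\<close>. Continuity reduces the pairs to rational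
  ones, and completeness of the surface measure absorbs the exceptional set. In the second part the
  solution of the limit problem comes from the first part, applied to the given \<open>u n\<close>.
  The gap between \<open>m\<^sub>a\<close> and \<open>\<alpha> * m\<^sub>j * (trace_norm \<Omega>
  \<gamma>)\<^sup>2\<close> is the constant of the Lipschitz estimate.\<close>

instantiation "fun" :: (type, real_vector) real_vector
begin

definition scaleR_fun :: "real \<Rightarrow> ('a \<Rightarrow> 'b) \<Rightarrow> 'a \<Rightarrow> 'b" where
  "scaleR_fun c f = (\<lambda>x. c *\<^sub>R f x)"

instance
  by standard (simp_all add: scaleR_fun_def fun_eq_iff algebra_simps)

end

lemma scaleR_fun_apply [simp]: "(c *\<^sub>R f) x = c *\<^sub>R f x"
  by (simp add: scaleR_fun_def)

section \<open>Semi-inner product spaces\<close>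

text \<open>The carrier \<open>V\<close> is a set because the type of all functions is far larger
  than the space. Definiteness is not assumed, so \<open>ip x x = 0\<close> does not force
  \<open>x = 0\<close>.\<close>

locale semi_inner =
  fixes V :: "'v::real_vector set" and ip :: "'v \<Rightarrow> 'v \<Rightarrow> real"
  assumes subspace_V: "subspace V"
    and ip_add: "\<lbrakk>x \<in> V; y \<in> V; z \<in> V\<rbrakk> \<Longrightarrow> ip (x + y) z = ip x z + ip y z"
    and ip_scale: "\<lbrakk>x \<in> V; z \<in> V\<rbrakk> \<Longrightarrow> ip (c *\<^sub>R x) z = c * ip x z"
    and ip_sym: "\<lbrakk>x \<in> V; y \<in> V\<rbrakk> \<Longrightarrow> ip x y = ip y x"
    and ip_nonneg: "x \<in> V \<Longrightarrow> 0 \<le> ip x x"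
begin

definition nrm :: "'v \<Rightarrow> real" where "nrm x = sqrt (ip x x)"

lemma add_V: "x \<in> V \<Longrightarrow> y \<in> V \<Longrightarrow> x + y \<in> V"
  and scale_V: "x \<in> V \<Longrightarrow> c *\<^sub>R x \<in> V"
  and diff_V: "x \<in> V \<Longrightarrow> y \<in> V \<Longrightarrow> x - y \<in> V"
  and zero_V: "0 \<in> V"
  and minus_V: "x \<in> V \<Longrightarrow> - x \<in> V"
  using subspace_V by (auto intro: subspace_add subspace_scale subspace_diff subspace_0 subspace_neg)

lemmas V_intros = add_V scale_V diff_V zero_V minus_V

lemma ip_minus: "x \<in> V \<Longrightarrow> z \<in> V \<Longrightarrow> ip (- x) z = - ip x z"
  using ip_scale[of x z "-1"] by simp

lemma ip_diff: "\<lbrakk>x \<in> V; y \<in> V; z \<in> V\<rbrakk> \<Longrightarrow> ip (x - y) z = ip x z - ip y z"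
  using ip_add[of x "- y" z] ip_minus[of y z] minus_V[of y] by simp

lemma ip_add_right: "\<lbrakk>x \<in> V; y \<in> V; z \<in> V\<rbrakk> \<Longrightarrow> ip z (x + y) = ip z x + ip z y"
  and ip_scale_right: "\<lbrakk>x \<in> V; z \<in> V\<rbrakk> \<Longrightarrow> ip z (c *\<^sub>R x) = c * ip z x"
  and ip_diff_right: "\<lbrakk>x \<in> V; y \<in> V; z \<in> V\<rbrakk> \<Longrightarrow> ip z (x - y) = ip z x - ip z y"
  by (metis ip_add ip_sym add_V, metis ip_scale ip_sym scale_V, metis ip_diff ip_sym diff_V)

lemmas ip_simps = ip_add ip_scale ip_diff ip_add_right ip_scale_right ip_diff_right

lemma nrm_ge_0: "x \<in> V \<Longrightarrow> 0 \<le> nrm x"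
  by (simp add: nrm_def ip_nonneg)

lemma nrm_square: "x \<in> V \<Longrightarrow> (nrm x)\<^sup>2 = ip x x"
  by (simp add: nrm_def ip_nonneg)

lemma cauchy_schwarz:
  assumes x: "x \<in> V" and y: "y \<in> V"
  shows "\<bar>ip x y\<bar> \<le> nrm x * nrm y"
proof -
  have sym: "ip y x = ip x y" using ip_sym x y by blast
  have q: "0 \<le> ip x x + 2 * t * ip x y + t\<^sup>2 * ip y y" for t
  proof -
    have "0 \<le> ip (x + t *\<^sub>R y) (x + t *\<^sub>R y)"
      by (intro ip_nonneg V_intros x y)
    then show ?thesis
      using x y by (simp add: ip_simps V_intros sym power2_eq_square algebra_simps)
  qed
  have "(ip x y)\<^sup>2 \<le> ip x x * ip y y"
  proof (cases "ip y y = 0")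
    case False
    then have pos: "ip y y > 0" using ip_nonneg[OF y] by simp
    \<comment> \<open>The quadratic in \<open>t\<close> is evaluated at its minimiser.\<close>
    have "0 \<le> ip x x + 2 * (- ip x y / ip y y) * ip x y + (- ip x y / ip y y)\<^sup>2 * ip y y"
      by (rule q)
    also have "\<dots> = ip x x - (ip x y)\<^sup>2 / ip y y"
      using pos by (simp add: field_simps power2_eq_square)
    finally show ?thesis using pos by (simp add: field_simps)
  next
    case True
    have "ip x y = 0"
    proof (rule ccontr)
      assume n: "ip x y \<noteq> 0"
      \<comment> \<open>Here \<open>y\<close> may be a nonzero vector of norm 0, so the quadratic
        degenerates to an affine function of \<open>t\<close>. At this \<open>t\<close> it would
        equal -1.\<close>
      have "0 \<le> ip x x + 2 * (- (ip x x + 1) / (2 * ip x y)) * ip x y"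
        using q[of "- (ip x x + 1) / (2 * ip x y)"] True by simp
      then show False using n by (simp add: field_simps)
    qed
    then show ?thesis using True by simp
  qed
  then have "sqrt ((ip x y)\<^sup>2) \<le> sqrt (ip x x * ip y y)" by (rule real_sqrt_le_mono)
  then show ?thesis by (simp add: nrm_def real_sqrt_mult)
qed

lemma nrm_scale: "x \<in> V \<Longrightarrow> nrm (c *\<^sub>R x) = \<bar>c\<bar> * nrm x"
  by (simp add: nrm_def ip_simps V_intros real_sqrt_mult real_sqrt_abs2 mult.assoc[symmetric])

lemma nrm_triangle:
  assumes x: "x \<in> V" and y: "y \<in> V"
  shows "nrm (x + y) \<le> nrm x + nrm y"
proof (rule power2_le_imp_le)
  have "(nrm (x + y))\<^sup>2 = ip x x + 2 * ip x y + ip y y"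
    using x y by (simp add: nrm_square ip_simps V_intros ip_sym[of y x])
  also have "\<dots> \<le> (nrm x + nrm y)\<^sup>2"
    using cauchy_schwarz[OF x y] by (simp add: power2_sum nrm_square x y)
  finally show "(nrm (x + y))\<^sup>2 \<le> (nrm x + nrm y)\<^sup>2" .
qed (intro add_nonneg_nonneg nrm_ge_0 x y)

text \<open>Relative to a subset \<open>X\<close>, since functionals are needed on all of
  \<open>V\<close> and also on the span of a sequence.\<close>

definition dual_on :: "'v set \<Rightarrow> ('v \<Rightarrow> real) \<Rightarrow> bool" where
  "dual_on X l \<longleftrightarrow> (\<forall>x\<in>X. \<forall>y\<in>X. l (x + y) = l x + l y) \<and> (\<forall>c. \<forall>x\<in>X. l (c *\<^sub>R x) = c * l x) \<and>
     (\<exists>C. \<forall>x\<in>X. \<bar>l x\<bar> \<le> C * nrm x)"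

end

locale semi_hilbert = semi_inner +
  assumes complete: "\<lbrakk>\<And>n. X n \<in> V; \<And>e. e > 0 \<Longrightarrow> \<exists>N. \<forall>m\<ge>N. \<forall>n\<ge>N. nrm (X m - X n) < e\<rbrakk>
    \<Longrightarrow> \<exists>x\<in>V. (\<lambda>n. nrm (X n - x)) \<longlonglongrightarrow> 0"
begin

text \<open>Dirichlet principle: \<open>w\<close> is the limit of a minimising sequence of
  \<open>ip x x - 2 * F x\<close> on \<open>X\<close>. As \<open>X\<close> need not be closed,
  \<open>w\<close> is only found in \<open>V\<close>, and the last conjunct records that it lies in
  the closure of \<open>X\<close>.\<close>

lemma riesz:
  assumes X: "subspace X" "X \<subseteq> V" and F: "dual_on X F"
  shows "\<exists>w\<in>V. (\<forall>x\<in>X. ip w x = F x) \<and> (\<forall>e>0. \<exists>x\<in>X. nrm (x - w) < e)"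
proof -
  define J where "J = (\<lambda>x. ip x x - 2 * F x)"
  obtain C where C: "\<And>x. x \<in> X \<Longrightarrow> \<bar>F x\<bar> \<le> C * nrm x"
    using F unfolding dual_on_def by blast
  have F_add: "F (x + y) = F x + F y" if "x \<in> X" "y \<in> X" for x y
    using F that by (auto simp: dual_on_def)
  have F_scale: "F (c *\<^sub>R x) = c * F x" if "x \<in> X" for c x
    using F that by (auto simp: dual_on_def)
  have XV: "x \<in> V" if "x \<in> X" for x using X that by blast
  have X_add: "x + y \<in> X" if "x \<in> X" "y \<in> X" for x y
    using X that subspace_add by blast
  have X_scale: "c *\<^sub>R x \<in> X" if "x \<in> X" for c x
    using X that subspace_scale by blast
  have J_ge: "- C\<^sup>2 \<le> J x" if "x \<in> X" for x
  proof -
    have "0 \<le> (nrm x - C)\<^sup>2" by simp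
    also have "\<dots> = ip x x - 2 * (C * nrm x) + C\<^sup>2"
      using nrm_square[OF XV[OF that]] by (simp add: power2_diff)
    finally show ?thesis using C[OF that] by (simp add: J_def)
  qed
  define m where "m = Inf (J ` X)"
  have bdd: "bdd_below (J ` X)" using J_ge by (intro bdd_belowI[of _ "- C\<^sup>2"]) auto
  have ne: "J ` X \<noteq> {}" using subspace_0[OF X(1)] by auto
  have m_le: "m \<le> J x" if "x \<in> X" for x
    unfolding m_def using bdd that by (intro cInf_lower) auto
  have "\<exists>x\<in>X. J x < m + 1 / real (Suc k)" for k
  proof -
    have "Inf (J ` X) < m + 1 / real (Suc k)" by (simp add: m_def)
    then show ?thesis using cInf_lessD[OF ne] by auto
  qed
  then obtain x where x: "\<And>k. x k \<in> X" and Jx: "\<And>k. J (x k) < m + 1 / real (Suc k)"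
    by metis
  \<comment> \<open>Parallelogram law: \<open>J\<close> at the midpoint is at least
    \<open>m\<close>, which leaves little room for the distance of two near-minimisers.\<close>
  have close: "ip (x k - x l) (x k - x l) \<le> 2 / real (Suc k) + 2 / real (Suc l)" for k l
  proof -
    have "m \<le> J ((1/2) *\<^sub>R (x k + x l))" by (intro m_le X_scale X_add x)
    moreover have "4 * J ((1/2) *\<^sub>R (x k + x l)) =
        2 * J (x k) + 2 * J (x l) - ip (x k - x l) (x k - x l)"
      using x by (simp add: J_def ip_simps V_intros XV F_add F_scale X_add ip_sym[of "x l" "x k"])
        (simp add: field_simps)
    ultimately show ?thesis using Jx[of k] Jx[of l] by simp
  qed
  have "\<exists>w\<in>V. (\<lambda>n. nrm (x n - w)) \<longlonglongrightarrow> 0"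
  proof (rule complete)
    show "x n \<in> V" for n using x XV by blast
    fix e :: real assume e: "e > 0"
    then obtain N where N: "inverse (real (Suc N)) < e\<^sup>2 / 4"
      using reals_Archimedean[of "e\<^sup>2 / 4"] by auto
    show "\<exists>N. \<forall>m\<ge>N. \<forall>n\<ge>N. nrm (x m - x n) < e"
    proof (intro exI allI impI)
      fix k l assume kl: "k \<ge> N" "l \<ge> N"
      have *: "1 / real (Suc i) < e\<^sup>2 / 4" if "i \<ge> N" for i
        using N that by (intro le_less_trans[OF _ N]) (simp add: field_simps)
      have "ip (x k - x l) (x k - x l) < e\<^sup>2"
        using close[of k l] *[OF kl(1)] *[OF kl(2)] by simp
      then show "nrm (x k - x l) < e"
        using e by (simp add: nrm_def real_less_lsqrt)
    qed
  qed
  then obtain w where w: "w \<in> V" and lim: "(\<lambda>n. nrm (x n - w)) \<longlonglongrightarrow> 0" by blast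
  have lim_ip: "(\<lambda>n. ip (x n) y) \<longlonglongrightarrow> ip w y" if y: "y \<in> V" for y
  proof (rule LIM_zero_cancel, rule Lim_null_comparison)
    show "(\<lambda>n. nrm (x n - w) * nrm y) \<longlonglongrightarrow> 0"
      using tendsto_mult_right[OF lim, of "nrm y"] by simp
    have "\<bar>ip (x n) y - ip w y\<bar> \<le> nrm (x n - w) * nrm y" for n
      using cauchy_schwarz[of "x n - w" y] w y x XV by (simp add: ip_simps V_intros)
    then show "\<forall>\<^sub>F n in sequentially. norm (ip (x n) y - ip w y) \<le> nrm (x n - w) * nrm y"
      by simp
  qed
  have "ip w y = F y" if y: "y \<in> X" for y
  proof -
    \<comment> \<open>First variation in direction \<open>y\<close>. It is taken at
      \<open>x k\<close>, which lies in \<open>X\<close> and is minimal up to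
      \<open>1 / real (Suc k)\<close>, and reaches \<open>w\<close> only in the limit.\<close>
    have q: "0 \<le> 2 * t * (ip w y - F y) + t\<^sup>2 * ip y y" for t
    proof (rule tendsto_lowerbound)
      show "(\<lambda>k. 2 * t * (ip (x k) y - F y) + t\<^sup>2 * ip y y + 1 / real (Suc k))
         \<longlonglongrightarrow> 2 * t * (ip w y - F y) + t\<^sup>2 * ip y y"
        unfolding divide_inverse mult_1_left
        by (rule tendsto_eq_intros lim_ip XV y LIMSEQ_inverse_real_of_nat refl)+ simp
      have "0 \<le> 2 * t * (ip (x k) y - F y) + t\<^sup>2 * ip y y + 1 / real (Suc k)" for k
      proof -
        have "m \<le> J (x k + t *\<^sub>R y)" by (intro m_le X_add X_scale x y)
        moreover have "J (x k + t *\<^sub>R y) = J (x k) + 2 * t * (ip (x k) y - F y) + t\<^sup>2 * ip y y"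
          using x y by (simp add: J_def ip_simps V_intros XV F_add F_scale X_scale ip_sym[of y "x k"]
              power2_eq_square algebra_simps)
        ultimately show ?thesis using Jx[of k] by simp
      qed
      then show "\<forall>\<^sub>F k in sequentially. 0 \<le> 2 * t * (ip (x k) y - F y) + t\<^sup>2 * ip y y + 1 / real (Suc k)"
        by simp
    qed simp
    define d where "d = ip w y - F y"
    show ?thesis
    proof (rule ccontr)
      assume "ip w y \<noteq> F y"
      then have d: "d \<noteq> 0" by (simp add: d_def)
      \<comment> \<open>Close to the minimiser of the quadratic; the added 1 avoids division by 0
        when \<open>y\<close> has norm 0.\<close>
      define t where "t = - d / (ip y y + 1)"
      have yy: "ip y y + 1 > 0" using ip_nonneg[OF XV[OF y]] by simp
      have "2 * t * d + t\<^sup>2 * ip y y \<le> 2 * t * d + t\<^sup>2 * (ip y y + 1)"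
        by (simp add: mult_left_mono)
      also have "\<dots> = - (d\<^sup>2 / (ip y y + 1))"
      proof -
        have "t * (ip y y + 1) = - d" using yy by (simp add: t_def)
        then show ?thesis
          by (simp only: power2_eq_square mult.assoc) (simp add: t_def)
      qed
      also have "\<dots> < 0" using d yy by simp
      finally show False using q[of t] by (simp add: d_def)
    qed
  qed
  moreover have "\<exists>y\<in>X. nrm (y - w) < e" if "e > 0" for e
  proof -
    have "\<exists>n. nrm (x n - w) < e"
      using order_tendstoD(2)[OF lim that] by (rule eventually_happens'[OF sequentially_bot])
    then show ?thesis using x by blast
  qed
  ultimately show ?thesis using w by blast
qed

text \<open>Only the span \<open>X\<close> of the sequence matters. A diagonal subsequence makes the
  pairings with all \<open>x m\<close> converge, hence those with all of \<open>X\<close>; the limit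
  functional on \<open>X\<close> is represented by \<open>w\<close>. A functional \<open>l\<close>
  on \<open>V\<close> is replaced by a representative in the closure of \<open>X\<close>, where
  convergence is known by approximation.\<close>

theorem weak_compactness:
  assumes x: "\<And>n::nat. x n \<in> V" and bound: "\<And>n. nrm (x n) \<le> B"
  shows "\<exists>\<sigma> w. strict_mono \<sigma> \<and> w \<in> V \<and> (\<forall>l. dual_on V l \<longrightarrow> (\<lambda>n. l (x (\<sigma> n))) \<longlonglongrightarrow> l w)"
proof -
  have B: "0 \<le> B" using bound[of 0] nrm_ge_0[OF x, of 0] by simp
  obtain \<sigma> :: "nat \<Rightarrow> nat" where \<sigma>: "strict_mono \<sigma>"
    and conv: "\<And>m. \<exists>c. (\<lambda>n. ip (x (\<sigma> n)) (x m)) \<longlonglongrightarrow> c"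
  proof (rule function_convergent_subsequence[of "UNIV :: nat set" "\<lambda>n m. ip (x n) (x m)" "B * B"])
    show "norm (ip (x n) (x m)) \<le> B * B" for n m
      using cauchy_schwarz[OF x x, of n m] mult_mono[OF bound[of n] bound[of m] B nrm_ge_0[OF x]]
      by simp
  qed auto
  define X where "X = span (range x)"
  have sX: "subspace X" by (simp add: X_def)
  have XV: "X \<subseteq> V" unfolding X_def by (rule span_minimal) (use x subspace_V in auto)
  have convX: "\<exists>c. (\<lambda>n. ip (x (\<sigma> n)) y) \<longlonglongrightarrow> c" if "y \<in> X" for y
  proof -
    have "X \<subseteq> {y \<in> V. \<exists>c. (\<lambda>n. ip (x (\<sigma> n)) y) \<longlonglongrightarrow> c}"
      unfolding X_def
    proof (rule span_minimal)
      show "subspace {y \<in> V. \<exists>c. (\<lambda>n. ip (x (\<sigma> n)) y) \<longlonglongrightarrow> c}"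
      proof (rule subspaceI)
        have "ip v 0 = 0" if "v \<in> V" for v using ip_scale_right[OF zero_V that, of 0] by simp
        then show "0 \<in> {y \<in> V. \<exists>c. (\<lambda>n. ip (x (\<sigma> n)) y) \<longlonglongrightarrow> c}"
          using x by (auto simp: zero_V)
      next
        fix y z
        assume "y \<in> {y \<in> V. \<exists>c. (\<lambda>n. ip (x (\<sigma> n)) y) \<longlonglongrightarrow> c}"
          "z \<in> {y \<in> V. \<exists>c. (\<lambda>n. ip (x (\<sigma> n)) y) \<longlonglongrightarrow> c}"
        then obtain c d where "y \<in> V" "z \<in> V" "(\<lambda>n. ip (x (\<sigma> n)) y) \<longlonglongrightarrow> c"
          "(\<lambda>n. ip (x (\<sigma> n)) z) \<longlonglongrightarrow> d" by blast
        then have "(\<lambda>n. ip (x (\<sigma> n)) (y + z)) \<longlonglongrightarrow> c + d" "y + z \<in> V"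
          using tendsto_add x by (auto simp: ip_simps V_intros)
        then show "y + z \<in> {y \<in> V. \<exists>c. (\<lambda>n. ip (x (\<sigma> n)) y) \<longlonglongrightarrow> c}" by blast
      next
        fix a y
        assume "y \<in> {y \<in> V. \<exists>c. (\<lambda>n. ip (x (\<sigma> n)) y) \<longlonglongrightarrow> c}"
        then obtain c where "y \<in> V" "(\<lambda>n. ip (x (\<sigma> n)) y) \<longlonglongrightarrow> c" by blast
        then have "(\<lambda>n. ip (x (\<sigma> n)) (a *\<^sub>R y)) \<longlonglongrightarrow> a * c" "a *\<^sub>R y \<in> V"
          using tendsto_mult_left x by (auto simp: ip_simps V_intros)
        then show "a *\<^sub>R y \<in> {y \<in> V. \<exists>c. (\<lambda>n. ip (x (\<sigma> n)) y) \<longlonglongrightarrow> c}" by blast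
      qed
    qed (use conv x in auto)
    then show ?thesis using that by blast
  qed
  define F where "F = (\<lambda>y. lim (\<lambda>n. ip (x (\<sigma> n)) y))"
  have F: "(\<lambda>n. ip (x (\<sigma> n)) y) \<longlonglongrightarrow> F y" if "y \<in> X" for y
    using convX[OF that] unfolding F_def by (metis limI)
  have "dual_on X F"
    unfolding dual_on_def
  proof (intro conjI ballI allI exI)
    fix y z assume yz: "y \<in> X" "z \<in> X"
    have "(\<lambda>n. ip (x (\<sigma> n)) (y + z)) \<longlonglongrightarrow> F y + F z"
      using tendsto_add[OF F F, OF yz] XV yz x by (simp add: ip_simps subset_eq)
    then show "F (y + z) = F y + F z"
      using LIMSEQ_unique F[OF subspace_add[OF sX yz]] by blast
  next
    fix c y assume y: "y \<in> X"
    have "(\<lambda>n. ip (x (\<sigma> n)) (c *\<^sub>R y)) \<longlonglongrightarrow> c * F y"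
      using tendsto_mult_left[OF F, OF y] XV y x by (simp add: ip_simps subset_eq)
    then show "F (c *\<^sub>R y) = c * F y"
      using LIMSEQ_unique F[OF subspace_scale[OF sX y]] by blast
  next
    fix y assume y: "y \<in> X"
    have "\<bar>ip (x (\<sigma> n)) y\<bar> \<le> B * nrm y" for n
      using cauchy_schwarz[OF x, of y "\<sigma> n"] mult_right_mono[OF bound nrm_ge_0, of y "\<sigma> n"] XV y
      by fastforce
    then show "\<bar>F y\<bar> \<le> B * nrm y"
      using tendsto_upperbound[OF tendsto_rabs[OF F[OF y]]] by simp
  qed
  from riesz[OF sX XV this] obtain w where w: "w \<in> V" "\<And>y. y \<in> X \<Longrightarrow> ip w y = F y"
    "\<And>e. e > 0 \<Longrightarrow> \<exists>y\<in>X. nrm (y - w) < e" by blast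
  have "(\<lambda>n. l (x (\<sigma> n))) \<longlonglongrightarrow> l w" if l: "dual_on V l" for l
  proof -
    \<comment> \<open>Restricting \<open>l\<close> to \<open>X\<close> before representing it puts
      \<open>z\<close> into the closure of \<open>X\<close>. It still gives the right values,
      because every \<open>x (\<sigma> n)\<close> lies in \<open>X\<close>.\<close>
    have "dual_on X l" using l XV unfolding dual_on_def by (meson subset_iff)
    from riesz[OF sX XV this] obtain z where z: "z \<in> V" "\<And>y. y \<in> X \<Longrightarrow> ip z y = l y"
      "\<And>e. e > 0 \<Longrightarrow> \<exists>y\<in>X. nrm (y - z) < e" by blast
    obtain C where C: "\<And>y. y \<in> V \<Longrightarrow> \<bar>l y\<bar> \<le> C * nrm y"
      using l unfolding dual_on_def by blast
    have l_diff: "l (a - b) = l a - l b" if "a \<in> V" "b \<in> V" for a b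
    proof -
      have "l (a + (-1) *\<^sub>R b) = l a + l ((-1) *\<^sub>R b)" "l ((-1) *\<^sub>R b) = (-1) * l b"
        using l that scale_V unfolding dual_on_def by blast+
      then show ?thesis by simp
    qed
    \<comment> \<open>Both sides are continuous in \<open>w\<close> and agree on \<open>X\<close>,
      and \<open>w\<close> is in the closure of \<open>X\<close>.\<close>
    have lw: "l w = ip z w"
    proof (rule ccontr)
      assume "l w \<noteq> ip z w"
      define e where "e = \<bar>l w - ip z w\<bar> / (\<bar>C\<bar> + nrm z + 1)"
      have pos: "\<bar>C\<bar> + nrm z + 1 > 0" using nrm_ge_0[OF z(1)] by linarith
      have "e > 0" using pos \<open>l w \<noteq> ip z w\<close> by (simp add: e_def)
      then obtain y where y: "y \<in> X" "nrm (y - w) < e" using w(3) by blast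
      have yV: "y \<in> V" using y XV by blast
      have "\<bar>l w - ip z w\<bar> = \<bar>ip z (y - w) - l (y - w)\<bar>"
        using z(2)[OF y(1)] by (simp add: l_diff yV w ip_simps z)
      also have "\<dots> \<le> nrm z * nrm (y - w) + C * nrm (y - w)"
        using cauchy_schwarz[OF z(1) diff_V[OF yV w(1)]] C[OF diff_V[OF yV w(1)]] by linarith
      also have "\<dots> \<le> (\<bar>C\<bar> + nrm z) * nrm (y - w)"
        using nrm_ge_0[OF diff_V[OF yV w(1)]] mult_right_mono[of C "\<bar>C\<bar>" "nrm (y - w)"]
        by (simp add: distrib_right)
      also have "\<dots> \<le> (\<bar>C\<bar> + nrm z) * e"
        using y nrm_ge_0[OF z(1)] by (intro mult_left_mono) auto
      also have "\<dots> < (\<bar>C\<bar> + nrm z + 1) * e" using \<open>e > 0\<close> by simp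
      also have "\<dots> = \<bar>l w - ip z w\<bar>" using pos by (simp add: e_def)
      finally show False by simp
    qed
    have "(\<lambda>n. ip z (x (\<sigma> n))) \<longlonglongrightarrow> ip z w"
    proof (rule LIMSEQ_I)
      fix r :: real assume r: "r > 0"
      \<comment> \<open>Bounds the norms of all \<open>x (\<sigma> n) - w\<close>, so replacing
        \<open>z\<close> by the nearby \<open>y\<close> costs at most \<open>r / 2\<close>.\<close>
      define K where "K = B + nrm w + 1"
      have K: "K > 0" using B nrm_ge_0[OF w(1)] by (simp add: K_def)
      then obtain y where y: "y \<in> X" "nrm (y - z) < r / (2 * K)"
        using z(3)[of "r / (2 * K)"] r by auto
      have yV: "y \<in> V" using y XV by blast
      have "(\<lambda>n. ip (x (\<sigma> n)) y) \<longlonglongrightarrow> ip w y" using F[OF y(1)] w(2)[OF y(1)] by simp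
      from LIMSEQ_D[OF this, of "r / 2"] r obtain N
        where N: "\<And>n. n \<ge> N \<Longrightarrow> \<bar>ip (x (\<sigma> n)) y - ip w y\<bar> < r / 2" by auto
      show "\<exists>N. \<forall>n\<ge>N. norm (ip z (x (\<sigma> n)) - ip z w) < r"
      proof (intro exI allI impI)
        fix n assume n: "N \<le> n"
        let ?v = "x (\<sigma> n) - w"
        have vV: "?v \<in> V" by (intro V_intros x w)
        have "ip z (x (\<sigma> n)) - ip z w = (ip (x (\<sigma> n)) y - ip w y) - ip (y - z) ?v"
          using x w z yV by (simp add: ip_simps V_intros ip_sym[of y])
        moreover have "\<bar>ip (y - z) ?v\<bar> \<le> nrm (y - z) * nrm ?v"
          by (intro cauchy_schwarz V_intros yV z vV)
        moreover have "nrm ?v \<le> K"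
          using nrm_triangle[OF x minus_V[OF w(1)], of "\<sigma> n"] bound[of "\<sigma> n"] nrm_scale[OF w(1), of "-1"]
          by (simp add: K_def)
        then have "nrm (y - z) * nrm ?v \<le> r / (2 * K) * K"
          using y nrm_ge_0[OF vV] r K by (intro mult_mono) auto
        moreover have "r / (2 * K) * K = r / 2" using K by simp
        ultimately show "norm (ip z (x (\<sigma> n)) - ip z w) < r"
          using N[OF n] unfolding real_norm_def by linarith
      qed
    qed
    moreover have "ip z (x (\<sigma> n)) = l (x (\<sigma> n))" for n
      by (rule z(2)) (simp add: X_def span_base)
    ultimately show ?thesis using lw by simp
  qed
  then show ?thesis using \<sigma> w by blast
qed

end

section \<open>The space $L^2$\<close>

lemma L2_D:
  assumes "f \<in> L2 M"
  shows "f \<in> borel_measurable M" "integrable M (\<lambda>x. (norm (f x))\<^sup>2)"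
  using assms by (auto simp: L2_def)

lemma L2_bounded_by:
  assumes f: "f \<in> borel_measurable M" and g: "integrable M g"
    and le: "AE x in M. (norm (f x))\<^sup>2 \<le> g x"
  shows "f \<in> L2 M"
  unfolding L2_def
proof (intro CollectI conjI f)
  show "integrable M (\<lambda>x. (norm (f x))\<^sup>2)"
    by (rule Bochner_Integration.integrable_bound[OF g]) (use f le in auto)
qed

lemma square_norm_add_le: "(norm (a + b))\<^sup>2 \<le> 2 * (norm a)\<^sup>2 + 2 * (norm b)\<^sup>2"
  for a b :: "'b::real_normed_vector"
proof -
  have "(norm (a + b))\<^sup>2 \<le> (norm a + norm b)\<^sup>2"
    by (intro power_mono norm_triangle_ineq) auto
  also have "\<dots> \<le> 2 * (norm a)\<^sup>2 + 2 * (norm b)\<^sup>2"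
    using sum_squares_bound[of "norm a" "norm b"] by (simp add: power2_sum)
  finally show ?thesis .
qed

lemma subspace_L2: "subspace (L2 M :: ('a \<Rightarrow> 'b::euclidean_space) set)"
proof (rule subspaceI)
  fix f g :: "'a \<Rightarrow> 'b" assume fg: "f \<in> L2 M" "g \<in> L2 M"
  show "f + g \<in> L2 M"
  proof (rule L2_bounded_by)
    show "integrable M (\<lambda>x. 2 * (norm (f x))\<^sup>2 + 2 * (norm (g x))\<^sup>2)"
      using fg[THEN L2_D(2)] by simp
    show "f + g \<in> borel_measurable M"
      using fg[THEN L2_D(1)] by (simp add: plus_fun_def)
  qed (simp add: square_norm_add_le)
next
  fix c and f :: "'a \<Rightarrow> 'b" assume "f \<in> L2 M"
  then show "c *\<^sub>R f \<in> L2 M"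
    by (auto simp: L2_def scaleR_fun_def power_mult_distrib)
qed (simp add: L2_def zero_fun_def)

lemma L2_diff: "f \<in> L2 M \<Longrightarrow> g \<in> L2 M \<Longrightarrow> (\<lambda>x. f x - g x) \<in> L2 M"
  using subspace_diff[OF subspace_L2, of f M g] by (simp add: fun_diff_def)

lemma L2_norm: "f \<in> L2 M \<Longrightarrow> (\<lambda>x. norm (f x)) \<in> L2 M"
  by (auto simp: L2_def)

lemma l2_norm_norm: "l2_norm M (\<lambda>x. norm (f x)) = l2_norm M f"
  by (simp add: l2_norm_def)

lemma integrable_inner_L2:
  assumes f: "f \<in> L2 M" and g: "g \<in> L2 M"
  shows "integrable M (\<lambda>x. f x \<bullet> g x)"
proof (rule Bochner_Integration.integrable_bound)
  show "integrable M (\<lambda>x. (norm (f x))\<^sup>2 + (norm (g x))\<^sup>2)"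
    using f g by (auto dest: L2_D)
  show "(\<lambda>x. f x \<bullet> g x) \<in> borel_measurable M"
    using L2_D(1)[OF f] L2_D(1)[OF g] by measurable
  have "\<bar>f x \<bullet> g x\<bar> \<le> (norm (f x))\<^sup>2 + (norm (g x))\<^sup>2" for x
  proof -
    have "2 * norm (f x) * norm (g x) \<le> (norm (f x))\<^sup>2 + (norm (g x))\<^sup>2"
      by (rule sum_squares_bound)
    moreover have "0 \<le> norm (f x) * norm (g x)" by simp
    ultimately show ?thesis
      using Cauchy_Schwarz_ineq2[of "f x" "g x"] by linarith
  qed
  then show "AE x in M. norm (f x \<bullet> g x) \<le> norm ((norm (f x))\<^sup>2 + (norm (g x))\<^sup>2)"
    by simp
qed

lemma integrable_mult_L2:
  fixes f g :: "'a \<Rightarrow> real"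
  assumes "f \<in> L2 M" "g \<in> L2 M"
  shows "integrable M (\<lambda>x. f x * g x)"
  using integrable_inner_L2[OF assms] by simp

interpretation l2: semi_inner "L2 M" "\<lambda>f g. \<integral>x. f x \<bullet> g x \<partial>M" for M
proof
  show "subspace (L2 M)" by (rule subspace_L2)
qed (auto simp: inner_add_left integrable_inner_L2 intro: Bochner_Integration.integral_cong inner_commute)

lemma l2_nrm: "l2.nrm M f = l2_norm M f"
  by (simp add: l2.nrm_def l2_norm_def power2_norm_eq_inner)

lemma l2_norm_nonneg [simp]: "0 \<le> l2_norm M f"
  by (simp add: l2_norm_def)

lemma l2_norm_square: "(l2_norm M f)\<^sup>2 = (\<integral>x. (norm (f x))\<^sup>2 \<partial>M)"
  by (simp add: l2_norm_def)

lemma l2_cauchy_schwarz: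
  fixes f g :: "'a \<Rightarrow> real"
  assumes "f \<in> L2 M" "g \<in> L2 M"
  shows "\<bar>\<integral>x. f x * g x \<partial>M\<bar> \<le> l2_norm M f * l2_norm M g"
  using l2.cauchy_schwarz[OF assms] unfolding l2_nrm by simp

lemma l2_norm_AE_cong:
  assumes "f \<in> borel_measurable M" "g \<in> borel_measurable M" "AE x in M. f x = g x"
  shows "l2_norm M f = l2_norm M g"
  unfolding l2_norm_def using assms by (intro arg_cong[of _ _ sqrt] integral_cong_AE) auto

lemma l2_norm_eq_0_iff:
  assumes "f \<in> L2 M"
  shows "l2_norm M f = 0 \<longleftrightarrow> (AE x in M. f x = 0)"
  using integral_nonneg_eq_0_iff_AE[OF L2_D(2)[OF assms]] by (simp add: l2_norm_def)

lemma L2_component: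
  assumes "g \<in> L2 M"
  shows "(\<lambda>x. g x \<bullet> i) \<in> L2 M"
proof (rule L2_bounded_by)
  show "(\<lambda>x. g x \<bullet> i) \<in> borel_measurable M" using L2_D(1)[OF assms] by measurable
  show "integrable M (\<lambda>x. (norm i)\<^sup>2 * (norm (g x))\<^sup>2)" using L2_D(2)[OF assms] by simp
  have "\<bar>g x \<bullet> i\<bar>\<^sup>2 \<le> (norm (g x) * norm i)\<^sup>2" for x
    by (intro power_mono Cauchy_Schwarz_ineq2) simp
  then show "AE x in M. (norm (g x \<bullet> i))\<^sup>2 \<le> (norm i)\<^sup>2 * (norm (g x))\<^sup>2"
    by (intro AE_I2) (simp add: power_mult_distrib mult.commute)
qed

lemma l2_norm_component_le:
  assumes g: "g \<in> L2 M" and i: "i \<in> Basis"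
  shows "l2_norm M (\<lambda>x. g x \<bullet> i) \<le> l2_norm M g"
proof -
  have "(g x \<bullet> i)\<^sup>2 \<le> (norm (g x))\<^sup>2" for x
    using power_mono[OF Basis_le_norm[OF i, of "g x"], of 2] by simp
  then show ?thesis
    unfolding l2_norm_def using L2_D(2)[OF L2_component[OF g, of i]] L2_D(2)[OF g]
    by (intro real_sqrt_le_mono integral_mono) auto
qed

section \<open>Completeness of $L^2$ over a finite measure\<close>

context finite_measure
begin

lemma L2_const: "(\<lambda>_. c) \<in> L2 M"
  by (simp add: L2_def)

lemma integrable_L2:
  assumes f: "f \<in> L2 M"
  shows "integrable M f"
proof -
  have "integrable M (\<lambda>x. norm (f x))"
    using integrable_mult_L2[OF L2_norm[OF f] L2_const[of 1]] by simp
  then show ?thesis using L2_D(1)[OF f] integrable_norm_cancel by blast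
qed

lemma integral_norm_le_l2_norm:
  assumes f: "f \<in> L2 M"
  shows "(\<integral>x. norm (f x) \<partial>M) \<le> l2_norm M f * sqrt (measure M (space M))"
  using l2_cauchy_schwarz[OF L2_norm[OF f] L2_const[of 1]]
  by (simp add: l2_norm_norm) (simp add: l2_norm_def)

text \<open>Finiteness of the measure turns an $L^2$ Cauchy sequence into an $L^1$ Cauchy sequence,
  which has an almost everywhere convergent subsequence. Fatou's lemma along it returns to
  $L^2$.\<close>

lemma L2_complete:
  fixes X :: "nat \<Rightarrow> 'a \<Rightarrow> 'b::euclidean_space"
  assumes X: "\<And>n. X n \<in> L2 M"
    and cauchy: "\<And>e. e > 0 \<Longrightarrow> \<exists>N. \<forall>m\<ge>N. \<forall>n\<ge>N. l2_norm M (\<lambda>x. X m x - X n x) < e"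
  shows "\<exists>f\<in>L2 M. (\<lambda>n. l2_norm M (\<lambda>x. X n x - f x)) \<longlonglongrightarrow> 0"
proof -
  have meas [measurable]: "X n \<in> borel_measurable M" for n by (rule L2_D(1)[OF X])
  obtain r where r: "strict_mono r" and conv: "AE x in M. Cauchy (\<lambda>i. X (r i) x)"
  proof (rule cauchy_L1_AE_cauchy_subseq[of M X])
    show "integrable M (X n)" for n by (intro integrable_L2 X)
    fix e :: real assume e: "e > 0"
    \<comment> \<open>The added 1 keeps the divisor positive when the measure is 0.\<close>
    define K where "K = sqrt (measure M (space M)) + 1"
    have K: "K > 0" by (simp add: K_def add_nonneg_pos)
    obtain N where N: "\<And>m n. m \<ge> N \<Longrightarrow> n \<ge> N \<Longrightarrow> l2_norm M (\<lambda>x. X m x - X n x) < e / K"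
      using cauchy[of "e / K"] e K by (auto simp del: l2_norm_def)
    have "(\<integral>x. norm (X i x - X j x) \<partial>M) < e" if "i \<ge> N" "j \<ge> N" for i j
    proof -
      have "(\<integral>x. norm (X i x - X j x) \<partial>M) \<le> l2_norm M (\<lambda>x. X i x - X j x) * K"
        using integral_norm_le_l2_norm[OF L2_diff[OF X X], of i j]
        by (simp add: K_def distrib_left add_increasing2)
      also have "\<dots> < e / K * K" using N[OF that] K by (intro mult_strict_right_mono) auto
      finally show ?thesis using K by simp
    qed
    then show "\<exists>N. \<forall>i\<ge>N. \<forall>j\<ge>N. (\<integral>x. norm (X i x - X j x) \<partial>M) < e" by blast
  qed
  define f where "f = (\<lambda>x. lim (\<lambda>i. X (r i) x))"
  have f_meas [measurable]: "f \<in> borel_measurable M"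
    unfolding f_def by measurable
  have lim: "AE x in M. (\<lambda>i. X (r i) x) \<longlonglongrightarrow> f x"
    using conv unfolding f_def by eventually_elim (simp add: Cauchy_convergent convergent_LIMSEQ_iff[symmetric])
  \<comment> \<open>Fatou's lemma in the second index of the Cauchy condition; finiteness of the
    bound also yields that the difference is in $L^2$.\<close>
  have key: "(\<lambda>x. X m x - f x) \<in> L2 M \<and> l2_norm M (\<lambda>x. X m x - f x) \<le> e"
    if e: "e > 0" and N: "\<And>m n. m \<ge> N \<Longrightarrow> n \<ge> N \<Longrightarrow> l2_norm M (\<lambda>x. X m x - X n x) < e" and m: "m \<ge> N"
    for e N m
  proof -
    have "(\<integral>\<^sup>+x. ennreal ((norm (X m x - f x))\<^sup>2) \<partial>M) =
        (\<integral>\<^sup>+x. liminf (\<lambda>i. ennreal ((norm (X m x - X (r i) x))\<^sup>2)) \<partial>M)"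
    proof (rule nn_integral_cong_AE)
      show "AE x in M. ennreal ((norm (X m x - f x))\<^sup>2) = liminf (\<lambda>i. ennreal ((norm (X m x - X (r i) x))\<^sup>2))"
        using lim
      proof eventually_elim
        case (elim x)
        then have "(\<lambda>i. ennreal ((norm (X m x - X (r i) x))\<^sup>2)) \<longlonglongrightarrow> ennreal ((norm (X m x - f x))\<^sup>2)"
          by (intro tendsto_intros tendsto_ennrealI)
        from lim_imp_Liminf[OF sequentially_bot this] show ?case by (rule sym)
      qed
    qed
    also have "\<dots> \<le> liminf (\<lambda>i. \<integral>\<^sup>+x. ennreal ((norm (X m x - X (r i) x))\<^sup>2) \<partial>M)"
      by (rule nn_integral_liminf) measurable
    also have "\<dots> \<le> ennreal (e\<^sup>2)"
    proof (rule Liminf_le)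
      have "(\<integral>\<^sup>+x. ennreal ((norm (X m x - X (r i) x))\<^sup>2) \<partial>M) \<le> ennreal (e\<^sup>2)" if "i \<ge> N" for i
      proof -
        have "r i \<ge> N" using seq_suble[OF r, of i] that by simp
        have "(\<integral>\<^sup>+x. ennreal ((norm (X m x - X (r i) x))\<^sup>2) \<partial>M) =
            ennreal ((l2_norm M (\<lambda>x. X m x - X (r i) x))\<^sup>2)"
          unfolding l2_norm_square
          by (rule nn_integral_eq_integral) (use L2_D(2)[OF L2_diff[OF X X]] in auto)
        also have "\<dots> \<le> ennreal (e\<^sup>2)"
          using N[OF m \<open>r i \<ge> N\<close>] by (intro ennreal_leI power_mono) auto
        finally show ?thesis .
      qed
      then show "\<forall>\<^sub>F i in sequentially. (\<integral>\<^sup>+x. ennreal ((norm (X m x - X (r i) x))\<^sup>2) \<partial>M) \<le> ennreal (e\<^sup>2)"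
        unfolding eventually_sequentially by blast
    qed simp
    finally have le: "(\<integral>\<^sup>+x. ennreal ((norm (X m x - f x))\<^sup>2) \<partial>M) \<le> ennreal (e\<^sup>2)" .
    then have int: "integrable M (\<lambda>x. (norm (X m x - f x))\<^sup>2)"
      by (intro integrableI_bounded) (auto intro: le_less_trans)
    then have "ennreal ((l2_norm M (\<lambda>x. X m x - f x))\<^sup>2) \<le> ennreal (e\<^sup>2)"
      using le unfolding l2_norm_square by (subst (asm) nn_integral_eq_integral) auto
    then have "(l2_norm M (\<lambda>x. X m x - f x))\<^sup>2 \<le> e\<^sup>2" by simp
    then have "l2_norm M (\<lambda>x. X m x - f x) \<le> e" using e power2_le_imp_le by fastforce
    moreover have "(\<lambda>x. X m x - f x) \<in> L2 M" using int by (simp add: L2_def)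
    ultimately show ?thesis by blast
  qed
  have "f \<in> L2 M"
  proof -
    obtain N where "\<And>m n. m \<ge> N \<Longrightarrow> n \<ge> N \<Longrightarrow> l2_norm M (\<lambda>x. X m x - X n x) < 1"
      using cauchy[of 1] by auto
    then have "(\<lambda>x. X N x - f x) \<in> L2 M" using key[of 1 N N] by simp
    from L2_diff[OF X[of N] this] show ?thesis by simp
  qed
  moreover have "(\<lambda>n. l2_norm M (\<lambda>x. X n x - f x)) \<longlonglongrightarrow> 0"
  proof (rule LIMSEQ_I)
    fix e :: real assume e: "e > 0"
    obtain N where N: "\<And>m n. m \<ge> N \<Longrightarrow> n \<ge> N \<Longrightarrow> l2_norm M (\<lambda>x. X m x - X n x) < e / 2"
      using cauchy[of "e / 2"] e by auto
    have "norm (l2_norm M (\<lambda>x. X m x - f x) - 0) < e" if "m \<ge> N" for m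
      using key[OF _ N that] e by force
    then show "\<exists>N. \<forall>n\<ge>N. norm (l2_norm M (\<lambda>x. X n x - f x) - 0) < e" by blast
  qed
  ultimately show ?thesis by blast
qed

end

section \<open>Smooth bump functions\<close>

text \<open>This family is closed under differentiation up to linear combinations.\<close>

definition flat_exp :: "nat \<Rightarrow> real \<Rightarrow> real" where
  "flat_exp m t = (if t > 0 then exp (- 1 / t) / t ^ m else 0)"

text \<open>From the right, the substitution of \<open>inverse t\<close> reduces it to the
  exponential outgrowing every power.\<close>

lemma flat_exp_tendsto_0: "(flat_exp m \<longlongrightarrow> 0) (at 0)"
  unfolding filterlim_at_split
proof
  have "\<forall>\<^sub>F t in at_left 0. flat_exp m t = 0"
    unfolding eventually_at_filter by (simp add: flat_exp_def)
  then show "(flat_exp m \<longlongrightarrow> 0) (at_left 0)" by (simp add: tendsto_eventually)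
  have "((\<lambda>t. (inverse t) ^ m / exp (inverse t)) \<longlongrightarrow> (0::real)) (at_right 0)"
    by (rule filterlim_compose[OF tendsto_power_div_exp_0 filterlim_inverse_at_top_right])
  moreover have "\<forall>\<^sub>F t in at_right 0. (inverse t) ^ m / exp (inverse t) = flat_exp m t"
    unfolding eventually_at_filter
    by (simp add: flat_exp_def exp_minus divide_inverse power_inverse)
  ultimately show "(flat_exp m \<longlongrightarrow> 0) (at_right 0)"
    by (rule Lim_transform_eventually)
qed

lemma DERIV_flat_exp:
  "(flat_exp m has_real_derivative (flat_exp (m + 2) t - real m * flat_exp (m + 1) t)) (at t)"
proof -
  consider "t > 0" | "t < 0" | "t = 0" by linarith
  then show ?thesis
  proof cases
    case 1
    have "((\<lambda>t. exp (- 1 / t) / t ^ m) has_real_derivative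
        (flat_exp (m + 2) t - real m * flat_exp (m + 1) t)) (at t)"
    proof (cases m)
      case (Suc k)
      have "t * t ^ (k - Suc 0) = t ^ k" if "k \<noteq> 0" using that by (cases k) auto
      then show ?thesis
        unfolding Suc using 1 by (cases "k = 0") (auto intro!: derivative_eq_intros
            simp: flat_exp_def divide_simps power2_eq_square, simp_all add: algebra_simps)
    qed (use 1 in \<open>auto intro!: derivative_eq_intros simp: flat_exp_def divide_simps power2_eq_square\<close>)
    moreover have "\<forall>\<^sub>F y in nhds t. y > 0"
      using 1 eventually_nhds_in_open[of "{0<..}" t] by simp
    then have ev: "\<forall>\<^sub>F y in nhds t. exp (- 1 / y) / y ^ m = flat_exp m y"
      by eventually_elim (simp add: flat_exp_def)
    ultimately show ?thesis unfolding DERIV_cong_ev[OF refl ev refl] by simp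
  next
    case 2
    have "\<forall>\<^sub>F y in nhds t. y < 0"
      using 2 eventually_nhds_in_open[of "{..<0}" t] by simp
    then have ev: "\<forall>\<^sub>F y in nhds t. 0 = flat_exp m y"
      by eventually_elim (simp add: flat_exp_def)
    moreover have "((\<lambda>_. 0) has_real_derivative (flat_exp (m + 2) t - real m * flat_exp (m + 1) t)) (at t)"
      using 2 by (simp add: flat_exp_def)
    ultimately show ?thesis using DERIV_cong_ev[OF refl ev refl] by simp
  next
    case 3
    \<comment> \<open>At the origin the difference quotient is again a member of the family, so its
      limit is already known.\<close>
    have "(\<lambda>h. (flat_exp m (0 + h) - flat_exp m 0) / h) = flat_exp (m + 1)"
      by (auto simp: flat_exp_def fun_eq_iff)
    then show ?thesis
      using 3 flat_exp_tendsto_0[of "m + 1"] by (simp add: DERIV_def flat_exp_def)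
  qed
qed

section \<open>Calculus of the classes \<open>Ck\<close>\<close>

lemma Ck_SucI:
  assumes "\<And>x. (\<phi> has_derivative \<phi>' x) (at x)" "\<And>i. i \<in> Basis \<Longrightarrow> Ck k (\<lambda>x. \<phi>' x i)"
  shows "Ck (Suc k) \<phi>"
proof -
  have "frechet_derivative \<phi> (at x) = \<phi>' x" for x
    using frechet_derivative_at[OF assms(1)] by simp
  then show ?thesis using assms by (auto simp: differentiable_def)
qed

lemma Ck_has_derivative:
  "Ck (Suc k) \<phi> \<Longrightarrow> (\<phi> has_derivative frechet_derivative \<phi> (at x)) (at x)"
  by (simp add: frechet_derivative_works[symmetric])

lemma Ck_Suc_imp: "Ck (Suc k) \<phi> \<Longrightarrow> Ck k \<phi>"
proof (induction k arbitrary: \<phi>)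
  case 0
  then show ?case
    by (auto intro!: differentiable_imp_continuous_on simp: differentiable_on_def)
next
  case (Suc k)
  then show ?case by auto
qed

lemma Ck_const: "Ck k (\<lambda>_. c)"
  by (induction k arbitrary: c) (auto simp: frechet_derivative_const)

lemma Ck_add: "Ck k f \<Longrightarrow> Ck k g \<Longrightarrow> Ck k (\<lambda>x. f x + g x)"
proof (induction k arbitrary: f g)
  case (Suc k)
  show ?case
  proof (rule Ck_SucI)
    show "((\<lambda>x. f x + g x) has_derivative
        (\<lambda>h. frechet_derivative f (at x) h + frechet_derivative g (at x) h)) (at x)" for x
      by (intro has_derivative_add Ck_has_derivative[OF Suc.prems(1)] Ck_has_derivative[OF Suc.prems(2)])
  qed (use Suc in auto)
qed (auto intro: continuous_intros)

lemma Ck_mult: "Ck k f \<Longrightarrow> Ck k g \<Longrightarrow> Ck k (\<lambda>x. f x * g x)"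
proof (induction k arbitrary: f g)
  case (Suc k)
  show ?case
  proof (rule Ck_SucI)
    show "((\<lambda>x. f x * g x) has_derivative
        (\<lambda>h. f x * frechet_derivative g (at x) h + frechet_derivative f (at x) h * g x)) (at x)" for x
      by (intro has_derivative_mult Ck_has_derivative[OF Suc.prems(1)] Ck_has_derivative[OF Suc.prems(2)])
    show "Ck k (\<lambda>x. f x * frechet_derivative g (at x) i + frechet_derivative f (at x) i * g x)"
      if "i \<in> Basis" for i
      using Suc.prems that Suc.prems[THEN Ck_Suc_imp] by (intro Ck_add Suc.IH) auto
  qed
qed (auto intro: continuous_intros)

lemma Ck_prod: "finite I \<Longrightarrow> (\<And>i. i \<in> I \<Longrightarrow> Ck k (f i)) \<Longrightarrow> Ck k (\<lambda>x. \<Prod>i\<in>I. f i x)"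
  by (induction I rule: finite_induct) (auto intro: Ck_const Ck_mult)

text \<open>The induction on \<open>k\<close> must leave \<open>m\<close> free, as each derivative
  raises the index by 1 or 2.\<close>

lemma Ck_flat_exp: "Ck k (\<lambda>x. flat_exp m (x \<bullet> v + c))"
proof (induction k arbitrary: m)
  case 0
  have "isCont (flat_exp m) t" for t using DERIV_flat_exp DERIV_isCont by blast
  then have "continuous_on UNIV (flat_exp m)" by (simp add: continuous_at_imp_continuous_on)
  from continuous_on_compose2[OF this, of UNIV "\<lambda>x. x \<bullet> v + c"]
  show ?case by (simp add: continuous_intros)
next
  case (Suc k)
  show ?case
  proof (rule Ck_SucI)
    fix x
    have "((\<lambda>x. x \<bullet> v + c) has_derivative (\<lambda>h. h \<bullet> v)) (at x)"
      by (auto intro!: derivative_eq_intros)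
    from has_derivative_compose[OF this DERIV_flat_exp[of m, unfolded has_field_derivative_def]]
    show "((\<lambda>x. flat_exp m (x \<bullet> v + c)) has_derivative
        (\<lambda>h. (flat_exp (m + 2) (x \<bullet> v + c) + - real m * flat_exp (m + 1) (x \<bullet> v + c)) * (h \<bullet> v))) (at x)"
      by simp
    show "Ck k (\<lambda>x. (flat_exp (m + 2) (x \<bullet> v + c) + - real m * flat_exp (m + 1) (x \<bullet> v + c)) * (i \<bullet> v))" for i
      by (intro Ck_mult Ck_add Ck_const Suc.IH)
  qed
qed

text \<open>Smooth approximation of the indicator of \<open>box a b\<close>: as \<open>n\<close>
  grows, each factor tends to 1 where its argument is positive, and it is 0 elsewhere. The arguments
  are written in the affine form that \<open>Ck_flat_exp\<close> expects; \<open>bump_alt\<close> is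
  the readable form.\<close>

definition bump :: "nat \<Rightarrow> 'a::euclidean_space \<Rightarrow> 'a \<Rightarrow> 'a \<Rightarrow> real" where
  "bump n a b x = (\<Prod>i\<in>Basis. flat_exp 0 (x \<bullet> (real (Suc n) *\<^sub>R i) + - real (Suc n) * (a \<bullet> i)) *
     flat_exp 0 (x \<bullet> (- real (Suc n) *\<^sub>R i) + real (Suc n) * (b \<bullet> i)))"

lemma flat_exp_0: "flat_exp 0 t = (if t > 0 then exp (- 1 / t) else 0)"
  by (simp add: flat_exp_def)

lemma flat_exp_0_bounds: "0 \<le> flat_exp 0 t" "flat_exp 0 t \<le> 1"
  by (auto simp: flat_exp_0)

lemma bump_alt:
  "bump n a b x = (\<Prod>i\<in>Basis. flat_exp 0 (real (Suc n) * (x \<bullet> i - a \<bullet> i)) *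
     flat_exp 0 (real (Suc n) * (b \<bullet> i - x \<bullet> i)))"
  unfolding bump_def by (intro prod.cong refl arg_cong2[of _ _ _ _ "(*)"] arg_cong[of _ _ "flat_exp 0"])
    (simp_all add: algebra_simps)

lemma bump_bounds: "0 \<le> bump n a b x" "bump n a b x \<le> 1"
  unfolding bump_alt
  by (auto intro!: prod_nonneg prod_le_1 mult_nonneg_nonneg mult_le_one simp: flat_exp_0_bounds)

lemma bump_eq_0: "x \<notin> box a b \<Longrightarrow> bump n a b x = 0"
proof -
  assume "x \<notin> box a b"
  then obtain i where i: "i \<in> Basis" "x \<bullet> i - a \<bullet> i \<le> 0 \<or> b \<bullet> i - x \<bullet> i \<le> 0"
    by (force simp: mem_box)
  have "flat_exp 0 (real (Suc n) * t) = 0" if "t \<le> 0" for t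
    using mult_nonneg_nonpos[of "real (Suc n)" t] that by (simp add: flat_exp_0)
  then show ?thesis
    unfolding bump_alt using i by (intro prod_zero bexI[of _ i]) (auto simp del: of_nat_Suc)
qed

lemma bump_tendsto: "(\<lambda>n. bump n a b x) \<longlonglongrightarrow> indicator (box a b) x"
proof (cases "x \<in> box a b")
  case True
  have *: "(\<lambda>n. flat_exp 0 (real (Suc n) * t)) \<longlonglongrightarrow> 1" if "t > 0" for t
  proof -
    have "(\<lambda>n. exp (- inverse (real (Suc n)) / t)) \<longlonglongrightarrow> exp (- 0 / t)"
      using that by (intro tendsto_intros LIMSEQ_inverse_real_of_nat) auto
    moreover have "flat_exp 0 (real (Suc n) * t) = exp (- inverse (real (Suc n)) / t)" for n
      using that by (simp add: flat_exp_0 divide_simps zero_less_mult_iff)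
    ultimately show ?thesis by simp
  qed
  have "(\<lambda>n. bump n a b x) \<longlonglongrightarrow> (\<Prod>i\<in>(Basis :: 'a set). 1 * 1)"
    unfolding bump_alt using True by (intro tendsto_intros *) (auto simp: mem_box)
  then show ?thesis using True by simp
qed (simp add: bump_eq_0)

lemma bump_test_function:
  assumes "cbox a b \<subseteq> \<Omega>"
  shows "bump n a b \<in> test_functions \<Omega>"
proof -
  have "Ck k (bump n a b)" for k
    unfolding bump_def[abs_def] by (intro Ck_prod Ck_mult Ck_flat_exp finite_Basis)
  moreover have "bump n a b x = 0" if "x \<notin> cbox a b" for x
    using that box_subset_cbox bump_eq_0 by blast
  ultimately show ?thesis
    unfolding test_functions_def using assms by (auto intro!: exI[of _ "cbox a b"])
qed

section \<open>The fundamental lemma of the calculus of variations\<close>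

lemma test_function_D:
  assumes "\<phi> \<in> test_functions \<Omega>"
  shows "continuous_on UNIV \<phi>" "(\<phi> has_derivative frechet_derivative \<phi> (at x)) (at x)"
    "i \<in> Basis \<Longrightarrow> continuous_on UNIV (\<lambda>x. frechet_derivative \<phi> (at x) i)"
    "\<exists>K. compact K \<and> K \<subseteq> \<Omega> \<and> (\<forall>x. x \<notin> K \<longrightarrow> \<phi> x = 0 \<and> frechet_derivative \<phi> (at x) = (\<lambda>_. 0))"
proof -
  have Ck: "Ck k \<phi>" for k using assms by (simp add: test_functions_def)
  show "continuous_on UNIV \<phi>" using Ck[of 0] by simp
  show "(\<phi> has_derivative frechet_derivative \<phi> (at x)) (at x)" by (rule Ck_has_derivative[OF Ck])
  show "i \<in> Basis \<Longrightarrow> continuous_on UNIV (\<lambda>x. frechet_derivative \<phi> (at x) i)"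
    using Ck[of "Suc 0"] by simp
  obtain K where K: "compact K" "K \<subseteq> \<Omega>" "\<And>x. x \<notin> K \<Longrightarrow> \<phi> x = 0"
    using assms by (auto simp: test_functions_def)
  have "frechet_derivative \<phi> (at x) = (\<lambda>_. 0)" if "x \<notin> K" for x
  proof -
    have "(\<phi> has_derivative (\<lambda>_. 0)) (at x)"
    proof (rule has_derivative_transform_within_open)
      show "((\<lambda>_. 0) has_derivative (\<lambda>_. 0)) (at x)" by simp
      show "open (- K)" using K compact_imp_closed by blast
    qed (use that K in auto)
    then show ?thesis using frechet_derivative_at by metis
  qed
  then show "\<exists>K. compact K \<and> K \<subseteq> \<Omega> \<and> (\<forall>x. x \<notin> K \<longrightarrow> \<phi> x = 0 \<and> frechet_derivative \<phi> (at x) = (\<lambda>_. 0))"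
    using K by blast
qed

lemma compact_support_bounded:
  fixes f :: "'a::euclidean_space \<Rightarrow> real"
  assumes "continuous_on UNIV f" "compact K" "\<And>x. x \<notin> K \<Longrightarrow> f x = 0"
  obtains B where "B > 0" "\<And>x. \<bar>f x\<bar> \<le> B"
proof -
  have "bounded (f ` K)"
    using assms by (intro compact_imp_bounded compact_continuous_image) (auto intro: continuous_on_subset)
  then obtain B where "B > 0" "\<And>x. x \<in> K \<Longrightarrow> \<bar>f x\<bar> \<le> B"
    by (auto simp: bounded_pos)
  then show ?thesis using that[of B] assms(3) by (metis abs_zero less_imp_le)
qed

text \<open>Dynkin's pi-lambda theorem: open boxes generate the Borel sets and are stable under
  intersection.\<close>

lemma borel_sets_induct_box [consumes 1, case_names box empty compl union]:
  fixes A :: "'a::euclidean_space set"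
  assumes "A \<in> sets borel"
    and "\<And>a b. P (box a b)" "P {}" "\<And>A. A \<in> sets borel \<Longrightarrow> P A \<Longrightarrow> P (- A)"
    and "\<And>A. disjoint_family A \<Longrightarrow> range A \<subseteq> sets borel \<Longrightarrow> (\<And>i::nat. P (A i)) \<Longrightarrow> P (\<Union>i. A i)"
  shows "P A"
proof -
  define G where "G = range (\<lambda>(a, b). box a b :: 'a set)"
  have borel: "sets borel = sigma_sets UNIV G"
    unfolding borel_eq_box G_def by (rule sets_measure_of) simp
  have "Int_stable G"
    unfolding Int_stable_def G_def by (auto simp: box_Int_box)
  moreover have "G \<subseteq> Pow UNIV" by simp
  moreover have "A \<in> sigma_sets UNIV G" using assms(1) by (simp add: borel)
  ultimately show ?thesis
  proof (induction rule: sigma_sets_induct_disjoint)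
    case (basic A)
    then show ?case using assms(2) by (auto simp: G_def)
  next
    case (compl A)
    then show ?case using assms(4)[of A] by (simp add: borel Compl_eq_Diff_UNIV)
  next
    case (union A)
    then show ?case using assms(5)[of A] by (simp add: borel)
  qed (use assms(3) in auto)
qed

text \<open>The signed measure with density \<open>f\<close> vanishes on boxes, hence on Borel sets,
  hence on Lebesgue sets. The assumption \<open>total\<close> serves the passage to
  complements.\<close>

lemma AE_eq_0_if_integral_box_0:
  fixes f :: "'a::euclidean_space \<Rightarrow> real"
  assumes f: "integrable lebesgue f"
    and box: "\<And>a b. (\<integral>x. indicator (box a b) x * f x \<partial>lebesgue) = 0"
    and total: "(\<integral>x. f x \<partial>lebesgue) = 0"
  shows "AE x in lebesgue. f x = 0"
proof -
  have int: "integrable lebesgue (\<lambda>x. indicator A x * f x)" if "A \<in> sets lebesgue" for A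
    using integrable_mult_indicator[OF that f] by simp
  have borel: "(\<integral>x. indicator A x * f x \<partial>lebesgue) = 0" if "A \<in> sets borel" for A
    using that
  proof (induction rule: borel_sets_induct_box)
    case (compl A)
    have "A \<in> sets lebesgue" using compl by simp
    have "(\<lambda>x. indicator (- A) x * f x) = (\<lambda>x. f x - indicator A x * f x)"
      by (auto simp: indicator_def)
    then show ?case using compl total f int[OF \<open>A \<in> sets lebesgue\<close>] by simp
  next
    case (union A)
    have A: "A i \<in> sets lebesgue" for i using union by auto
    have "(LINT x:(\<Union>i. A i)|lebesgue. f x) = (\<Sum>i. LINT x:A i|lebesgue. f x)"
    proof (rule lebesgue_integral_countable_add)
      show "set_integrable lebesgue (\<Union>i. A i) f"
        unfolding set_integrable_def using A f by (intro integrable_mult_indicator) auto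
    qed (use A union in \<open>auto simp: disjoint_family_on_def\<close>)
    then show ?case using union.IH by (simp add: set_lebesgue_integral_def)
  qed (use box in auto)
  show ?thesis
  proof (rule sigma_finite_measure.density_zero[OF _ f])
    obtain F :: "'a set set" where "countable F" "F \<subseteq> sets lborel" "\<Union>F = space lborel"
      "\<forall>a\<in>F. emeasure lborel a \<noteq> \<infinity>"
      using lborel.sigma_finite_countable by blast
    then show "sigma_finite_measure (lebesgue :: 'a measure)"
      by unfold_locales (intro exI[of _ F], auto)
    \<comment> \<open>A Lebesgue set is a countable union of closed sets up to a null set, which
      leads back to the Borel case.\<close>
    fix A :: "'a set" assume "A \<in> sets lebesgue"
    then obtain C T where CT: "fsigma C" "T \<in> null_sets lebesgue" "A = C \<union> T"
      by (metis lebesgue_set_almost_fsigma)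
    obtain F :: "nat \<Rightarrow> 'a set" where F: "\<And>i. closed (F i)" "C = (\<Union>i. F i)"
      using CT(1) by (auto elim: fsigma.cases)
    then have C: "C \<in> sets borel" by auto
    have "(\<integral>x. indicator A x * f x \<partial>lebesgue) = (\<integral>x. indicator C x * f x \<partial>lebesgue)"
    proof (rule integral_cong_AE)
      show "AE x in lebesgue. indicator A x * f x = indicator C x * f x"
        using AE_not_in[OF CT(2)] by eventually_elim (simp add: CT(3) indicator_def)
      show "(\<lambda>x. indicator A x * f x) \<in> borel_measurable lebesgue"
        "(\<lambda>x. indicator C x * f x) \<in> borel_measurable lebesgue"
        using int \<open>A \<in> sets lebesgue\<close> C by (auto intro!: borel_measurable_integrable)
    qed
    then show "(LINT x:A|lebesgue. f x) = 0"
      using borel[OF C] by (simp add: set_lebesgue_integral_def)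
  qed
qed

text \<open>The bumps of a box whose closure lies in \<open>\<Omega>\<close> are admissible and
  converge boundedly to its indicator. So \<open>f\<close> integrates to 0 over all such boxes,
  which settles each box; countably many of them cover \<open>\<Omega>\<close>.\<close>

lemma fundamental_lemma_calculus_of_variations:
  fixes f :: "'a::euclidean_space \<Rightarrow> real"
  assumes \<Omega>: "open \<Omega>" and f: "integrable (lebesgue_on \<Omega>) f"
    and zero: "\<And>\<phi>. \<phi> \<in> test_functions \<Omega> \<Longrightarrow> (\<integral>x. f x * \<phi> x \<partial>lebesgue_on \<Omega>) = 0"
  shows "AE x in lebesgue_on \<Omega>. f x = 0"
proof -
  have meas: "\<Omega> \<in> sets lebesgue" using \<Omega> by simp
  define g where "g = (\<lambda>x. indicator \<Omega> x * f x)"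
  have g: "integrable lebesgue g"
    using f meas by (simp add: integrable_restrict_space g_def)
  have int: "integrable lebesgue (\<lambda>x. indicator A x * g x)" if "A \<in> sets borel" for A
    using integrable_mult_indicator[OF _ g, of A] that by simp
  have box0: "(\<integral>x. indicator (box a b) x * g x \<partial>lebesgue) = 0" if "cbox a b \<subseteq> \<Omega>" for a b
  proof -
    have "(\<lambda>n. \<integral>x. bump n a b x * g x \<partial>lebesgue) \<longlonglongrightarrow> (\<integral>x. indicator (box a b) x * g x \<partial>lebesgue)"
    proof (rule integral_dominated_convergence)
      show "integrable lebesgue (\<lambda>x. norm (g x))" using g by simp
      show "AE x in lebesgue. (\<lambda>n. bump n a b x * g x) \<longlonglongrightarrow> indicator (box a b) x * g x"
        by (intro AE_I2 tendsto_intros bump_tendsto)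
      show "AE x in lebesgue. norm (bump n a b x * g x) \<le> norm (g x)" for n
        by (intro AE_I2) (simp add: abs_mult bump_bounds mult_left_le_one_le)
      have "bump n a b \<in> borel_measurable lebesgue" for n
        using test_function_D(1)[OF bump_test_function[OF that]]
          continuous_imp_measurable_on_sets_lebesgue[of UNIV "bump n a b"] by (simp add: lebesgue_on_UNIV_eq)
      then show "(\<lambda>x. bump n a b x * g x) \<in> borel_measurable lebesgue" for n
        using g by (intro borel_measurable_times) auto
      show "(\<lambda>x. indicator (box a b) x * g x) \<in> borel_measurable lebesgue"
        using int[of "box a b"] by simp
    qed
    moreover have "(\<integral>x. bump n a b x * g x \<partial>lebesgue) = 0" for n
      using zero[OF bump_test_function[OF that]] meas
      by (simp add: integral_restrict_space g_def mult_ac)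
    ultimately show ?thesis by (simp add: LIMSEQ_const_iff)
  qed
  have box: "AE x in lebesgue. x \<in> cbox a b \<longrightarrow> g x = 0" if ab: "cbox a b \<subseteq> \<Omega>" for a b
  proof -
    have "AE x in lebesgue. indicator (box a b) x * g x = 0"
    proof (rule AE_eq_0_if_integral_box_0)
      fix c d
      \<comment> \<open>Corners of the intersection of the two boxes. That box again has its closure
        in \<open>\<Omega>\<close>, even if \<open>box c d\<close> leaves
        \<open>\<Omega>\<close>.\<close>
      let ?p = "\<Sum>i\<in>Basis. max (c\<bullet>i) (a\<bullet>i) *\<^sub>R i" and ?q = "\<Sum>i\<in>Basis. min (d\<bullet>i) (b\<bullet>i) *\<^sub>R i"
      have "cbox ?p ?q \<subseteq> \<Omega>" using ab by (simp add: Int_interval[symmetric] le_infI2)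
      from box0[OF this]
      show "(\<integral>x. indicator (box c d) x * (indicator (box a b) x * g x) \<partial>lebesgue) = 0"
        by (simp add: box_Int_box[symmetric] indicator_inter_arith mult.assoc)
    qed (use box0[OF ab] int[of "box a b"] in auto)
    moreover have "AE x in lebesgue. x \<notin> cbox a b - box a b"
      using negligible_frontier_interval[of a b] by (intro AE_not_in) (simp add: negligible_iff_null_sets)
    ultimately show ?thesis by eventually_elim auto
  qed
  obtain D where D: "countable D" "\<And>X. X \<in> D \<Longrightarrow> X \<subseteq> \<Omega> \<and> (\<exists>a b. X = cbox a b)" "\<Omega> \<subseteq> \<Union>D"
    using open_countable_Union_open_cbox[OF \<Omega>] by (metis PowD order_refl subsetD)
  have "AE x in lebesgue. \<forall>X\<in>D. x \<in> X \<longrightarrow> g x = 0"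
    unfolding AE_ball_countable[OF D(1)] using D(2) box by metis
  then have "AE x in lebesgue. x \<in> \<Omega> \<longrightarrow> f x = 0"
    by eventually_elim (use D(3) in \<open>auto simp: g_def\<close>)
  then show ?thesis using meas by (simp add: AE_restrict_space_iff)
qed

text \<open>Difference quotients integrate to 0 by translation invariance, and dominated convergence
  passes to the derivative. This is what makes constants members of \<open>H1 \<Omega>\<close>, and
  later bounds the surface measure.\<close>

lemma integral_partial_derivative_test_function:
  fixes \<Omega> :: "'a::euclidean_space set"
  assumes \<phi>: "\<phi> \<in> test_functions \<Omega>" and i: "i \<in> Basis" and \<Omega>: "\<Omega> \<in> sets lebesgue"
  shows "(\<integral>x. frechet_derivative \<phi> (at x) i \<partial>lebesgue_on \<Omega>) = 0"
proof -
  define d where "d = (\<lambda>x. frechet_derivative \<phi> (at x) i)"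
  note \<phi>_D = test_function_D[OF \<phi>]
  obtain K where K: "compact K" "K \<subseteq> \<Omega>" "\<And>x. x \<notin> K \<Longrightarrow> \<phi> x = 0" "\<And>x. x \<notin> K \<Longrightarrow> d x = 0"
    using \<phi>_D(4) unfolding d_def by force
  have d_cont: "continuous_on UNIV d" unfolding d_def by (rule \<phi>_D(3)[OF i])
  obtain B where B: "B > 0" "\<And>x. \<bar>d x\<bar> \<le> B"
    using compact_support_bounded[OF d_cont K(1) K(4)] by metis
  obtain R where R: "\<And>x. x \<in> K \<Longrightarrow> norm x \<le> R"
    using compact_imp_bounded[OF K(1)] by (auto simp: bounded_iff)
  have [measurable]: "\<phi> \<in> borel_measurable borel" "d \<in> borel_measurable borel"
    using \<phi>_D(1) d_cont by (auto intro: borel_measurable_continuous_onI)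
  have deriv: "((\<lambda>s. \<phi> (x + s *\<^sub>R i)) has_real_derivative d (x + s *\<^sub>R i)) (at s)" for x s
  proof -
    have "((\<lambda>s. x + s *\<^sub>R i) has_derivative (\<lambda>h. h *\<^sub>R i)) (at s)"
      by (auto intro!: derivative_eq_intros)
    from has_derivative_compose[OF this \<phi>_D(2)]
    have "((\<lambda>s. \<phi> (x + s *\<^sub>R i)) has_derivative (\<lambda>h. frechet_derivative \<phi> (at (x + s *\<^sub>R i)) (h *\<^sub>R i))) (at s)" .
    moreover have "linear (frechet_derivative \<phi> (at (x + s *\<^sub>R i)))"
      using \<phi>_D(2) has_derivative_linear by blast
    then have "(\<lambda>h. frechet_derivative \<phi> (at (x + s *\<^sub>R i)) (h *\<^sub>R i)) = (*) (d (x + s *\<^sub>R i))"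
      by (simp add: linear_cmul d_def fun_eq_iff)
    ultimately show ?thesis by (simp add: has_field_derivative_def)
  qed
  define q where "q = (\<lambda>n x. (\<phi> (x + inverse (real (Suc n)) *\<^sub>R i) - \<phi> x) * real (Suc n))"
  have \<phi>_int: "integrable lborel \<phi>"
  proof -
    have "integrable lborel (\<lambda>x. indicator K x *\<^sub>R \<phi> x)"
      by (intro borel_integrable_compact K continuous_on_subset[OF \<phi>_D(1)]) simp
    moreover have "(\<lambda>x. indicator K x *\<^sub>R \<phi> x) = \<phi>" using K(3) by (auto simp: fun_eq_iff indicator_def)
    ultimately show ?thesis by simp
  qed
  have shift: "integrable lborel (\<lambda>x. \<phi> (x + c))" "(\<integral>x. \<phi> (x + c) \<partial>lborel) = (\<integral>x. \<phi> x \<partial>lborel)" for c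
  proof -
    have *: "distr lborel borel (\<lambda>x. x + c) = lborel"
    proof -
      have "(\<lambda>x. x + c) = (+) c" by (simp add: fun_eq_iff add.commute)
      then show ?thesis by (simp only: lborel_distr_plus)
    qed
    show "integrable lborel (\<lambda>x. \<phi> (x + c))"
      using \<phi>_int by (subst (asm) *[symmetric]) (simp add: integrable_distr_eq)
    show "(\<integral>x. \<phi> (x + c) \<partial>lborel) = (\<integral>x. \<phi> x \<partial>lborel)"
      by (subst (2) *[symmetric]) (simp add: integral_distr)
  qed
  have "(\<lambda>n. \<integral>x. q n x \<partial>lborel) \<longlonglongrightarrow> (\<integral>x. d x \<partial>lborel)"
  proof (rule integral_dominated_convergence)
    \<comment> \<open>The steps have length at most 1, so outside the radius \<open>R + 1\<close>
      both points of the quotient miss the support. Inside it, the mean value inequality gives the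
      bound \<open>B\<close>.\<close>
    show "integrable lborel (\<lambda>x. B * indicator (cball 0 (R + 1)) x)"
      by (intro integrable_mult_right integrable_real_indicator) (use emeasure_bounded_finite[OF bounded_cball] in auto)
    show "AE x in lborel. (\<lambda>n. q n x) \<longlonglongrightarrow> d x"
    proof (rule AE_I2)
      fix x
      have "((\<lambda>h. (\<phi> (x + h *\<^sub>R i) - \<phi> x) / h) \<longlongrightarrow> d x) (at 0)"
        using deriv[of x 0] by (simp add: DERIV_def)
      moreover have "filterlim (\<lambda>n. inverse (real (Suc n))) (at 0) sequentially"
        by (intro filterlim_atI LIMSEQ_inverse_real_of_nat) simp
      ultimately have "(\<lambda>n. (\<phi> (x + inverse (real (Suc n)) *\<^sub>R i) - \<phi> x) / inverse (real (Suc n))) \<longlonglongrightarrow> d x"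
        by (rule filterlim_compose)
      then show "(\<lambda>n. q n x) \<longlonglongrightarrow> d x" by (simp add: q_def divide_inverse)
    qed
    show "AE x in lborel. norm (q n x) \<le> B * indicator (cball 0 (R + 1)) x" for n
    proof (rule AE_I2)
      fix x
      define h where "h = inverse (real (Suc n))"
      have h: "0 < h" "h \<le> 1" by (auto simp: h_def inverse_le_1_iff)
      have q: "q n x = (\<phi> (x + h *\<^sub>R i) - \<phi> x) / h" by (simp add: q_def h_def divide_inverse)
      show "norm (q n x) \<le> B * indicator (cball 0 (R + 1)) x"
      proof (cases "x \<in> cball 0 (R + 1)")
        case False
        then have n: "norm x > R + 1" by simp
        then have "x \<notin> K" using R[of x] by auto
        have "norm x \<le> norm (x + h *\<^sub>R i) + norm (h *\<^sub>R i)"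
          using norm_triangle_ineq4[of "x + h *\<^sub>R i" "h *\<^sub>R i"] by simp
        then have "norm (x + h *\<^sub>R i) > R" using n h i by simp
        then have "x + h *\<^sub>R i \<notin> K" using R by fastforce
        then show ?thesis using \<open>x \<notin> K\<close> K(3) False by (simp add: q)
      next
        case True
        have "norm (\<phi> (x + h *\<^sub>R i) - \<phi> (x + 0 *\<^sub>R i)) \<le> B * norm (h - 0)"
          by (rule field_differentiable_bound[of UNIV _ "\<lambda>s. d (x + s *\<^sub>R i)"]) (use deriv B in auto)
        then show ?thesis using True h by (simp add: q field_simps abs_mult)
      qed
    qed
  qed (auto simp: q_def)
  moreover have "(\<integral>x. q n x \<partial>lborel) = 0" for n
    unfolding q_def using shift \<phi>_int by simp
  ultimately have "(\<integral>x. d x \<partial>lborel) = 0" by (simp add: LIMSEQ_const_iff)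
  then have "(\<integral>x. d x \<partial>lebesgue) = 0" by (simp add: integral_completion)
  moreover have "(\<lambda>x. indicator \<Omega> x *\<^sub>R d x) = d"
    using K by (auto simp: fun_eq_iff indicator_def)
  ultimately show ?thesis using \<Omega> by (simp add: integral_restrict_space d_def)
qed

section \<open>The Hilbert space $H^1$\<close>

locale bounded_open =
  fixes \<Omega> :: "'a::euclidean_space set"
  assumes open_\<Omega>: "open \<Omega>" and bounded_\<Omega>: "bounded \<Omega>"
begin

lemma sets_\<Omega>: "\<Omega> \<in> sets lebesgue"
  using open_\<Omega> by simp

sublocale finite_measure "lebesgue_on \<Omega>"
  by (rule finite_measure_lebesgue_on) (use open_\<Omega> bounded_\<Omega> in \<open>simp add: lmeasurable_open\<close>)

lemma continuous_L2:
  fixes f :: "'a \<Rightarrow> real"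
  assumes "continuous_on UNIV f" "compact K" "\<And>x. x \<notin> K \<Longrightarrow> f x = 0"
  shows "f \<in> L2 (lebesgue_on \<Omega>)"
proof -
  obtain B where B: "B > 0" "\<And>x. \<bar>f x\<bar> \<le> B"
    using compact_support_bounded[OF assms] by metis
  show ?thesis
  proof (rule L2_bounded_by)
    show "f \<in> borel_measurable (lebesgue_on \<Omega>)"
      using assms(1) sets_\<Omega> by (intro continuous_imp_measurable_on_sets_lebesgue) (auto intro: continuous_on_subset)
    show "integrable (lebesgue_on \<Omega>) (\<lambda>_. B\<^sup>2)" by simp
    show "AE x in lebesgue_on \<Omega>. (norm (f x))\<^sup>2 \<le> B\<^sup>2"
      using B by (intro AE_I2 power_mono) auto
  qed
qed

lemma test_function_L2:
  assumes "\<phi> \<in> test_functions \<Omega>"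
  shows "\<phi> \<in> L2 (lebesgue_on \<Omega>)"
    and "i \<in> Basis \<Longrightarrow> (\<lambda>x. frechet_derivative \<phi> (at x) i) \<in> L2 (lebesgue_on \<Omega>)"
proof -
  obtain K where "compact K" "K \<subseteq> \<Omega>" "\<forall>x. x \<notin> K \<longrightarrow> \<phi> x = 0 \<and> frechet_derivative \<phi> (at x) = (\<lambda>_. 0)"
    using test_function_D(4)[OF assms] by blast
  then show "\<phi> \<in> L2 (lebesgue_on \<Omega>)"
    and "i \<in> Basis \<Longrightarrow> (\<lambda>x. frechet_derivative \<phi> (at x) i) \<in> L2 (lebesgue_on \<Omega>)"
    using test_function_D(1,3)[OF assms] by (auto intro: continuous_L2[of _ K])
qed

text \<open>The fundamental lemma applied to each component. It frees \<open>weak_gradient\<close>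
  from the choice in its definition and lets any weak gradient be used to compute
  \<open>dirichlet_form\<close>.\<close>

lemma weak_gradient_unique:
  assumes g: "has_weak_gradient \<Omega> v g" and h: "has_weak_gradient \<Omega> v h"
  shows "AE x in lebesgue_on \<Omega>. g x = h x"
proof -
  have L2: "g \<in> L2 (lebesgue_on \<Omega>)" "h \<in> L2 (lebesgue_on \<Omega>)"
    using g h by (auto simp: has_weak_gradient_def)
  have "AE x in lebesgue_on \<Omega>. (g x - h x) \<bullet> i = 0" if i: "i \<in> Basis" for i
  proof (rule fundamental_lemma_calculus_of_variations[OF open_\<Omega>])
    show "integrable (lebesgue_on \<Omega>) (\<lambda>x. (g x - h x) \<bullet> i)"
      by (intro integrable_L2 L2_component L2_diff L2)
    fix \<phi> assume \<phi>: "\<phi> \<in> test_functions \<Omega>"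
    have "(\<integral>x. (g x \<bullet> i) * \<phi> x \<partial>lebesgue_on \<Omega>) = (\<integral>x. (h x \<bullet> i) * \<phi> x \<partial>lebesgue_on \<Omega>)"
      using g h \<phi> i by (simp add: has_weak_gradient_def)
    then show "(\<integral>x. ((g x - h x) \<bullet> i) * \<phi> x \<partial>lebesgue_on \<Omega>) = 0"
      by (simp add: inner_diff_left left_diff_distrib integrable_mult_L2 L2_component L2 test_function_L2[OF \<phi>])
  qed
  then have "AE x in lebesgue_on \<Omega>. \<forall>i\<in>Basis. (g x - h x) \<bullet> i = 0"
    by (simp add: AE_finite_allI)
  then show ?thesis
    by eventually_elim (simp add: euclidean_eq_iff[where 'a='a] inner_diff_left)
qed

lemma has_weak_gradient_add:
  assumes "has_weak_gradient \<Omega> u g" "has_weak_gradient \<Omega> v h"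
  shows "has_weak_gradient \<Omega> (u + v) (g + h)"
  using assms unfolding has_weak_gradient_def
  by (auto simp: subspace_add[OF subspace_L2] inner_add_left distrib_right integrable_mult_L2 L2_component test_function_L2)

lemma has_weak_gradient_scale:
  assumes "has_weak_gradient \<Omega> u g"
  shows "has_weak_gradient \<Omega> (c *\<^sub>R u) (c *\<^sub>R g)"
  using assms unfolding has_weak_gradient_def
  by (auto simp: subspace_scale[OF subspace_L2] mult.assoc)

lemma has_weak_gradient_const: "has_weak_gradient \<Omega> (\<lambda>_. c) (\<lambda>_. 0)"
  unfolding has_weak_gradient_def
  using integral_partial_derivative_test_function sets_\<Omega> by (auto simp: L2_const)

lemma subspace_H1: "subspace (H1 \<Omega>)"
proof (rule subspaceI)
  show "0 \<in> H1 \<Omega>" using has_weak_gradient_const[of 0] by (auto simp: H1_def zero_fun_def)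
qed (auto simp: H1_def intro: has_weak_gradient_add has_weak_gradient_scale)

lemma weak_gradient:
  assumes "v \<in> H1 \<Omega>"
  shows "has_weak_gradient \<Omega> v (weak_gradient \<Omega> v)"
  using assms someI_ex[of "has_weak_gradient \<Omega> v"] by (simp add: H1_def weak_gradient_def)

lemma H1_L2:
  assumes "v \<in> H1 \<Omega>"
  shows "v \<in> L2 (lebesgue_on \<Omega>)" "weak_gradient \<Omega> v \<in> L2 (lebesgue_on \<Omega>)"
  using weak_gradient[OF assms] by (auto simp: has_weak_gradient_def)

lemma AE_weak_gradient_eq:
  assumes "has_weak_gradient \<Omega> v g"
  shows "AE x in lebesgue_on \<Omega>. weak_gradient \<Omega> v x = g x"
  using weak_gradient_unique[OF weak_gradient assms] assms by (auto simp: H1_def)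

definition h1_ip :: "('a \<Rightarrow> real) \<Rightarrow> ('a \<Rightarrow> real) \<Rightarrow> real" where
  "h1_ip u v = (\<integral>x. u x * v x \<partial>lebesgue_on \<Omega>) + dirichlet_form \<Omega> u v"

lemma dirichlet_form_eq:
  assumes "has_weak_gradient \<Omega> u g" "has_weak_gradient \<Omega> v h"
  shows "dirichlet_form \<Omega> u v = (\<integral>x. g x \<bullet> h x \<partial>lebesgue_on \<Omega>)"
  unfolding dirichlet_form_def
proof (rule integral_cong_AE)
  have uv: "u \<in> H1 \<Omega>" "v \<in> H1 \<Omega>" using assms by (auto simp: H1_def)
  show "(\<lambda>x. weak_gradient \<Omega> u x \<bullet> weak_gradient \<Omega> v x) \<in> borel_measurable (lebesgue_on \<Omega>)"
    using integrable_inner_L2[OF H1_L2(2)[OF uv(1)] H1_L2(2)[OF uv(2)]] by (rule borel_measurable_integrable)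
  show "(\<lambda>x. g x \<bullet> h x) \<in> borel_measurable (lebesgue_on \<Omega>)"
    using assms integrable_inner_L2 unfolding has_weak_gradient_def by (blast intro: borel_measurable_integrable)
  show "AE x in lebesgue_on \<Omega>. weak_gradient \<Omega> u x \<bullet> weak_gradient \<Omega> v x = g x \<bullet> h x"
    using assms[THEN AE_weak_gradient_eq] by eventually_elim simp
qed

lemma dirichlet_form_add:
  assumes "u \<in> H1 \<Omega>" "v \<in> H1 \<Omega>" "w \<in> H1 \<Omega>"
  shows "dirichlet_form \<Omega> (u + v) w = dirichlet_form \<Omega> u w + dirichlet_form \<Omega> v w"
  unfolding dirichlet_form_eq[OF has_weak_gradient_add[OF assms(1,2)[THEN weak_gradient]] weak_gradient[OF assms(3)]]
  using assms by (simp add: inner_add_left integrable_inner_L2 H1_L2 dirichlet_form_def)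

lemma dirichlet_form_scale:
  assumes "u \<in> H1 \<Omega>" "w \<in> H1 \<Omega>"
  shows "dirichlet_form \<Omega> (c *\<^sub>R u) w = c * dirichlet_form \<Omega> u w"
  unfolding dirichlet_form_eq[OF has_weak_gradient_scale[OF weak_gradient[OF assms(1)]] weak_gradient[OF assms(2)]]
  by (simp add: dirichlet_form_def)

lemma dirichlet_form_sym: "dirichlet_form \<Omega> u v = dirichlet_form \<Omega> v u"
  by (simp add: dirichlet_form_def inner_commute)

text \<open>Degenerate on constants, which semi-inner products allow; it supplies bilinearity and
  the Cauchy-Schwarz inequality for the form alone.\<close>

sublocale dirichlet: semi_inner "H1 \<Omega>" "dirichlet_form \<Omega>"
  by standard (auto simp: subspace_H1 dirichlet_form_add dirichlet_form_scale
      intro: dirichlet_form_sym, auto simp: dirichlet_form_def)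

lemma dirichlet_nrm: "dirichlet.nrm u = l2_norm (lebesgue_on \<Omega>) (weak_gradient \<Omega> u)"
  by (simp add: dirichlet.nrm_def l2_norm_def dirichlet_form_def power2_norm_eq_inner)

sublocale h1: semi_inner "H1 \<Omega>" h1_ip
proof
  show "subspace (H1 \<Omega>)" by (rule subspace_H1)
next
  fix x y z assume "x \<in> H1 \<Omega>" "y \<in> H1 \<Omega>" "z \<in> H1 \<Omega>"
  then show "h1_ip (x + y) z = h1_ip x z + h1_ip y z"
    by (simp add: h1_ip_def distrib_right integrable_mult_L2 H1_L2 dirichlet_form_add)
next
  fix x z and c :: real assume "x \<in> H1 \<Omega>" "z \<in> H1 \<Omega>"
  then show "h1_ip (c *\<^sub>R x) z = c * h1_ip x z"
    by (simp add: h1_ip_def dirichlet_form_scale distrib_left mult.assoc)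
next
  fix x y show "h1_ip x y = h1_ip y x"
    by (simp add: h1_ip_def dirichlet_form_sym[of x] mult.commute)
next
  fix x show "0 \<le> h1_ip x x"
    by (auto simp: h1_ip_def dirichlet_form_def)
qed

lemma h1_nrm: "h1.nrm v = h1_norm \<Omega> v"
  by (simp add: h1.nrm_def h1_ip_def h1_norm_def l2_norm_square dirichlet_form_def
      power2_norm_eq_inner flip: power2_eq_square)

lemma l2_norm_le_h1_norm: "l2_norm (lebesgue_on \<Omega>) v \<le> h1_norm \<Omega> v"
  and l2_norm_gradient_le_h1_norm: "l2_norm (lebesgue_on \<Omega>) (weak_gradient \<Omega> v) \<le> h1_norm \<Omega> v"
  unfolding h1_norm_def by (intro real_le_rsqrt; simp)+

text \<open>Weak differentiation is a closed operator: for a fixed test function, both sides of the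
  integration by parts formula are continuous in $L^2$.\<close>

lemma has_weak_gradient_limit:
  assumes X: "\<And>n. has_weak_gradient \<Omega> (X n) (G n)"
    and u: "u \<in> L2 (lebesgue_on \<Omega>)" "(\<lambda>n. l2_norm (lebesgue_on \<Omega>) (\<lambda>x. X n x - u x)) \<longlonglongrightarrow> 0"
    and g: "g \<in> L2 (lebesgue_on \<Omega>)" "(\<lambda>n. l2_norm (lebesgue_on \<Omega>) (\<lambda>x. G n x - g x)) \<longlonglongrightarrow> 0"
  shows "has_weak_gradient \<Omega> u g"
  unfolding has_weak_gradient_def
proof (intro conjI ballI u g)
  fix \<phi> :: "'a \<Rightarrow> real" and i :: 'a assume \<phi>: "\<phi> \<in> test_functions \<Omega>" and i: "i \<in> Basis"
  let ?M = "lebesgue_on \<Omega>"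
  have XL2: "X n \<in> L2 ?M" "G n \<in> L2 ?M" for n using X by (auto simp: has_weak_gradient_def)
  have lim: "(\<lambda>n. \<integral>x. f n x * \<psi> x \<partial>?M) \<longlonglongrightarrow> (\<integral>x. h x * \<psi> x \<partial>?M)"
    if "\<And>n. f n \<in> L2 ?M" "h \<in> L2 ?M" "\<psi> \<in> L2 ?M" "(\<lambda>n. l2_norm ?M (\<lambda>x. f n x - h x)) \<longlonglongrightarrow> 0"
    for f :: "nat \<Rightarrow> 'a \<Rightarrow> real" and h \<psi>
  proof (rule LIM_zero_cancel, rule Lim_null_comparison)
    show "(\<lambda>n. l2_norm ?M (\<lambda>x. f n x - h x) * l2_norm ?M \<psi>) \<longlonglongrightarrow> 0"
      using tendsto_mult_right[OF that(4), of "l2_norm ?M \<psi>"] by simp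
    have "norm ((\<integral>x. f n x * \<psi> x \<partial>?M) - (\<integral>x. h x * \<psi> x \<partial>?M)) \<le> l2_norm ?M (\<lambda>x. f n x - h x) * l2_norm ?M \<psi>" for n
      using l2_cauchy_schwarz[OF L2_diff[OF that(1,2)] that(3), of n] that
      by (simp add: left_diff_distrib integrable_mult_L2)
    then show "\<forall>\<^sub>F n in sequentially. norm ((\<integral>x. f n x * \<psi> x \<partial>?M) - (\<integral>x. h x * \<psi> x \<partial>?M))
        \<le> l2_norm ?M (\<lambda>x. f n x - h x) * l2_norm ?M \<psi>"
      by simp
  qed
  have "(\<lambda>n. \<integral>x. X n x * frechet_derivative \<phi> (at x) i \<partial>?M) \<longlonglongrightarrow> (\<integral>x. u x * frechet_derivative \<phi> (at x) i \<partial>?M)"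
    by (intro lim XL2 u test_function_L2(2)[OF \<phi> i])
  moreover have "(\<lambda>n. \<integral>x. (G n x \<bullet> i) * \<phi> x \<partial>?M) \<longlonglongrightarrow> (\<integral>x. (g x \<bullet> i) * \<phi> x \<partial>?M)"
  proof (intro lim XL2 g L2_component test_function_L2(1)[OF \<phi>])
    show "(\<lambda>n. l2_norm ?M (\<lambda>x. G n x \<bullet> i - g x \<bullet> i)) \<longlonglongrightarrow> 0"
    proof (rule Lim_null_comparison[OF _ g(2)])
      show "\<forall>\<^sub>F n in sequentially. norm (l2_norm ?M (\<lambda>x. G n x \<bullet> i - g x \<bullet> i)) \<le> l2_norm ?M (\<lambda>x. G n x - g x)"
        using l2_norm_component_le[OF L2_diff[OF XL2(2) g(1)] i] by (simp add: inner_diff_left)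
    qed
  qed
  then have "(\<lambda>n. - (\<integral>x. (G n x \<bullet> i) * \<phi> x \<partial>?M)) \<longlonglongrightarrow> - (\<integral>x. (g x \<bullet> i) * \<phi> x \<partial>?M)"
    by (rule tendsto_minus)
  moreover have "(\<integral>x. X n x * frechet_derivative \<phi> (at x) i \<partial>?M) = - (\<integral>x. (G n x \<bullet> i) * \<phi> x \<partial>?M)" for n
    using X \<phi> i by (simp add: has_weak_gradient_def)
  ultimately show "(\<integral>x. u x * frechet_derivative \<phi> (at x) i \<partial>?M) = - (\<integral>x. (g x \<bullet> i) * \<phi> x \<partial>?M)"
    using LIMSEQ_unique by simp
qed

lemma weak_gradient_diff:
  assumes "u \<in> H1 \<Omega>" "v \<in> H1 \<Omega>"
  shows "l2_norm (lebesgue_on \<Omega>) (weak_gradient \<Omega> (u - v)) =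
    l2_norm (lebesgue_on \<Omega>) (\<lambda>x. weak_gradient \<Omega> u x - weak_gradient \<Omega> v x)"
proof (rule l2_norm_AE_cong)
  have *: "has_weak_gradient \<Omega> (u - v) (\<lambda>x. weak_gradient \<Omega> u x - weak_gradient \<Omega> v x)"
    using has_weak_gradient_add[OF weak_gradient has_weak_gradient_scale[OF weak_gradient], of u v "-1"] assms
    by (simp add: plus_fun_def scaleR_fun_def fun_diff_def)
  from AE_weak_gradient_eq[OF *]
  show "AE x in lebesgue_on \<Omega>. weak_gradient \<Omega> (u - v) x = weak_gradient \<Omega> u x - weak_gradient \<Omega> v x" .
  show "weak_gradient \<Omega> (u - v) \<in> borel_measurable (lebesgue_on \<Omega>)"
    "(\<lambda>x. weak_gradient \<Omega> u x - weak_gradient \<Omega> v x) \<in> borel_measurable (lebesgue_on \<Omega>)"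
    using * by (auto intro!: L2_D H1_L2 simp: has_weak_gradient_def H1_def)
qed

text \<open>Functions and gradients converge separately in $L^2$, and closedness identifies the
  second limit as a weak gradient of the first. It may differ from the chosen
  \<open>weak_gradient\<close> on a null set, to which the norms are blind.\<close>

sublocale h1: semi_hilbert "H1 \<Omega>" h1_ip
proof
  fix X :: "nat \<Rightarrow> 'a \<Rightarrow> real"
  let ?M = "lebesgue_on \<Omega>"
  assume X: "\<And>n. X n \<in> H1 \<Omega>" and cauchy: "\<And>e. e > 0 \<Longrightarrow> \<exists>N. \<forall>m\<ge>N. \<forall>n\<ge>N. h1.nrm (X m - X n) < e"
  let ?G = "\<lambda>n. weak_gradient \<Omega> (X n)"
  have "\<exists>u\<in>L2 ?M. (\<lambda>n. l2_norm ?M (\<lambda>x. X n x - u x)) \<longlonglongrightarrow> 0"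
  proof (rule L2_complete)
    show "X n \<in> L2 ?M" for n by (rule H1_L2(1)[OF X])
    show "\<exists>N. \<forall>m\<ge>N. \<forall>n\<ge>N. l2_norm ?M (\<lambda>x. X m x - X n x) < e" if "e > 0" for e
      using cauchy[OF that] le_less_trans[OF l2_norm_le_h1_norm] by (simp add: h1_nrm fun_diff_def) blast
  qed
  then obtain u where u: "u \<in> L2 ?M" "(\<lambda>n. l2_norm ?M (\<lambda>x. X n x - u x)) \<longlonglongrightarrow> 0" by blast
  have "\<exists>g\<in>L2 ?M. (\<lambda>n. l2_norm ?M (\<lambda>x. ?G n x - g x)) \<longlonglongrightarrow> 0"
  proof (rule L2_complete)
    show "?G n \<in> L2 ?M" for n by (rule H1_L2(2)[OF X])
    show "\<exists>N. \<forall>m\<ge>N. \<forall>n\<ge>N. l2_norm ?M (\<lambda>x. ?G m x - ?G n x) < e" if "e > 0" for e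
      using cauchy[OF that] le_less_trans[OF l2_norm_gradient_le_h1_norm]
      by (simp add: h1_nrm weak_gradient_diff[OF X X, symmetric]) blast
  qed
  then obtain g where g: "g \<in> L2 ?M" "(\<lambda>n. l2_norm ?M (\<lambda>x. ?G n x - g x)) \<longlonglongrightarrow> 0" by blast
  have wg: "has_weak_gradient \<Omega> u g"
    by (rule has_weak_gradient_limit[OF weak_gradient[OF X] u g])
  then have uH: "u \<in> H1 \<Omega>" by (auto simp: H1_def)
  have "l2_norm ?M (\<lambda>x. ?G n x - weak_gradient \<Omega> u x) = l2_norm ?M (\<lambda>x. ?G n x - g x)" for n
  proof (rule l2_norm_AE_cong)
    show "AE x in ?M. ?G n x - weak_gradient \<Omega> u x = ?G n x - g x"
      using AE_weak_gradient_eq[OF wg] by eventually_elim simp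
  qed (use L2_D(1)[OF H1_L2(2)[OF X, of n]] L2_D(1)[OF H1_L2(2)[OF uH]] L2_D(1)[OF g(1)] in measurable)
  then have "h1.nrm (X n - u) = sqrt ((l2_norm ?M (\<lambda>x. X n x - u x))\<^sup>2 + (l2_norm ?M (\<lambda>x. ?G n x - g x))\<^sup>2)" for n
    unfolding h1_nrm h1_norm_def weak_gradient_diff[OF X uH] by (simp add: fun_diff_def)
  moreover have "(\<lambda>n. sqrt ((l2_norm ?M (\<lambda>x. X n x - u x))\<^sup>2 + (l2_norm ?M (\<lambda>x. ?G n x - g x))\<^sup>2)) \<longlonglongrightarrow> sqrt (0\<^sup>2 + 0\<^sup>2)"
    by (intro tendsto_intros u g)
  ultimately show "\<exists>u\<in>H1 \<Omega>. (\<lambda>n. h1.nrm (X n - u)) \<longlonglongrightarrow> 0"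
    using uH by (auto intro!: bexI[of _ u])
qed

lemma h1_dual_iff: "l \<in> h1_dual \<Omega> \<longleftrightarrow> h1.dual_on (H1 \<Omega>) l"
  by (simp add: h1_dual_def h1.dual_on_def h1_nrm plus_fun_def scaleR_fun_def)

lemma h1_weak_compactness:
  fixes x :: "nat \<Rightarrow> 'a \<Rightarrow> real"
  assumes "\<And>n. x n \<in> H1 \<Omega>" "\<And>n. h1_norm \<Omega> (x n) \<le> B"
  shows "\<exists>\<sigma> w. strict_mono \<sigma> \<and> weakly_converges_h1 \<Omega> (\<lambda>n. x (\<sigma> n)) w"
  using h1.weak_compactness[of x B] assms
  by (auto simp: weakly_converges_h1_def h1_dual_iff h1_nrm Ball_def)

end

section \<open>Clarke calculus\<close>

lemma eventually_nhds_prod_at_right_0: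
  fixes r :: real
  shows "eventually P (nhds r \<times>\<^sub>F at_right (0::real)) \<longleftrightarrow>
    (\<exists>d>0. \<forall>y t. \<bar>y - r\<bar> < d \<and> 0 < t \<and> t < d \<longrightarrow> P (y, t))"
proof
  assume "eventually P (nhds r \<times>\<^sub>F at_right (0::real))"
  then obtain Q R where Q: "eventually Q (nhds r)" and R: "eventually R (at_right (0::real))"
    and P: "\<And>y t. Q y \<Longrightarrow> R t \<Longrightarrow> P (y, t)"
    unfolding eventually_prod_filter by blast
  obtain d where d: "d > 0" "\<And>y. \<bar>y - r\<bar> < d \<Longrightarrow> Q y"
    using Q unfolding eventually_nhds_metric by (auto simp: dist_real_def)
  obtain e where e: "e > 0" "\<And>t. 0 < t \<Longrightarrow> t < e \<Longrightarrow> R t"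
    using R unfolding eventually_at_right_field by auto
  show "\<exists>d>0. \<forall>y t. \<bar>y - r\<bar> < d \<and> 0 < t \<and> t < d \<longrightarrow> P (y, t)"
    using d e P by (intro exI[of _ "min d e"]) auto
next
  assume "\<exists>d>0. \<forall>y t. \<bar>y - r\<bar> < d \<and> 0 < t \<and> t < d \<longrightarrow> P (y, t)"
  then obtain d where d: "d > 0" "\<And>y t. \<bar>y - r\<bar> < d \<Longrightarrow> 0 < t \<Longrightarrow> t < d \<Longrightarrow> P (y, t)" by blast
  have "eventually (\<lambda>y. \<bar>y - r\<bar> < d) (nhds r)"
    using d(1) unfolding eventually_nhds_metric by (auto simp: dist_real_def)
  moreover have "eventually (\<lambda>t. 0 < t \<and> t < d) (at_right (0::real))"
    using d(1) unfolding eventually_at_right_field by auto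
  ultimately show "eventually P (nhds r \<times>\<^sub>F at_right (0::real))"
    unfolding eventually_prod_filter using d(2) by blast
qed

definition diff_quot :: "(real \<Rightarrow> real) \<Rightarrow> real \<Rightarrow> real \<Rightarrow> real \<Rightarrow> real" where
  "diff_quot \<phi> s y t = (\<phi> (y + t * s) - \<phi> y) / t"

locale loc_lip =
  fixes \<phi> :: "real \<Rightarrow> real"
  assumes loc_lip: "locally_lipschitz \<phi>"
begin

abbreviation dd :: "real \<Rightarrow> real \<Rightarrow> real" where "dd \<equiv> clarke_dd \<phi>"

lemma continuous: "continuous_on UNIV \<phi>"
proof (rule continuous_at_imp_continuous_on, intro ballI)
  fix r
  obtain e C where "e > 0" "C-lipschitz_on (ball r e) \<phi>"
    using loc_lip unfolding locally_lipschitz_def by blast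
  then show "isCont \<phi> r"
    using lipschitz_on_continuous_on continuous_on_interior by (metis centre_in_ball interior_ball)
qed

text \<open>A local Lipschitz constant \<open>C\<close> keeps the quotients between
  \<open>- C * \<bar>s\<bar>\<close> and \<open>C * \<bar>s\<bar>\<close>, so the upper limit is
  finite and the conversion to a real loses nothing.\<close>

lemma Limsup_eq:
  "Limsup (nhds r \<times>\<^sub>F at_right 0) (\<lambda>(y, t). ereal (diff_quot \<phi> s y t)) = ereal (dd r s)"
proof -
  let ?F = "nhds r \<times>\<^sub>F at_right (0::real)"
  let ?L = "Limsup ?F (\<lambda>(y, t). ereal (diff_quot \<phi> s y t))"
  obtain e C where e: "e > 0" and C: "C-lipschitz_on (ball r e) \<phi>"
    using loc_lip unfolding locally_lipschitz_def by blast
  \<comment> \<open>Small enough that both \<open>y\<close> and \<open>y + t * s\<close> stay in the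
    ball of radius \<open>e\<close>; the 1 covers \<open>s = 0\<close>.\<close>
  define d where "d = e / (2 * (1 + \<bar>s\<bar>))"
  have d: "d > 0" using e by (simp add: d_def)
  have d1: "d \<le> e / 2" "d * \<bar>s\<bar> \<le> e / 2"
    using e by (auto simp: d_def field_simps)
  have bound: "\<bar>diff_quot \<phi> s y t\<bar> \<le> C * \<bar>s\<bar>" if "\<bar>y - r\<bar> < d" "0 < t" "t < d" for y t
  proof -
    have "t * \<bar>s\<bar> \<le> d * \<bar>s\<bar>" using that by (intro mult_right_mono) auto
    then have "\<bar>t * s\<bar> \<le> e / 2" using d1 that by (simp add: abs_mult)
    then have "y \<in> ball r e" "y + t * s \<in> ball r e" using that d1 e by (auto simp: dist_real_def)
    then have "\<bar>\<phi> (y + t * s) - \<phi> y\<bar> \<le> C * \<bar>t * s\<bar>"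
      using lipschitz_onD[OF C, of "y + t * s" y] by (simp add: dist_real_def)
    then show ?thesis using that by (simp add: diff_quot_def abs_mult field_simps)
  qed
  have "?F \<noteq> bot" by (simp add: prod_filter_eq_bot)
  then have "- ereal (C * \<bar>s\<bar>) \<le> ?L"
  proof (rule le_Limsup)
    show "\<forall>\<^sub>F x in ?F. - ereal (C * \<bar>s\<bar>) \<le> (case x of (y, t) \<Rightarrow> ereal (diff_quot \<phi> s y t))"
      unfolding eventually_nhds_prod_at_right_0 using d bound by (force simp: abs_le_iff)
  qed
  moreover have "?L \<le> ereal (C * \<bar>s\<bar>)"
  proof (rule Limsup_bounded)
    show "\<forall>\<^sub>F x in ?F. (case x of (y, t) \<Rightarrow> ereal (diff_quot \<phi> s y t)) \<le> ereal (C * \<bar>s\<bar>)"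
      unfolding eventually_nhds_prod_at_right_0 using d bound by (force simp: abs_le_iff)
  qed
  moreover have "dd r s = real_of_ereal ?L" by (simp add: clarke_dd_def diff_quot_def)
  ultimately show ?thesis by (cases ?L) auto
qed

lemma dd_lessD:
  assumes "dd r s < c"
  obtains d where "d > 0" "\<And>y t. \<bar>y - r\<bar> < d \<Longrightarrow> 0 < t \<Longrightarrow> t < d \<Longrightarrow> diff_quot \<phi> s y t < c"
proof -
  have "eventually (\<lambda>(y, t). ereal (diff_quot \<phi> s y t) < ereal c) (nhds r \<times>\<^sub>F at_right 0)"
    using Limsup_lessD[of "nhds r \<times>\<^sub>F at_right 0" "\<lambda>(y, t). ereal (diff_quot \<phi> s y t)" "ereal c"] assms
    by (simp add: Limsup_eq) (simp add: case_prod_unfold)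
  then show ?thesis unfolding eventually_nhds_prod_at_right_0 using that by auto
qed

lemma dd_leI:
  assumes "d > 0" "\<And>y t. \<bar>y - r\<bar> < d \<Longrightarrow> 0 < t \<Longrightarrow> t < d \<Longrightarrow> diff_quot \<phi> s y t \<le> c"
  shows "dd r s \<le> c"
proof -
  have "Limsup (nhds r \<times>\<^sub>F at_right 0) (\<lambda>(y, t). ereal (diff_quot \<phi> s y t)) \<le> ereal c"
    by (rule Limsup_bounded) (use assms in \<open>auto simp: eventually_nhds_prod_at_right_0\<close>)
  then show ?thesis by (simp add: Limsup_eq)
qed

text \<open>The quotient in direction \<open>s + s'\<close> splits at the intermediate point
  \<open>y + t * s'\<close>. This works because the base point of the Clarke derivative is itself
  variable.\<close>

lemma dd_subadditive: "dd r (s + s') \<le> dd r s + dd r s'"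
proof (rule field_le_epsilon)
  fix e :: real assume e: "e > 0"
  obtain d where d: "d > 0" "\<And>y t. \<bar>y - r\<bar> < d \<Longrightarrow> 0 < t \<Longrightarrow> t < d \<Longrightarrow> diff_quot \<phi> s y t < dd r s + e / 2"
    using dd_lessD[of r s "dd r s + e / 2"] e by auto
  obtain d' where d': "d' > 0" "\<And>y t. \<bar>y - r\<bar> < d' \<Longrightarrow> 0 < t \<Longrightarrow> t < d' \<Longrightarrow> diff_quot \<phi> s' y t < dd r s' + e / 2"
    using dd_lessD[of r s' "dd r s' + e / 2"] e by auto
  \<comment> \<open>Keeps the shifted base point \<open>y + t * s'\<close> within \<open>d\<close>
    of \<open>r\<close>.\<close>
  define k where "k = min (d / (2 * (1 + \<bar>s'\<bar>))) d'"
  show "dd r (s + s') \<le> dd r s + dd r s' + e"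
  proof (rule dd_leI)
    show "k > 0" using d d' by (simp add: k_def)
    fix y t assume y: "\<bar>y - r\<bar> < k" and t: "0 < t" "t < k"
    have k: "k \<le> d / (2 * (1 + \<bar>s'\<bar>))" "k \<le> d'" by (auto simp: k_def)
    have "d / (2 * (1 + \<bar>s'\<bar>)) \<le> d / 2" "d / (2 * (1 + \<bar>s'\<bar>)) * \<bar>s'\<bar> \<le> d / 2"
      using d(1) by (auto simp: field_simps)
    moreover have "t * \<bar>s'\<bar> \<le> d / (2 * (1 + \<bar>s'\<bar>)) * \<bar>s'\<bar>" using t k by (intro mult_right_mono) auto
    moreover have "\<bar>t * s'\<bar> = t * \<bar>s'\<bar>" using t by (simp add: abs_mult)
    ultimately have "\<bar>t * s'\<bar> \<le> d / 2" "k \<le> d / 2" using k(1) by linarith+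
    then have "\<bar>y + t * s' - r\<bar> < d" "t < d" using y t d(1) by linarith+
    then have "diff_quot \<phi> s (y + t * s') t < dd r s + e / 2" using d(2) t by blast
    moreover have "diff_quot \<phi> s' y t < dd r s' + e / 2" using d'(2) y t k by force
    moreover have "diff_quot \<phi> (s + s') y t = diff_quot \<phi> s (y + t * s') t + diff_quot \<phi> s' y t"
      using t by (simp add: diff_quot_def field_simps)
    ultimately show "diff_quot \<phi> (s + s') y t \<le> dd r s + dd r s' + e" by simp
  qed
qed

lemma dd_zero: "0 \<le> dd r 0"
proof (rule ccontr)
  assume "\<not> 0 \<le> dd r 0"
  then obtain d where "d > 0" "\<And>y t. \<bar>y - r\<bar> < d \<Longrightarrow> 0 < t \<Longrightarrow> t < d \<Longrightarrow> diff_quot \<phi> 0 y t < 0"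
    using dd_lessD[of r 0 0] by auto
  from this(2)[of r "d / 2"] this(1) show False by (simp add: diff_quot_def)
qed

lemma dd_minus: "- dd r (- s) \<le> dd r s"
  using dd_subadditive[of r s "- s"] dd_zero[of r] by simp

lemma dd_scale_le:
  assumes k: "k > 0"
  shows "dd r (k * s) \<le> k * dd r s"
proof (rule field_le_epsilon)
  fix e :: real assume e: "e > 0"
  obtain d where d: "d > 0" "\<And>y t. \<bar>y - r\<bar> < d \<Longrightarrow> 0 < t \<Longrightarrow> t < d \<Longrightarrow> diff_quot \<phi> s y t < dd r s + e / k"
    using dd_lessD[of r s "dd r s + e / k"] e k by auto
  show "dd r (k * s) \<le> k * dd r s + e"
  proof (rule dd_leI)
    show "min d (d / k) > 0" using d k by simp
    fix y t assume "\<bar>y - r\<bar> < min d (d / k)" "0 < t" "t < min d (d / k)"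
    then have "diff_quot \<phi> s y (k * t) < dd r s + e / k" using d(2) k by (simp add: field_simps)
    moreover have "diff_quot \<phi> (k * s) y t = k * diff_quot \<phi> s y (k * t)"
      using k by (simp add: diff_quot_def mult_ac)
    ultimately show "diff_quot \<phi> (k * s) y t \<le> k * dd r s + e" using k by (simp add: field_simps)
  qed
qed

text \<open>For \<open>e = 1\<close> and \<open>e = -1\<close> these numbers are the two endpoints
  of the subdifferential, an interval on the line. Positive multiples of \<open>e\<close> follow
  from homogeneity, negative ones from \<open>dd_minus\<close> as well.\<close>

lemma dd_unit_subdiff:
  assumes e: "e = 1 \<or> e = -1"
  shows "e * dd r e \<in> clarke_subdiff \<phi> r"
  unfolding clarke_subdiff_def
proof (intro CollectI allI)
  fix s
  have ee: "e * e = 1" using e by auto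
  consider "s = 0" | "s * e > 0" | "s * e < 0" using e by fastforce
  then show "e * dd r e * s \<le> dd r s"
  proof cases
    case 1
    then show ?thesis using dd_zero by simp
  next
    case 2
    have "dd r e = dd r (inverse (s * e) * s)" using 2 e by (auto simp: field_simps)
    also have "\<dots> \<le> inverse (s * e) * dd r s" using 2 by (intro dd_scale_le positive_imp_inverse_positive)
    finally show ?thesis using 2 by (simp add: field_simps)
  next
    case 3
    have "dd r (- s) = dd r ((- s * e) * e)" using ee by (simp add: mult.assoc)
    also have "\<dots> \<le> (- s * e) * dd r e" using 3 by (intro dd_scale_le) simp
    finally show ?thesis using dd_minus[of r s] by (simp add: mult_ac)
  qed
qed

text \<open>Transfers a growth bound on the subdifferential to the directional derivative; applying
  it to the two endpoints is enough.\<close>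

lemma dd_bound:
  assumes K: "\<And>\<zeta>. \<zeta> \<in> clarke_subdiff \<phi> r \<Longrightarrow> \<bar>\<zeta>\<bar> \<le> K"
  shows "\<bar>dd r s\<bar> \<le> K * \<bar>s\<bar>"
proof -
  have e: "\<bar>dd r e\<bar> \<le> K" if "e = 1 \<or> e = -1" for e
    using K[OF dd_unit_subdiff[OF that]] that by (auto simp: abs_mult)
  have upper: "dd r s \<le> K * \<bar>s\<bar>" for s
  proof (cases "s = 0")
    case True
    have "dd r 0 \<le> 0" by (rule dd_leI[of 1]) (auto simp: diff_quot_def)
    then show ?thesis using True by simp
  next
    case False
    have "dd r s = dd r (\<bar>s\<bar> * sgn s)" by (simp add: abs_mult_sgn)
    also have "\<dots> \<le> \<bar>s\<bar> * dd r (sgn s)" using False by (intro dd_scale_le) simp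
    also have "\<dots> \<le> \<bar>s\<bar> * K"
      using e[of "sgn s"] False by (intro mult_left_mono) (auto simp: sgn_if)
    finally show ?thesis by (simp add: mult.commute)
  qed
  show ?thesis using upper[of s] upper[of "- s"] dd_minus[of r s] by simp
qed

text \<open>A bound on the quotients valid within \<open>d\<close> of \<open>r\<close> is valid
  within \<open>d / 2\<close> of every point that is \<open>d / 2\<close>-close to \<open>r\<close>.
  The intermediate value \<open>c'\<close> keeps the final inequality strict.\<close>

lemma dd_upper_semicontinuous:
  assumes f: "f \<longlonglongrightarrow> r" and c: "dd r s < c"
  shows "\<forall>\<^sub>F n in sequentially. dd (f n) s < c"
proof -
  obtain c' where c': "dd r s < c'" "c' < c" using dense[OF c] by blast
  obtain d where d: "d > 0" "\<And>y t. \<bar>y - r\<bar> < d \<Longrightarrow> 0 < t \<Longrightarrow> t < d \<Longrightarrow> diff_quot \<phi> s y t < c'"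
    using dd_lessD[OF c'(1)] by metis
  have "\<forall>\<^sub>F n in sequentially. dist (f n) r < d / 2"
    using tendstoD[OF f, of "d / 2"] d(1) by simp
  then show ?thesis
  proof eventually_elim
    case (elim n)
    have "dd (f n) s \<le> c'"
    proof (rule dd_leI[of "d / 2"])
      fix y t assume "\<bar>y - f n\<bar> < d / 2" "0 < t" "t < d / 2"
      moreover from this have "\<bar>y - r\<bar> < d"
        using elim unfolding dist_real_def by linarith
      ultimately show "diff_quot \<phi> s y t \<le> c'"
        by (intro less_imp_le d(2)) auto
    qed (use d in simp)
    then show ?case using c'(2) by simp
  qed
qed

text \<open>Expresses the sublevel condition by countable quantifiers, so that measurability in a
  parameter can be read off.\<close>

lemma dd_less_iff:
  "dd r s < c \<longleftrightarrow> (\<exists>c'::rat. of_rat c' < c \<and> (\<exists>k::nat. \<forall>p t::rat.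
     \<bar>of_rat p\<bar> < inverse (real (Suc k)) \<and> 0 < (of_rat t::real) \<and> of_rat t < inverse (real (Suc k)) \<longrightarrow>
       diff_quot \<phi> s (r + of_rat p) (of_rat t) \<le> of_rat c'))"
proof
  assume "dd r s < c"
  then obtain c' where c': "dd r s < of_rat c'" "of_rat c' < c" using of_rat_dense by blast
  obtain d where d: "d > 0" "\<And>y t. \<bar>y - r\<bar> < d \<Longrightarrow> 0 < t \<Longrightarrow> t < d \<Longrightarrow> diff_quot \<phi> s y t < of_rat c'"
    using dd_lessD[OF c'(1)] by metis
  obtain k where k: "inverse (real (Suc k)) < d" using reals_Archimedean[OF d(1)] by blast
  show "\<exists>c'::rat. of_rat c' < c \<and> (\<exists>k::nat. \<forall>p t::rat.
     \<bar>of_rat p\<bar> < inverse (real (Suc k)) \<and> 0 < (of_rat t::real) \<and> of_rat t < inverse (real (Suc k)) \<longrightarrow>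
       diff_quot \<phi> s (r + of_rat p) (of_rat t) \<le> of_rat c')"
    by (intro exI[of _ c'] exI[of _ k] conjI c' allI impI less_imp_le[OF d(2)]) (use k in auto)
next
  assume "\<exists>c'::rat. of_rat c' < c \<and> (\<exists>k::nat. \<forall>p t::rat.
     \<bar>of_rat p\<bar> < inverse (real (Suc k)) \<and> 0 < (of_rat t::real) \<and> of_rat t < inverse (real (Suc k)) \<longrightarrow>
       diff_quot \<phi> s (r + of_rat p) (of_rat t) \<le> of_rat c')"
  then obtain c' :: rat and k :: nat where c': "of_rat c' < c"
    and le: "\<And>p t. \<bar>of_rat p\<bar> < inverse (real (Suc k)) \<Longrightarrow> 0 < (of_rat t::real) \<Longrightarrow> of_rat t < inverse (real (Suc k)) \<Longrightarrow>
       diff_quot \<phi> s (r + of_rat p) (of_rat t) \<le> of_rat c'" by blast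
  define d where "d = inverse (real (Suc k))"
  define U where "U = {-d<..<d} \<times> {0<..<d}"
  \<comment> \<open>By continuity a violated bound is violated on an open set of pairs, which
    contains a rational pair.\<close>
  have "continuous_on U (\<lambda>z. diff_quot \<phi> s (r + fst z) (snd z))"
    unfolding diff_quot_def
    by (intro continuous_intros continuous_on_compose2[OF continuous]) (auto simp: U_def)
  then have op: "open (U \<inter> (\<lambda>z. diff_quot \<phi> s (r + fst z) (snd z)) -` {of_rat c'<..})"
    by (intro continuous_open_preimage) (auto simp: U_def open_Times)
  have "dd r s \<le> of_rat c'"
  proof (rule dd_leI)
    show "d > 0" by (simp add: d_def)
    fix y t assume y: "\<bar>y - r\<bar> < d" and t: "0 < t" "t < d"
    show "diff_quot \<phi> s y t \<le> of_rat c'"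
    proof (rule ccontr)
      assume "\<not> diff_quot \<phi> s y t \<le> of_rat c'"
      then have "(y - r, t) \<in> U \<inter> (\<lambda>z. diff_quot \<phi> s (r + fst z) (snd z)) -` {of_rat c'<..}"
        using y t by (auto simp: U_def)
      from open_prod_elim[OF op this] obtain A B where AB: "open A" "open B" "(y - r, t) \<in> A \<times> B"
        "A \<times> B \<subseteq> U \<inter> (\<lambda>z. diff_quot \<phi> s (r + fst z) (snd z)) -` {of_rat c'<..}" .
      from AB(3) have yA: "y - r \<in> A" and tB: "t \<in> B" by auto
      have rat: "\<exists>q. of_rat q \<in> S" if S: "open S" "x \<in> S" for S and x :: real
      proof -
        obtain e where e: "e > 0" "ball x e \<subseteq> S"
          using S by (rule openE)
        obtain q where "x < of_rat q" "of_rat q < x + e" using of_rat_dense[of x "x + e"] e by auto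
        then show ?thesis using e by (intro exI[of _ q]) (auto simp: dist_real_def subset_eq)
      qed
      obtain p q where "of_rat p \<in> A" "of_rat q \<in> B" using rat[OF AB(1) yA] rat[OF AB(2) tB] by blast
      then have "(of_rat p, of_rat q) \<in> U" "of_rat c' < diff_quot \<phi> s (r + of_rat p) (of_rat q)"
        using AB(4) by auto
      moreover from this have "\<bar>of_rat p\<bar> < d" "0 < (of_rat q::real)" "of_rat q < d"
        unfolding U_def mem_Sigma_iff greaterThanLessThan_iff by linarith+
      ultimately show False using le[of p q, folded d_def] by linarith
    qed
  qed
  then show "dd r s < c" using c' by simp
qed

end

section \<open>Measurability of superposition operators\<close>

text \<open>Rounding \<open>f\<close> down to multiples of \<open>1 / real (Suc n)\<close> leaves
  countably many values, for which measurability is clear; continuity in the second argument gives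
  the limit.\<close>

lemma borel_measurable_caratheodory:
  fixes h :: "'a \<Rightarrow> real \<Rightarrow> real"
  assumes h: "\<And>r. (\<lambda>x. h x r) \<in> borel_measurable M" and cont: "\<And>x. continuous_on UNIV (h x)"
    and f [measurable]: "f \<in> borel_measurable M"
  shows "(\<lambda>x. h x (f x)) \<in> borel_measurable M"
proof (rule borel_measurable_LIMSEQ_real)
  fix n :: nat
  show "(\<lambda>x. h x (of_int \<lfloor>real (Suc n) * f x\<rfloor> / real (Suc n))) \<in> borel_measurable M"
    by (rule measurable_compose_countable[where f = "\<lambda>i x. h x (of_int i / real (Suc n))"
          and g = "\<lambda>x. \<lfloor>real (Suc n) * f x\<rfloor>"]) (use h in auto)
next
  fix x
  have "(\<lambda>n. of_int \<lfloor>real (Suc n) * f x\<rfloor> / real (Suc n)) \<longlonglongrightarrow> f x"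
  proof (rule LIM_zero_cancel, rule Lim_null_comparison[OF _ LIMSEQ_inverse_real_of_nat])
    have "norm (of_int \<lfloor>real (Suc n) * f x\<rfloor> / real (Suc n) - f x) \<le> inverse (real (Suc n))" for n
    proof -
      have "of_int \<lfloor>real (Suc n) * f x\<rfloor> / real (Suc n) - f x =
          (of_int \<lfloor>real (Suc n) * f x\<rfloor> - real (Suc n) * f x) / real (Suc n)"
        by (simp add: field_simps del: of_nat_Suc)
      moreover have "\<bar>of_int \<lfloor>real (Suc n) * f x\<rfloor> - real (Suc n) * f x\<bar> \<le> 1" by linarith
      ultimately show ?thesis by (simp add: divide_inverse abs_mult mult_left_le_one_le del: of_nat_Suc)
    qed
    then show "\<forall>\<^sub>F n in sequentially. norm (of_int \<lfloor>real (Suc n) * f x\<rfloor> / real (Suc n) - f x) \<le> inverse (real (Suc n))"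
      by simp
  qed
  moreover have "isCont (h x) (f x)" using cont[of x] by (simp add: continuous_on_eq_continuous_at)
  ultimately show "(\<lambda>n. h x (of_int \<lfloor>real (Suc n) * f x\<rfloor> / real (Suc n))) \<longlonglongrightarrow> h x (f x)"
    by (rule isCont_tendsto_compose[rotated])
qed

lemma borel_measurable_clarke_dd_everywhere:
  fixes h :: "'a \<Rightarrow> real \<Rightarrow> real"
  assumes h: "\<And>r. (\<lambda>x. h x r) \<in> borel_measurable M" and lip: "\<And>x. locally_lipschitz (h x)"
    and f [measurable]: "f \<in> borel_measurable M" and g [measurable]: "g \<in> borel_measurable M"
  shows "(\<lambda>x. clarke_dd (h x) (f x) (g x)) \<in> borel_measurable M"
proof -
  have cont: "continuous_on UNIV (h x)" for x
    by (rule loc_lip.continuous) (simp add: loc_lip_def lip)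
  have [measurable]: "(\<lambda>x. diff_quot (h x) (g x) (f x + p) t) \<in> borel_measurable M" for p t
    unfolding diff_quot_def
    by (intro borel_measurable_divide borel_measurable_diff borel_measurable_const
        borel_measurable_caratheodory[OF h cont]) measurable
  show ?thesis
    unfolding borel_measurable_iff_less loc_lip.dd_less_iff[OF loc_lip.intro[OF lip]]
    by measurable
qed

text \<open>The sublevel sets of \<open>f\<close> and \<open>g\<close> differ only inside a null
  set, whose subsets are measurable by completeness.\<close>

lemma (in complete_measure) borel_measurable_AE_cong:
  fixes f g :: "'a \<Rightarrow> real"
  assumes f: "f \<in> borel_measurable M" and eq: "AE x in M. f x = g x"
  shows "g \<in> borel_measurable M"
  unfolding borel_measurable_iff_less
proof
  fix a
  show "{x \<in> space M. g x < a} \<in> sets M"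
  proof (rule in_sets_AE)
    show "AE x in M. x \<in> {x \<in> space M. f x < a} \<longleftrightarrow> x \<in> {x \<in> space M. g x < a}"
      using eq by eventually_elim auto
  qed (use f in auto)
qed

lemma (in complete_measure) borel_measurable_clarke_dd:
  fixes h :: "'a \<Rightarrow> real \<Rightarrow> real"
  assumes h: "\<And>r. (\<lambda>x. h x r) \<in> borel_measurable M" and lip: "AE x in M. locally_lipschitz (h x)"
    and f: "f \<in> borel_measurable M" and g: "g \<in> borel_measurable M"
  shows "(\<lambda>x. clarke_dd (h x) (f x) (g x)) \<in> borel_measurable M"
proof -
  obtain N where N: "N \<in> null_sets M" "{x \<in> space M. \<not> locally_lipschitz (h x)} \<subseteq> N"
    using lip by (auto elim: AE_E simp: null_sets_def)
  \<comment> \<open>Replacing the integrand by 0 on a null set makes it locally Lipschitz for every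
    \<open>x\<close>; completeness undoes the change.\<close>
  define h' where "h' = (\<lambda>x r. if x \<in> space M - N then h x r else 0)"
  have "locally_lipschitz (\<lambda>_. 0)"
    unfolding locally_lipschitz_def
    by (intro allI exI[of _ "1::real"] conjI exI[of _ "0::real"] lipschitz_onI) auto
  then have "locally_lipschitz (h' x)" for x
    using N(2) unfolding h'_def by (cases "x \<in> space M - N") (auto simp: fun_eq_iff)
  moreover have "(\<lambda>x. h' x r) \<in> borel_measurable M" for r
    unfolding h'_def using h[of r] N(1) by (intro measurable_If_set) auto
  ultimately have "(\<lambda>x. clarke_dd (h' x) (f x) (g x)) \<in> borel_measurable M"
    by (intro borel_measurable_clarke_dd_everywhere f g)
  then show ?thesis
  proof (rule borel_measurable_AE_cong)
    show "AE x in M. clarke_dd (h' x) (f x) (g x) = clarke_dd (h x) (f x) (g x)"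
      using AE_not_in[OF N(1)] AE_space by eventually_elim (simp add: h'_def)
  qed
qed

text \<open>Every subset of a set of outer measure 0 satisfies the Caratheodory criterion.\<close>

lemma complete_hausdorff_measure: "complete_measure (hausdorff_measure k)"
proof
  fix A B :: "'a set" assume AB: "A \<subseteq> B" and B: "B \<in> null_sets (hausdorff_measure k)"
  let ?\<mu> = "hausdorff_outer k :: 'a set \<Rightarrow> ennreal"
  have mono: "?\<mu> S \<le> ?\<mu> T" if "S \<subseteq> T" for S T
    using outer_measure_space_hausdorff_outer[of k] that by (auto simp: outer_measure_space_def increasing_def)
  have B0: "?\<mu> B = 0" and sets_B: "B \<in> sets (hausdorff_measure k)"
    using B emeasure_hausdorff_measure[of B k] by (auto simp: null_sets_def)
  have "?\<mu> (A \<inter> x) + ?\<mu> (- A \<inter> x) = ?\<mu> x" for x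
  proof -
    have zero: "?\<mu> (A \<inter> x) = 0" "?\<mu> (B \<inter> x) = 0"
      using mono[of "A \<inter> x" B] mono[of "B \<inter> x" B] AB B0 by auto
    have "?\<mu> x = ?\<mu> (B \<inter> x) + ?\<mu> (- B \<inter> x)"
      using sets_B by (simp add: sets_hausdorff_measure lambda_system_def Compl_eq_Diff_UNIV)
    also have "\<dots> \<le> ?\<mu> (- A \<inter> x)" using AB by (simp add: zero) (intro mono, auto)
    finally show ?thesis using mono[of "- A \<inter> x" x] by (simp add: zero antisym)
  qed
  then show "A \<in> sets (hausdorff_measure k)"
    by (simp add: sets_hausdorff_measure lambda_system_def Compl_eq_Diff_UNIV)
qed

lemma complete_surface_measure:
  fixes S :: "'a::euclidean_space set"
  assumes S: "S \<in> sets (hausdorff_measure (DIM('a) - 1))"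
  shows "complete_measure (surface_measure S)"
proof
  fix A B :: "'a set" assume "A \<subseteq> B" "B \<in> null_sets (surface_measure S)"
  then have "B \<subseteq> S" "B \<in> null_sets (hausdorff_measure (DIM('a) - 1))" "A \<subseteq> B"
    using null_sets_restrict_space[OF S] by (auto simp: surface_measure_def)
  then have "A \<in> sets (hausdorff_measure (DIM('a) - 1))" "A \<subseteq> S"
    using complete_measure.complete[OF complete_hausdorff_measure] by auto
  then show "A \<in> sets (surface_measure S)"
    using S by (auto simp: surface_measure_def sets_restrict_space)
qed

section \<open>Convergence of functionals\<close>

text \<open>Places \<open>f k\<close> at index \<open>\<tau> k\<close> and the limit at all other
  indices. It extends a sequence known only along a subsequence to all indices without changing its
  limit.\<close>

lemma tendsto_fill_subsequence:
  fixes \<tau> :: "nat \<Rightarrow> nat" and f :: "nat \<Rightarrow> 'b::metric_space"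
  assumes \<tau>: "strict_mono \<tau>" and f: "f \<longlonglongrightarrow> c"
  shows "(\<lambda>m. if m \<in> range \<tau> then f (inv \<tau> m) else c) \<longlonglongrightarrow> c"
proof (rule metric_LIMSEQ_I)
  fix e :: real assume e: "e > 0"
  obtain K where K: "\<And>k. k \<ge> K \<Longrightarrow> dist (f k) c < e"
    using metric_LIMSEQ_D[OF f e] by blast
  have "dist (if m \<in> range \<tau> then f (inv \<tau> m) else c) c < e" if "m \<ge> \<tau> K" for m
  proof (cases "m \<in> range \<tau>")
    case True
    then obtain k where k: "m = \<tau> k" by blast
    have "k \<ge> K" using that k strict_mono_less_eq[OF \<tau>] by simp
    then show ?thesis using K k inv_f_f[OF strict_mono_imp_inj_on[OF \<tau>]] by simp
  qed (use e in simp)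
  then show "\<exists>N. \<forall>m\<ge>N. dist (if m \<in> range \<tau> then f (inv \<tau> m) else c) c < e" by blast
qed

context bounded_open
begin

lemma h1_norm_nonneg [simp]: "0 \<le> h1_norm \<Omega> v"
  by (simp add: h1_norm_def)

lemma h1_dual_linear:
  assumes l: "l \<in> h1_dual \<Omega>"
  shows "\<lbrakk>u \<in> H1 \<Omega>; v \<in> H1 \<Omega>\<rbrakk> \<Longrightarrow> l (u + v) = l u + l v"
    and "v \<in> H1 \<Omega> \<Longrightarrow> l (c *\<^sub>R v) = c * l v"
    and "\<lbrakk>u \<in> H1 \<Omega>; v \<in> H1 \<Omega>\<rbrakk> \<Longrightarrow> l (u - v) = l u - l v"
    and "\<exists>C. \<forall>v\<in>H1 \<Omega>. \<bar>l v\<bar> \<le> C * h1_norm \<Omega> v"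
proof -
  have d: "h1.dual_on (H1 \<Omega>) l" using l by (simp add: h1_dual_iff)
  show add: "\<lbrakk>u \<in> H1 \<Omega>; v \<in> H1 \<Omega>\<rbrakk> \<Longrightarrow> l (u + v) = l u + l v" for u v
    using d unfolding h1.dual_on_def by blast
  show scale: "v \<in> H1 \<Omega> \<Longrightarrow> l (c *\<^sub>R v) = c * l v" for c v
    using d unfolding h1.dual_on_def by blast
  show "\<lbrakk>u \<in> H1 \<Omega>; v \<in> H1 \<Omega>\<rbrakk> \<Longrightarrow> l (u - v) = l u - l v"
    using add[of u "(-1) *\<^sub>R v"] scale[of v "-1"] h1.scale_V[of v "-1"] by simp
  show "\<exists>C. \<forall>v\<in>H1 \<Omega>. \<bar>l v\<bar> \<le> C * h1_norm \<Omega> v"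
    using d unfolding h1.dual_on_def h1_nrm by blast
qed

text \<open>By weak compactness of the unit ball, convergence along weakly convergent sequences
  upgrades to convergence in the dual norm.\<close>

lemma functional_norm_convergence:
  assumes L: "L \<in> h1_dual \<Omega>" and Lk: "\<And>n. Lk n \<in> h1_dual \<Omega>"
    and conv: "\<And>z z0. weakly_converges_h1 \<Omega> z z0 \<Longrightarrow> (\<lambda>n. Lk n (z n)) \<longlonglongrightarrow> L z0"
    and e: "e > 0"
  shows "\<forall>\<^sub>F n in sequentially. \<forall>v\<in>H1 \<Omega>. \<bar>Lk n v - L v\<bar> \<le> e * h1_norm \<Omega> v"
proof (rule ccontr)
  assume "\<not> ?thesis"
  from not_eventually_sequentiallyD[OF this] obtain r :: "nat \<Rightarrow> nat" where r: "strict_mono r"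
    and bad: "\<And>k. \<exists>v\<in>H1 \<Omega>. e * h1_norm \<Omega> v < \<bar>Lk (r k) v - L v\<bar>"
    by (auto simp: not_le)
  have "\<exists>v\<in>H1 \<Omega>. h1_norm \<Omega> v = 1 \<and> e < \<bar>Lk (r k) v - L v\<bar>" for k
  proof -
    obtain v where v: "v \<in> H1 \<Omega>" "e * h1_norm \<Omega> v < \<bar>Lk (r k) v - L v\<bar>" using bad by blast
    \<comment> \<open>Bounded functionals vanish on vectors of norm 0, so a violating
      \<open>v\<close> has positive norm and can be normalised.\<close>
    obtain C D where CD: "\<bar>Lk (r k) v\<bar> \<le> C * h1_norm \<Omega> v" "\<bar>L v\<bar> \<le> D * h1_norm \<Omega> v"
      using h1_dual_linear(4)[OF L] h1_dual_linear(4)[OF Lk[of "r k"]] v(1) by blast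
    have "h1_norm \<Omega> v \<noteq> 0" using v(2) CD by auto
    then have pos: "h1_norm \<Omega> v > 0" using h1_norm_nonneg[of v] by linarith
    let ?w = "inverse (h1_norm \<Omega> v) *\<^sub>R v"
    have w: "?w \<in> H1 \<Omega>" by (intro h1.scale_V v)
    moreover have "h1_norm \<Omega> ?w = 1"
      using h1.nrm_scale[OF v(1), of "inverse (h1_norm \<Omega> v)"] pos by (simp add: h1_nrm)
    moreover have "Lk (r k) ?w - L ?w = inverse (h1_norm \<Omega> v) * (Lk (r k) v - L v)"
      using v(1) by (simp add: h1_dual_linear(2) L Lk right_diff_distrib)
    then have "\<bar>Lk (r k) ?w - L ?w\<bar> = \<bar>Lk (r k) v - L v\<bar> / h1_norm \<Omega> v"
      using pos by (simp add: abs_mult divide_inverse)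
    then have "e < \<bar>Lk (r k) ?w - L ?w\<bar>" using v(2) pos_less_divide_eq[OF pos] by metis
    ultimately show ?thesis by blast
  qed
  then obtain v where v: "\<And>k. v k \<in> H1 \<Omega>" "\<And>k. h1_norm \<Omega> (v k) = 1"
    "\<And>k. e < \<bar>Lk (r k) (v k) - L (v k)\<bar>" by metis
  obtain \<sigma> w where \<sigma>: "strict_mono \<sigma>" and w: "weakly_converges_h1 \<Omega> (\<lambda>n. v (\<sigma> n)) w"
    using h1_weak_compactness[of v 1] v(1,2) by auto
  define \<tau> where "\<tau> = r \<circ> \<sigma>"
  have \<tau>: "strict_mono \<tau>" using r \<sigma> by (simp add: \<tau>_def strict_mono_o)
  \<comment> \<open>The hypothesis \<open>conv\<close> pairs \<open>Lk n\<close> with a sequence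
    indexed by every \<open>n\<close>, hence the gaps are filled with the weak limit.\<close>
  define z where "z = (\<lambda>m. if m \<in> range \<tau> then v (\<sigma> (inv \<tau> m)) else w)"
  have "weakly_converges_h1 \<Omega> z w"
    unfolding weakly_converges_h1_def
  proof (intro conjI allI ballI)
    show "z n \<in> H1 \<Omega>" for n using v w by (simp add: z_def weakly_converges_h1_def)
    show "w \<in> H1 \<Omega>" using w by (simp add: weakly_converges_h1_def)
    fix l assume "l \<in> h1_dual \<Omega>"
    then have "(\<lambda>n. l (v (\<sigma> n))) \<longlonglongrightarrow> l w" using w by (simp add: weakly_converges_h1_def)
    from tendsto_fill_subsequence[OF \<tau> this] show "(\<lambda>n. l (z n)) \<longlonglongrightarrow> l w"
      by (simp add: z_def if_distrib cong: if_cong)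
  qed
  from conv[OF this] have "(\<lambda>k. Lk (\<tau> k) (z (\<tau> k))) \<longlonglongrightarrow> L w"
    using LIMSEQ_subseq_LIMSEQ[OF _ \<tau>] by (force simp: comp_def)
  moreover have "z (\<tau> k) = v (\<sigma> k)" for k
    using inv_f_f[OF strict_mono_imp_inj_on[OF \<tau>]] by (simp add: z_def)
  ultimately have "(\<lambda>k. Lk (\<tau> k) (v (\<sigma> k))) \<longlonglongrightarrow> L w" by simp
  moreover have "(\<lambda>k. L (v (\<sigma> k))) \<longlonglongrightarrow> L w"
    using w L by (simp add: weakly_converges_h1_def)
  ultimately have "(\<lambda>k. Lk (\<tau> k) (v (\<sigma> k)) - L (v (\<sigma> k))) \<longlonglongrightarrow> 0"
    using tendsto_diff by fastforce
  from LIMSEQ_D[OF this e] obtain N where "\<bar>Lk (\<tau> N) (v (\<sigma> N)) - L (v (\<sigma> N))\<bar> < e" by auto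
  then show False using v(3)[of "\<sigma> N"] by (simp add: \<tau>_def)
qed

end

section \<open>The boundary\<close>

lemma surface_measure_restrict:
  fixes S T :: "'a::euclidean_space set"
  assumes "S \<in> sets (hausdorff_measure (DIM('a) - 1))" "T \<in> sets (hausdorff_measure (DIM('a) - 1))" "T \<subseteq> S"
  shows "surface_measure T = restrict_space (surface_measure S) T" "T \<in> sets (surface_measure S)"
proof -
  have "S \<inter> T = T" using assms(3) by blast
  then show "surface_measure T = restrict_space (surface_measure S) T"
    using assms restrict_restrict_space[of S "hausdorff_measure (DIM('a) - 1)" T]
    by (simp add: surface_measure_def sets.Int_space_eq2)
  show "T \<in> sets (surface_measure S)"
    using assms by (auto simp: surface_measure_def sets_restrict_space)
qed

lemma L2_restrict_space:
  fixes f :: "'a \<Rightarrow> real"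
  assumes f: "f \<in> L2 M" and T: "T \<in> sets M"
  shows "f \<in> L2 (restrict_space M T)" "l2_norm (restrict_space M T) f \<le> l2_norm M f"
proof -
  have T': "T \<inter> space M \<in> sets M" using T by simp
  have int: "integrable M (\<lambda>x. indicator T x * (f x)\<^sup>2)"
    using integrable_mult_indicator[OF T L2_D(2)[OF f]] by simp
  show "f \<in> L2 (restrict_space M T)"
    using f int T' by (simp add: L2_def integrable_restrict_space measurable_restrict_space1)
  show "l2_norm (restrict_space M T) f \<le> l2_norm M f"
    unfolding l2_norm_def using int L2_D(2)[OF f] T'
    by (auto simp: integral_restrict_space indicator_def intro!: integral_mono real_sqrt_le_mono)
qed

text \<open>The growth constants \<open>c\<^sub>0\<close> and \<open>c\<^sub>1\<close> are
  parameters, so that all estimates share them. The constant \<open>m\<^sub>j\<close> enters only in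
  \<open>solution_stability\<close>.\<close>

locale hemivariational = bounded_open \<Omega> for \<Omega> :: "'a::euclidean_space set" +
  fixes \<gamma> :: "('a \<Rightarrow> real) \<Rightarrow> ('a \<Rightarrow> real)" and \<Gamma>\<^sub>1 \<Gamma>\<^sub>3 :: "'a set"
    and j :: "'a \<Rightarrow> real \<Rightarrow> real" and m\<^sub>a \<alpha> b c\<^sub>0 c\<^sub>1 :: real
  assumes trace: "trace_operator \<Omega> \<gamma>" and trace_compact: "compact_trace \<Omega> \<gamma>"
    and portions: "\<Gamma>\<^sub>1 \<subseteq> frontier \<Omega>" "\<Gamma>\<^sub>3 \<subseteq> frontier \<Omega>"
    and portions_measurable: "\<Gamma>\<^sub>1 \<in> sets (hausdorff_measure (DIM('a) - 1))"
      "\<Gamma>\<^sub>3 \<in> sets (hausdorff_measure (DIM('a) - 1))" "frontier \<Omega> \<in> sets (hausdorff_measure (DIM('a) - 1))"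
    and ma_pos: "m\<^sub>a > 0"
    and coercive: "v \<in> V0 \<Omega> \<gamma> \<Gamma>\<^sub>1 \<Longrightarrow> dirichlet_form \<Omega> v v \<ge> m\<^sub>a * (h1_norm \<Omega> v)\<^sup>2"
    and j_measurable: "(\<lambda>x. j x r) \<in> borel_measurable (surface_measure \<Gamma>\<^sub>3)"
    and j_lipschitz: "AE x in surface_measure \<Gamma>\<^sub>3. locally_lipschitz (j x)"
    and c_nonneg: "c\<^sub>0 \<ge> 0" "c\<^sub>1 \<ge> 0"
    and j_growth: "AE x in surface_measure \<Gamma>\<^sub>3.
      \<forall>r. \<forall>\<zeta> \<in> clarke_subdiff (j x) r. \<bar>\<zeta>\<bar> \<le> c\<^sub>0 + c\<^sub>1 * \<bar>r\<bar>"
    and j_sign: "AE x in surface_measure \<Gamma>\<^sub>3. \<forall>r. clarke_dd (j x) r (b - r) \<le> 0"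
    and alpha_pos: "\<alpha> > 0"
begin

abbreviation "S \<equiv> surface_measure (frontier \<Omega>)"
abbreviation "S1 \<equiv> surface_measure \<Gamma>\<^sub>1"
abbreviation "S3 \<equiv> surface_measure \<Gamma>\<^sub>3"

lemma S1_restrict: "S1 = restrict_space S \<Gamma>\<^sub>1" "\<Gamma>\<^sub>1 \<in> sets S"
  and S3_restrict: "S3 = restrict_space S \<Gamma>\<^sub>3" "\<Gamma>\<^sub>3 \<in> sets S"
  using surface_measure_restrict portions portions_measurable by blast+

lemma AE_S1: "AE x in S. P x \<Longrightarrow> AE x in S1. P x"
  and AE_S3: "AE x in S. P x \<Longrightarrow> AE x in S3. P x"
  unfolding S1_restrict(1) S3_restrict(1)
  using S1_restrict(2) S3_restrict(2) by (auto simp: AE_restrict_space_iff)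

lemma L2_S1:
  fixes f :: "'a \<Rightarrow> real"
  assumes "f \<in> L2 S"
  shows "f \<in> L2 S1" "l2_norm S1 f \<le> l2_norm S f"
  unfolding S1_restrict(1) using L2_restrict_space[OF assms S1_restrict(2)] by auto

lemma L2_S3:
  fixes f :: "'a \<Rightarrow> real"
  assumes "f \<in> L2 S"
  shows "f \<in> L2 S3" "l2_norm S3 f \<le> l2_norm S f"
  unfolding S3_restrict(1) using L2_restrict_space[OF assms S3_restrict(2)] by auto

text \<open>The constant 1 has trace 1 almost everywhere, and traces are square integrable.\<close>

lemma finite_measure_S: "finite_measure S"
proof -
  have one: "(\<lambda>_. 1) \<in> H1 \<Omega>" using has_weak_gradient_const by (auto simp: H1_def)
  then have L2: "\<gamma> (\<lambda>_. 1) \<in> L2 S" and ae: "AE x in S. \<gamma> (\<lambda>_. 1) x = 1"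
    using trace by (auto simp: trace_operator_def)
  have "integrable S (\<lambda>x. (norm (\<gamma> (\<lambda>_. 1) x))\<^sup>2) \<longleftrightarrow> integrable S (\<lambda>_. 1::real)"
    by (rule integrable_cong_AE) (use L2_D(1)[OF L2] ae in auto)
  then have "integrable S (\<lambda>_. 1::real)" using L2_D(2)[OF L2] by simp
  then show ?thesis by (intro finite_measureI) (auto simp: integrable_iff_bounded)
qed

sublocale S3: finite_measure S3
  using finite_measure_restrict_space[OF finite_measure_S, of \<Gamma>\<^sub>3] S3_restrict by simp

sublocale S3: complete_measure S3
  by (rule complete_surface_measure) (rule portions_measurable)

lemma trace_L2: "v \<in> H1 \<Omega> \<Longrightarrow> \<gamma> v \<in> L2 S"
  using trace by (simp add: trace_operator_def)

lemma trace_add: "u \<in> H1 \<Omega> \<Longrightarrow> v \<in> H1 \<Omega> \<Longrightarrow> AE x in S. \<gamma> (u + v) x = \<gamma> u x + \<gamma> v x"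
  using trace by (simp add: trace_operator_def plus_fun_def)

lemma trace_scale: "v \<in> H1 \<Omega> \<Longrightarrow> AE x in S. \<gamma> (c *\<^sub>R v) x = c * \<gamma> v x"
  using trace by (simp add: trace_operator_def scaleR_fun_def)

lemma trace_minus:
  assumes "v \<in> H1 \<Omega>"
  shows "AE x in S. \<gamma> (- v) x = - \<gamma> v x"
  using trace_scale[OF assms, of "-1"] by simp

lemma trace_diff:
  assumes u: "u \<in> H1 \<Omega>" and v: "v \<in> H1 \<Omega>"
  shows "AE x in S. \<gamma> (u - v) x = \<gamma> u x - \<gamma> v x"
  using trace_add[OF u h1.minus_V[OF v]] trace_minus[OF v] by eventually_elim simp

lemma trace_norm_le:
  assumes v: "v \<in> H1 \<Omega>"
  shows "l2_norm S (\<gamma> v) \<le> trace_norm \<Omega> \<gamma> * h1_norm \<Omega> v"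
proof -
  obtain C where C: "\<And>v. v \<in> H1 \<Omega> \<Longrightarrow> l2_norm S (\<gamma> v) \<le> C * h1_norm \<Omega> v"
    using trace unfolding trace_operator_def by blast
  show ?thesis
  proof (cases "h1_norm \<Omega> v = 0")
    case True
    then show ?thesis using C[OF v] by simp
  next
    case False
    then have pos: "h1_norm \<Omega> v > 0" using h1_norm_nonneg[of v] by linarith
    let ?w = "inverse (h1_norm \<Omega> v) *\<^sub>R v"
    have w: "?w \<in> H1 \<Omega>" by (intro h1.scale_V v)
    have nw: "h1_norm \<Omega> ?w = 1"
      using h1.nrm_scale[OF v, of "inverse (h1_norm \<Omega> v)"] pos by (simp add: h1_nrm)
    \<comment> \<open>A real supremum is an upper bound only for bounded families; boundedness of
      the trace operator provides this.\<close>
    have bdd: "bdd_above ((\<lambda>v. l2_norm S (\<gamma> v)) ` {v \<in> H1 \<Omega>. h1_norm \<Omega> v \<le> 1})"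
    proof (rule bdd_aboveI2)
      fix u assume u: "u \<in> {v \<in> H1 \<Omega>. h1_norm \<Omega> v \<le> 1}"
      have "C * h1_norm \<Omega> u \<le> \<bar>C\<bar> * 1" using u by (intro mult_mono) auto
      then show "l2_norm S (\<gamma> u) \<le> \<bar>C\<bar>" using C[of u] u by simp
    qed
    have "l2_norm S (\<gamma> ?w) \<le> trace_norm \<Omega> \<gamma>"
      unfolding trace_norm_def using w nw by (intro cSUP_upper[OF _ bdd]) simp
    moreover have "l2_norm S (\<gamma> ?w) = l2_norm S (inverse (h1_norm \<Omega> v) *\<^sub>R \<gamma> v)"
      using trace_scale[OF v, of "inverse (h1_norm \<Omega> v)"] L2_D(1)[OF trace_L2[OF w]] L2_D(1)[OF trace_L2[OF v]]
      by (intro l2_norm_AE_cong) (auto simp: scaleR_fun_def)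
    moreover have "\<dots> = inverse (h1_norm \<Omega> v) * l2_norm S (\<gamma> v)"
      using l2.nrm_scale[OF trace_L2[OF v], of "inverse (h1_norm \<Omega> v)"] pos unfolding l2_nrm by simp
    ultimately have "inverse (h1_norm \<Omega> v) * l2_norm S (\<gamma> v) \<le> trace_norm \<Omega> \<gamma>" by simp
    then show ?thesis using pos by (simp add: field_simps)
  qed
qed

lemma trace_norm_S3_le:
  assumes v: "v \<in> H1 \<Omega>"
  shows "l2_norm S3 (\<gamma> v) \<le> trace_norm \<Omega> \<gamma> * h1_norm \<Omega> v"
  using L2_S3(2)[OF trace_L2[OF v]] trace_norm_le[OF v] by linarith

lemma V0_H1: "v \<in> V0 \<Omega> \<gamma> \<Gamma>\<^sub>1 \<Longrightarrow> v \<in> H1 \<Omega>"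
  by (simp add: V0_def)

lemma V0_diff:
  assumes "u \<in> V0 \<Omega> \<gamma> \<Gamma>\<^sub>1" "v \<in> V0 \<Omega> \<gamma> \<Gamma>\<^sub>1"
  shows "u - v \<in> V0 \<Omega> \<gamma> \<Gamma>\<^sub>1"
proof -
  have "AE x in S1. \<gamma> u x = 0" "AE x in S1. \<gamma> v x = 0" using assms by (auto simp: V0_def)
  moreover have "AE x in S1. \<gamma> (u - v) x = \<gamma> u x - \<gamma> v x"
    by (intro AE_S1 trace_diff V0_H1 assms)
  ultimately have "AE x in S1. \<gamma> (u - v) x = 0" by eventually_elim simp
  then show ?thesis using h1.diff_V[OF assms[THEN V0_H1]] by (simp add: V0_def)
qed

lemma V0_minus: "v \<in> V0 \<Omega> \<gamma> \<Gamma>\<^sub>1 \<Longrightarrow> - v \<in> V0 \<Omega> \<gamma> \<Gamma>\<^sub>1"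
  using V0_diff[OF V0_diff, of v v v] by simp

section \<open>Integrability of the Clarke derivative along traces\<close>

lemma clarke_dd_bound:
  "AE x in S3. \<forall>r s. \<bar>clarke_dd (j x) r s\<bar> \<le> (c\<^sub>0 + c\<^sub>1 * \<bar>r\<bar>) * \<bar>s\<bar>"
  using j_lipschitz j_growth
proof eventually_elim
  case (elim x)
  interpret loc_lip "j x" by (rule loc_lip.intro) (rule elim)
  show ?case using dd_bound elim(2) by blast
qed

lemma integrable_growth:
  assumes u: "f \<in> L2 S3" and v: "g \<in> L2 S3"
  shows "integrable S3 (\<lambda>x. (c\<^sub>0 + c\<^sub>1 * \<bar>f x\<bar>) * \<bar>g x\<bar>)"
  using integrable_mult_L2[OF S3.L2_const[of c\<^sub>0] L2_norm[OF v]] integrable_mult_L2[OF L2_norm[OF u] L2_norm[OF v]]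
  by (simp add: distrib_right mult.assoc)

lemma clarke_dd_measurable:
  assumes "f \<in> L2 S3" "g \<in> L2 S3"
  shows "(\<lambda>x. clarke_dd (j x) (f x) (g x)) \<in> borel_measurable S3"
  by (intro S3.borel_measurable_clarke_dd j_measurable j_lipschitz L2_D(1) assms)

lemma integrable_clarke_dd:
  assumes "f \<in> L2 S3" "g \<in> L2 S3"
  shows "integrable S3 (\<lambda>x. clarke_dd (j x) (f x) (g x))"
proof (rule Bochner_Integration.integrable_bound[OF integrable_growth[OF assms] clarke_dd_measurable[OF assms]])
  show "AE x in S3. norm (clarke_dd (j x) (f x) (g x)) \<le> norm ((c\<^sub>0 + c\<^sub>1 * \<bar>f x\<bar>) * \<bar>g x\<bar>)"
    using clarke_dd_bound by eventually_elim (auto intro: order_trans[OF _ abs_ge_self])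
qed

abbreviation J :: "('a \<Rightarrow> real) \<Rightarrow> ('a \<Rightarrow> real) \<Rightarrow> real" where
  "J u v \<equiv> \<integral>x. clarke_dd (j x) (\<gamma> u x) (\<gamma> v x) \<partial>S3"

abbreviation solution :: "(('a \<Rightarrow> real) \<Rightarrow> real) \<Rightarrow> ('a \<Rightarrow> real) \<Rightarrow> bool" where
  "solution \<equiv> hvi_solution \<Omega> \<gamma> \<Gamma>\<^sub>1 \<Gamma>\<^sub>3 j \<alpha>"

lemma solution_D:
  assumes "solution l u"
  shows "u \<in> V0 \<Omega> \<gamma> \<Gamma>\<^sub>1" "u \<in> H1 \<Omega>"
    "v \<in> V0 \<Omega> \<gamma> \<Gamma>\<^sub>1 \<Longrightarrow> l v \<le> dirichlet_form \<Omega> u v + \<alpha> * J u v"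
  using assms by (auto simp: hvi_solution_def V0_def)

lemma trace_L2_S3: "v \<in> H1 \<Omega> \<Longrightarrow> \<gamma> v \<in> L2 S3"
  by (intro L2_S3 trace_L2)

text \<open>The radius depends on the functional only through its bound \<open>K\<close>, so one
  radius serves a whole sequence of problems.\<close>

lemma solution_bounded:
  "\<exists>R. \<forall>l u. l \<in> h1_dual \<Omega> \<longrightarrow> (\<forall>v\<in>H1 \<Omega>. \<bar>l v\<bar> \<le> K * h1_norm \<Omega> v) \<longrightarrow> solution l u \<longrightarrow> h1_norm \<Omega> u \<le> R"
proof -
  define \<mu> where "\<mu> = measure S3 (space S3)"
  \<comment> \<open>\<open>A\<close> and \<open>B\<close> are the coefficients of the bound
    \<open>A + B * t\<close> for the boundary term, where \<open>t\<close> is the norm of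
    \<open>u\<close>. \<open>B\<close> collects the passage from $L^1$ to $L^2$ and the trace
    norm.\<close>
  define A where "A = \<alpha> * (\<bar>b\<bar> * (c\<^sub>0 * \<mu>))"
  define B where "B = \<alpha> * (\<bar>b\<bar> * (c\<^sub>1 * (trace_norm \<Omega> \<gamma> * sqrt \<mu>)))"
  \<comment> \<open>The summand 1 covers norms up to 1. For larger \<open>t\<close>, the constant
    \<open>\<bar>A\<bar>\<close> is at most \<open>\<bar>A\<bar> * t\<close>, and the quadratic
    inequality can be divided by \<open>t\<close>.\<close>
  have "h1_norm \<Omega> u \<le> 1 + (\<bar>A\<bar> + \<bar>B\<bar> + \<bar>K\<bar>) / m\<^sub>a"
    if l: "l \<in> h1_dual \<Omega>" and K: "\<And>v. v \<in> H1 \<Omega> \<Longrightarrow> \<bar>l v\<bar> \<le> K * h1_norm \<Omega> v" and sol: "solution l u" for l u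
  proof -
    note u = solution_D[OF sol]
    define t where "t = h1_norm \<Omega> u"
    have mu: "- u \<in> H1 \<Omega>" using u(2) by (rule h1.minus_V)
    have fu: "\<gamma> u \<in> L2 S3" "\<gamma> (- u) \<in> L2 S3" using u(2) mu trace_L2_S3 by auto
    have "J u (- u) \<le> (\<integral>x. \<bar>b\<bar> * (c\<^sub>0 + c\<^sub>1 * norm (\<gamma> u x)) \<partial>S3)"
    proof (rule integral_mono_AE)
      show "integrable S3 (\<lambda>x. clarke_dd (j x) (\<gamma> u x) (\<gamma> (- u) x))" by (intro integrable_clarke_dd fu)
      show "integrable S3 (\<lambda>x. \<bar>b\<bar> * (c\<^sub>0 + c\<^sub>1 * norm (\<gamma> u x)))"
        using S3.integrable_L2[OF L2_norm[OF fu(1)]] by simp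
      show "AE x in S3. clarke_dd (j x) (\<gamma> u x) (\<gamma> (- u) x) \<le> \<bar>b\<bar> * (c\<^sub>0 + c\<^sub>1 * norm (\<gamma> u x))"
        using AE_S3[OF trace_minus[OF u(2)]] j_sign clarke_dd_bound j_lipschitz
      proof eventually_elim
        case (elim x)
        interpret loc_lip "j x" by (rule loc_lip.intro) (rule elim)
        have "dd (\<gamma> u x) (- \<gamma> u x) \<le> dd (\<gamma> u x) (b - \<gamma> u x) + dd (\<gamma> u x) (- b)"
          using dd_subadditive[of "\<gamma> u x" "b - \<gamma> u x" "- b"] by simp
        also have "\<dots> \<le> 0 + (c\<^sub>0 + c\<^sub>1 * \<bar>\<gamma> u x\<bar>) * \<bar>- b\<bar>"
          using elim(2,3) abs_le_D1 by (intro add_mono) blast+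
        finally show ?case using elim(1) by (simp add: mult.commute)
      qed
    qed
    also have "\<dots> = \<bar>b\<bar> * (c\<^sub>0 * \<mu> + c\<^sub>1 * (\<integral>x. norm (\<gamma> u x) \<partial>S3))"
      using S3.integrable_L2[OF L2_norm[OF fu(1)]] by (simp add: \<mu>_def mult.commute)
    also have "\<dots> \<le> \<bar>b\<bar> * (c\<^sub>0 * \<mu> + c\<^sub>1 * (trace_norm \<Omega> \<gamma> * sqrt \<mu> * t))"
    proof -
      have "(\<integral>x. norm (\<gamma> u x) \<partial>S3) \<le> l2_norm S3 (\<gamma> u) * sqrt \<mu>"
        unfolding \<mu>_def by (rule S3.integral_norm_le_l2_norm[OF fu(1)])
      also have "\<dots> \<le> (trace_norm \<Omega> \<gamma> * t) * sqrt \<mu>"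
        unfolding t_def using trace_norm_S3_le[OF u(2)] by (intro mult_right_mono) (auto simp: \<mu>_def)
      finally show ?thesis using c_nonneg by (intro mult_left_mono add_left_mono) (auto simp: mult_ac)
    qed
    finally have "\<alpha> * J u (- u) \<le> \<alpha> * (\<bar>b\<bar> * (c\<^sub>0 * \<mu> + c\<^sub>1 * (trace_norm \<Omega> \<gamma> * sqrt \<mu> * t)))"
      using alpha_pos by (intro mult_left_mono) auto
    also have "\<dots> = A + B * t" by (simp add: A_def B_def algebra_simps)
    finally have Jle: "\<alpha> * J u (- u) \<le> A + B * t" .
    have "l (- u) \<le> dirichlet_form \<Omega> u (- u) + \<alpha> * J u (- u)" by (rule u(3)[OF V0_minus[OF u(1)]])
    moreover have "dirichlet_form \<Omega> u (- u) = - dirichlet_form \<Omega> u u"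
      using dirichlet.ip_minus[OF u(2) u(2)] dirichlet_form_sym[of u "- u"] by simp
    moreover have "\<bar>l (- u)\<bar> \<le> K * t"
      using K[OF u(2)] h1_dual_linear(2)[OF l u(2), of "-1"] by (simp add: t_def)
    moreover have "m\<^sub>a * t\<^sup>2 \<le> dirichlet_form \<Omega> u u" unfolding t_def by (rule coercive[OF u(1)])
    ultimately have quad: "m\<^sub>a * t\<^sup>2 \<le> A + B * t + K * t" using Jle by linarith
    show ?thesis
    proof (cases "t \<le> 1")
      case True
      then show ?thesis using ma_pos by (simp add: t_def add_increasing2)
    next
      case False
      then have t: "t > 1" by simp
      have "\<bar>A\<bar> * 1 \<le> \<bar>A\<bar> * t" using t by (intro mult_left_mono) auto
      moreover have "B * t \<le> \<bar>B\<bar> * t" "K * t \<le> \<bar>K\<bar> * t" using t by (auto intro: mult_right_mono)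
      ultimately have "m\<^sub>a * t\<^sup>2 \<le> \<bar>A\<bar> * t + \<bar>B\<bar> * t + \<bar>K\<bar> * t" using quad by linarith
      then have "(m\<^sub>a * t) * t \<le> (\<bar>A\<bar> + \<bar>B\<bar> + \<bar>K\<bar>) * t" by (simp add: power2_eq_square algebra_simps)
      then have "m\<^sub>a * t \<le> \<bar>A\<bar> + \<bar>B\<bar> + \<bar>K\<bar>" using t by (simp add: mult_le_cancel_right)
      then have "t \<le> (\<bar>A\<bar> + \<bar>B\<bar> + \<bar>K\<bar>) / m\<^sub>a" using ma_pos by (simp add: field_simps)
      then show ?thesis by (simp add: t_def)
    qed
  qed
  then show ?thesis by blast
qed

section \<open>Passage to the limit\<close>

text \<open>Provides the test functionals that make traces of weakly convergent sequences converge
  weakly on the boundary.\<close>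

lemma trace_pairing_dual:
  assumes h: "h \<in> L2 S"
  shows "(\<lambda>v. \<integral>x. \<gamma> v x * h x \<partial>S) \<in> h1_dual \<Omega>"
  unfolding h1_dual_iff h1.dual_on_def
proof (intro conjI ballI allI exI)
  have meas: "(\<lambda>x. \<gamma> v x * h x) \<in> borel_measurable S" if "v \<in> H1 \<Omega>" for v
    using L2_D(1)[OF trace_L2[OF that]] L2_D(1)[OF h] by measurable
  fix u assume u: "u \<in> H1 \<Omega>"
  { fix v assume v: "v \<in> H1 \<Omega>"
    have "(\<integral>x. \<gamma> (u + v) x * h x \<partial>S) = (\<integral>x. \<gamma> u x * h x + \<gamma> v x * h x \<partial>S)"
    proof (rule integral_cong_AE)
      show "AE x in S. \<gamma> (u + v) x * h x = \<gamma> u x * h x + \<gamma> v x * h x"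
        using trace_add[OF u v] by eventually_elim (simp add: distrib_right)
    qed (use meas h1.add_V u v in auto)
    then show "(\<integral>x. \<gamma> (u + v) x * h x \<partial>S) = (\<integral>x. \<gamma> u x * h x \<partial>S) + (\<integral>x. \<gamma> v x * h x \<partial>S)"
      by (simp add: integrable_mult_L2 trace_L2 u v h) }
  { fix c :: real
    have "(\<integral>x. \<gamma> (c *\<^sub>R u) x * h x \<partial>S) = (\<integral>x. c * (\<gamma> u x * h x) \<partial>S)"
    proof (rule integral_cong_AE)
      show "AE x in S. \<gamma> (c *\<^sub>R u) x * h x = c * (\<gamma> u x * h x)"
        using trace_scale[OF u, of c] by eventually_elim simp
    qed (use meas[OF h1.scale_V[OF u]] meas[OF u] in auto)
    then show "(\<integral>x. \<gamma> (c *\<^sub>R u) x * h x \<partial>S) = c * (\<integral>x. \<gamma> u x * h x \<partial>S)" by simp }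
  have "\<bar>\<integral>x. \<gamma> u x * h x \<partial>S\<bar> \<le> l2_norm S (\<gamma> u) * l2_norm S h"
    by (rule l2_cauchy_schwarz[OF trace_L2[OF u] h])
  also have "\<dots> \<le> (trace_norm \<Omega> \<gamma> * h1_norm \<Omega> u) * l2_norm S h"
    by (intro mult_right_mono trace_norm_le u) simp
  finally show "\<bar>\<integral>x. \<gamma> u x * h x \<partial>S\<bar> \<le> (trace_norm \<Omega> \<gamma> * l2_norm S h) * h1.nrm u"
    by (simp add: h1_nrm mult_ac)
qed

text \<open>Makes the bilinear term pass to the limit along weakly convergent sequences.\<close>

lemma dirichlet_dual:
  assumes v: "v \<in> H1 \<Omega>"
  shows "(\<lambda>u. dirichlet_form \<Omega> u v) \<in> h1_dual \<Omega>"
  unfolding h1_dual_iff h1.dual_on_def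
proof (intro conjI ballI allI exI)
  fix u assume u: "u \<in> H1 \<Omega>"
  have "\<bar>dirichlet_form \<Omega> u v\<bar> \<le> dirichlet.nrm u * dirichlet.nrm v"
    by (rule dirichlet.cauchy_schwarz[OF u v])
  also have "\<dots> \<le> h1_norm \<Omega> u * dirichlet.nrm v"
    using l2_norm_gradient_le_h1_norm by (intro mult_right_mono) (auto simp: dirichlet_nrm)
  finally show "\<bar>dirichlet_form \<Omega> u v\<bar> \<le> dirichlet.nrm v * h1.nrm u"
    by (simp add: h1_nrm mult.commute)
qed (simp_all add: dirichlet_form_add dirichlet_form_scale v)

text \<open>Strong convergence of the traces gives one limit of the boundary pairings, weak
  convergence the other. Pairing with the difference \<open>h\<close> of the two candidates shows
  that its norm is 0.\<close>

lemma weak_strong_trace: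
  assumes w: "weakly_converges_h1 \<Omega> u u0" and g: "g \<in> L2 S"
    and lim: "(\<lambda>n. l2_norm S (\<lambda>x. \<gamma> (u n) x - g x)) \<longlonglongrightarrow> 0"
  shows "AE x in S. \<gamma> u0 x = g x"
proof -
  have u: "u n \<in> H1 \<Omega>" "u0 \<in> H1 \<Omega>" for n using w by (auto simp: weakly_converges_h1_def)
  define h where "h = (\<lambda>x. \<gamma> u0 x - g x)"
  have h: "h \<in> L2 S" unfolding h_def by (intro L2_diff trace_L2 u g)
  have "(\<lambda>n. \<integral>x. \<gamma> (u n) x * h x \<partial>S) \<longlonglongrightarrow> (\<integral>x. \<gamma> u0 x * h x \<partial>S)"
    using bspec[OF conjunct2[OF conjunct2[OF w[unfolded weakly_converges_h1_def]]] trace_pairing_dual[OF h]] .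
  moreover have "(\<lambda>n. \<integral>x. \<gamma> (u n) x * h x \<partial>S) \<longlonglongrightarrow> (\<integral>x. g x * h x \<partial>S)"
  proof (rule LIM_zero_cancel, rule Lim_null_comparison)
    show "(\<lambda>n. l2_norm S (\<lambda>x. \<gamma> (u n) x - g x) * l2_norm S h) \<longlonglongrightarrow> 0"
      using tendsto_mult_right[OF lim, of "l2_norm S h"] by simp
    have "norm ((\<integral>x. \<gamma> (u n) x * h x \<partial>S) - (\<integral>x. g x * h x \<partial>S)) \<le> l2_norm S (\<lambda>x. \<gamma> (u n) x - g x) * l2_norm S h" for n
      using l2_cauchy_schwarz[OF L2_diff[OF trace_L2[OF u(1)] g] h, of n]
      by (simp add: left_diff_distrib integrable_mult_L2 trace_L2 u g h)
    then show "\<forall>\<^sub>F n in sequentially. norm ((\<integral>x. \<gamma> (u n) x * h x \<partial>S) - (\<integral>x. g x * h x \<partial>S))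
        \<le> l2_norm S (\<lambda>x. \<gamma> (u n) x - g x) * l2_norm S h" by simp
  qed
  ultimately have "(\<integral>x. \<gamma> u0 x * h x \<partial>S) = (\<integral>x. g x * h x \<partial>S)" by (rule LIMSEQ_unique)
  moreover have "(\<integral>x. \<gamma> u0 x * h x \<partial>S) - (\<integral>x. g x * h x \<partial>S) = (\<integral>x. \<gamma> u0 x * h x - g x * h x \<partial>S)"
    by (simp add: integrable_mult_L2 trace_L2 u g h)
  ultimately have "(\<integral>x. (norm (h x))\<^sup>2 \<partial>S) = 0"
    by (simp add: h_def left_diff_distrib[symmetric] power2_eq_square)
  then have "l2_norm S h = 0" by (simp add: l2_norm_def)
  then have "AE x in S. h x = 0" using l2_norm_eq_0_iff[OF h] by simp
  then show ?thesis by eventually_elim (simp add: h_def)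
qed

text \<open>Fatou's lemma is applied to the growth bound minus the Clarke derivative, which is nonnegative.\<close>

lemma clarke_integral_limit:
  assumes f: "\<And>n. f n \<in> L2 S3" "f0 \<in> L2 S3" and g: "g \<in> L2 S3"
    and lim: "(\<lambda>n. l2_norm S3 (\<lambda>x. f n x - f0 x)) \<longlonglongrightarrow> 0"
    and ae: "AE x in S3. (\<lambda>n. f n x) \<longlonglongrightarrow> f0 x"
    and r: "\<And>n. r n \<le> (\<integral>x. clarke_dd (j x) (f n x) (g x) \<partial>S3)" "r \<longlonglongrightarrow> r0"
  shows "r0 \<le> (\<integral>x. clarke_dd (j x) (f0 x) (g x) \<partial>S3)"
proof -
  define D where "D = (\<lambda>f x. (c\<^sub>0 + c\<^sub>1 * \<bar>f x\<bar>) * \<bar>g x\<bar>)"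
  define C where "C = (\<lambda>f x. clarke_dd (j x) (f x) (g x))"
  have D_int: "integrable S3 (D h)" and C_int: "integrable S3 (C h)" if "h \<in> L2 S3" for h
    unfolding D_def C_def using integrable_growth integrable_clarke_dd that g by auto
  have CD: "AE x in S3. 0 \<le> D h x - C h x" for h
    using clarke_dd_bound by eventually_elim (auto simp: D_def C_def abs_le_iff)
  have DC_nn: "(\<integral>\<^sup>+x. ennreal (D h x - C h x) \<partial>S3) = ennreal ((\<integral>x. D h x \<partial>S3) - (\<integral>x. C h x \<partial>S3))" if "h \<in> L2 S3" for h
    using nn_integral_eq_integral[OF _ CD[of h]] D_int[OF that] C_int[OF that] by simp
  \<comment> \<open>The growth bound is affine in the absolute value of \<open>f\<close>, so its
    integral is Lipschitz in the $L^2$ norm of \<open>f\<close>.\<close>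
  have D_lim: "(\<lambda>n. \<integral>x. D (f n) x \<partial>S3) \<longlonglongrightarrow> (\<integral>x. D f0 x \<partial>S3)"
  proof (rule LIM_zero_cancel, rule Lim_null_comparison)
    show "(\<lambda>n. c\<^sub>1 * (l2_norm S3 (\<lambda>x. f n x - f0 x) * l2_norm S3 g)) \<longlonglongrightarrow> 0"
      using tendsto_mult_left[OF tendsto_mult_right[OF lim, of "l2_norm S3 g"], of c\<^sub>1] by simp
    have "norm ((\<integral>x. D (f n) x \<partial>S3) - (\<integral>x. D f0 x \<partial>S3)) \<le> c\<^sub>1 * (l2_norm S3 (\<lambda>x. f n x - f0 x) * l2_norm S3 g)" for n
    proof -
      let ?a = "\<lambda>x. norm (f n x - f0 x)" and ?b = "\<lambda>x. norm (g x)"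
      have ab: "?a \<in> L2 S3" "?b \<in> L2 S3" by (intro L2_norm L2_diff f g)+
      have "norm ((\<integral>x. D (f n) x \<partial>S3) - (\<integral>x. D f0 x \<partial>S3)) = norm (\<integral>x. D (f n) x - D f0 x \<partial>S3)"
        using D_int f by simp
      also have "\<dots> \<le> (\<integral>x. c\<^sub>1 * (?a x * ?b x) \<partial>S3)"
      proof (rule order_trans[OF integral_norm_bound integral_mono])
        show "integrable S3 (\<lambda>x. norm (D (f n) x - D f0 x))" using D_int f by simp
        show "integrable S3 (\<lambda>x. c\<^sub>1 * (?a x * ?b x))" using integrable_mult_L2[OF ab] by simp
        show "norm (D (f n) x - D f0 x) \<le> c\<^sub>1 * (?a x * ?b x)" for x
        proof -
          have "D (f n) x - D f0 x = c\<^sub>1 * ((\<bar>f n x\<bar> - \<bar>f0 x\<bar>) * \<bar>g x\<bar>)" by (simp add: D_def algebra_simps)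
          moreover have "\<bar>\<bar>f n x\<bar> - \<bar>f0 x\<bar>\<bar> * \<bar>g x\<bar> \<le> ?a x * ?b x"
            unfolding real_norm_def by (intro mult_right_mono) auto
          ultimately show ?thesis using c_nonneg by (simp add: abs_mult mult_left_mono)
        qed
      qed
      also have "\<dots> \<le> c\<^sub>1 * (l2_norm S3 (\<lambda>x. f n x - f0 x) * l2_norm S3 g)"
        using l2_cauchy_schwarz[OF ab] c_nonneg unfolding l2_norm_norm
        by (simp add: mult_left_mono)
      finally show ?thesis .
    qed
    then show "\<forall>\<^sub>F n in sequentially. norm ((\<integral>x. D (f n) x \<partial>S3) - (\<integral>x. D f0 x \<partial>S3))
        \<le> c\<^sub>1 * (l2_norm S3 (\<lambda>x. f n x - f0 x) * l2_norm S3 g)" by simp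
  qed
  have pw: "AE x in S3. ennreal (D f0 x - C f0 x) \<le> liminf (\<lambda>n. ennreal (D (f n) x - C (f n) x))"
    using ae j_lipschitz
  proof eventually_elim
    case (elim x)
    interpret loc_lip "j x" by (rule loc_lip.intro) (rule elim)
    have Dx: "(\<lambda>n. D (f n) x) \<longlonglongrightarrow> D f0 x" unfolding D_def by (intro tendsto_intros elim)
    show ?case
      unfolding le_Liminf_iff
    proof (intro allI impI)
      fix y assume y: "y < ennreal (D f0 x - C f0 x)"
      then obtain y' where y': "y = ennreal y'" "0 \<le> y'" "y' < D f0 x - C f0 x"
        by (cases y) (auto simp: ennreal_less_iff top_unique)
      \<comment> \<open>Half of the gap is spent on semicontinuity of \<open>C\<close>, the other
        half on convergence of \<open>D\<close>.\<close>
      define e where "e = (D f0 x - C f0 x - y') / 2"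
      have e: "e > 0" using y' by (simp add: e_def)
      have "\<forall>\<^sub>F n in sequentially. C (f n) x < C f0 x + e"
        using dd_upper_semicontinuous[OF elim(1), of "g x" "C f0 x + e"] e by (simp add: C_def)
      moreover have "\<forall>\<^sub>F n in sequentially. D f0 x - e < D (f n) x"
        using order_tendstoD(1)[OF Dx, of "D f0 x - e"] e by simp
      ultimately show "\<forall>\<^sub>F n in sequentially. y < ennreal (D (f n) x - C (f n) x)"
      proof eventually_elim
        case (elim n)
        then have "y' < D (f n) x - C (f n) x" using e by (simp add: e_def field_simps)
        then show ?case using y' by (simp add: ennreal_less_iff)
      qed
    qed
  qed
  have "ennreal ((\<integral>x. D f0 x \<partial>S3) - (\<integral>x. C f0 x \<partial>S3)) = (\<integral>\<^sup>+x. ennreal (D f0 x - C f0 x) \<partial>S3)"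
    using DC_nn[OF f(2)] by simp
  also have "\<dots> \<le> (\<integral>\<^sup>+x. liminf (\<lambda>n. ennreal (D (f n) x - C (f n) x)) \<partial>S3)"
    by (rule nn_integral_mono_AE[OF pw])
  also have "\<dots> \<le> liminf (\<lambda>n. \<integral>\<^sup>+x. ennreal (D (f n) x - C (f n) x) \<partial>S3)"
    using D_int[OF f(1)] C_int[OF f(1)] by (intro nn_integral_liminf) auto
  also have "\<dots> \<le> liminf (\<lambda>n. ennreal ((\<integral>x. D (f n) x \<partial>S3) - r n))"
    unfolding DC_nn[OF f(1)] using r(1) by (intro Liminf_mono always_eventually allI ennreal_leI) (simp add: C_def)
  also have "\<dots> = ennreal ((\<integral>x. D f0 x \<partial>S3) - r0)"
    by (intro lim_imp_Liminf tendsto_ennrealI tendsto_diff D_lim r) simp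
  finally have le: "ennreal ((\<integral>x. D f0 x \<partial>S3) - (\<integral>x. C f0 x \<partial>S3)) \<le> ennreal ((\<integral>x. D f0 x \<partial>S3) - r0)" .
  \<comment> \<open>\<open>ennreal\<close> sends negative numbers to 0, so \<open>le\<close> yields
    a real inequality only once its right-hand side is known to be nonnegative.\<close>
  have "0 \<le> (\<integral>x. D f0 x \<partial>S3) - r0"
  proof (rule tendsto_lowerbound[OF tendsto_diff[OF D_lim r(2)]])
    have "r n \<le> (\<integral>x. D (f n) x \<partial>S3)" for n
    proof -
      have "0 \<le> (\<integral>x. D (f n) x - C (f n) x \<partial>S3)" by (rule integral_nonneg_AE[OF CD])
      also have "\<dots> = (\<integral>x. D (f n) x \<partial>S3) - (\<integral>x. C (f n) x \<partial>S3)"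
        by (intro Bochner_Integration.integral_diff D_int C_int f)
      finally show ?thesis using r(1)[of n] by (simp add: C_def)
    qed
    then show "\<forall>\<^sub>F n in sequentially. 0 \<le> (\<integral>x. D (f n) x \<partial>S3) - r n" by simp
  qed simp
  then have "(\<integral>x. D f0 x \<partial>S3) - (\<integral>x. C f0 x \<partial>S3) \<le> (\<integral>x. D f0 x \<partial>S3) - r0"
    using le by simp
  then show ?thesis by (simp add: C_def)
qed

text \<open>Two extractions are needed, one for strong convergence of the traces by compactness and
  one for pointwise convergence. The weak limit \<open>u0\<close> is fixed beforehand, so neither
  affects the conclusion.\<close>

lemma solution_limit:
  assumes L: "\<And>v. v \<in> H1 \<Omega> \<Longrightarrow> (\<lambda>n. F n v) \<longlonglongrightarrow> L v"
    and sol: "\<And>n. solution (F n) (u n)" and weak: "weakly_converges_h1 \<Omega> u u0"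
    and bound: "\<And>n. h1_norm \<Omega> (u n) \<le> R"
  shows "solution L u0"
proof -
  have u: "u n \<in> H1 \<Omega>" "u0 \<in> H1 \<Omega>" for n using weak by (auto simp: weakly_converges_h1_def)
  obtain \<sigma> g where \<sigma>: "strict_mono \<sigma>" and g: "g \<in> L2 S"
    and lim: "(\<lambda>n. l2_norm S (\<lambda>x. \<gamma> (u (\<sigma> n)) x - g x)) \<longlonglongrightarrow> 0"
    using trace_compact[unfolded compact_trace_def, rule_format, of u] u(1) bound by blast
  have weak_sub: "weakly_converges_h1 \<Omega> (u \<circ> \<tau>) u0" if "strict_mono \<tau>" for \<tau>
    using weak LIMSEQ_subseq_LIMSEQ[OF _ that] unfolding weakly_converges_h1_def
    by (auto simp: comp_def)
  have trace_u0: "AE x in S. \<gamma> u0 x = g x"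
    using weak_strong_trace[OF weak_sub[OF \<sigma>] g] lim by simp
  have lim0: "(\<lambda>n. l2_norm S (\<lambda>x. \<gamma> (u (\<sigma> n)) x - \<gamma> u0 x)) \<longlonglongrightarrow> 0"
  proof -
    have "l2_norm S (\<lambda>x. \<gamma> (u (\<sigma> n)) x - \<gamma> u0 x) = l2_norm S (\<lambda>x. \<gamma> (u (\<sigma> n)) x - g x)" for n
    proof (rule l2_norm_AE_cong)
      show "AE x in S. \<gamma> (u (\<sigma> n)) x - \<gamma> u0 x = \<gamma> (u (\<sigma> n)) x - g x"
        using trace_u0 by eventually_elim simp
    qed (intro L2_D(1) L2_diff trace_L2 u g)+
    then show ?thesis using lim by simp
  qed
  have u0_V0: "u0 \<in> V0 \<Omega> \<gamma> \<Gamma>\<^sub>1"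
  proof -
    \<comment> \<open>On \<open>\<Gamma>\<^sub>1\<close> the traces of the approximations vanish, so
      the error there is the trace of \<open>u0\<close> itself.\<close>
    have "l2_norm S1 (\<gamma> u0) \<le> l2_norm S (\<lambda>x. \<gamma> (u (\<sigma> n)) x - \<gamma> u0 x)" for n
    proof -
      have d: "(\<lambda>x. \<gamma> (u (\<sigma> n)) x - \<gamma> u0 x) \<in> L2 S" by (intro L2_diff trace_L2 u)
      have "AE x in S1. \<gamma> (u (\<sigma> n)) x = 0" using solution_D(1)[OF sol] by (auto simp: V0_def)
      then have "AE x in S1. norm (\<gamma> u0 x) = norm (\<gamma> (u (\<sigma> n)) x - \<gamma> u0 x)" by eventually_elim simp
      then have "l2_norm S1 (\<lambda>x. norm (\<gamma> u0 x)) = l2_norm S1 (\<lambda>x. norm (\<gamma> (u (\<sigma> n)) x - \<gamma> u0 x))"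
        using L2_S1(1)[OF trace_L2[OF u(2)]] L2_S1(1)[OF d]
        by (intro l2_norm_AE_cong L2_D(1) L2_norm)
      then show ?thesis using L2_S1(2)[OF d] by (simp only: l2_norm_norm)
    qed
    then have "l2_norm S1 (\<gamma> u0) \<le> 0"
      using tendsto_lowerbound[OF lim0] by simp
    then have "l2_norm S1 (\<gamma> u0) = 0" using l2_norm_nonneg[of S1 "\<gamma> u0"] by linarith
    then show ?thesis
      using l2_norm_eq_0_iff[OF L2_S1(1)[OF trace_L2[OF u(2)]]] u by (simp add: V0_def)
  qed
  have lim3: "(\<lambda>n. l2_norm S3 (\<lambda>x. \<gamma> (u (\<sigma> n)) x - \<gamma> u0 x)) \<longlonglongrightarrow> 0"
  proof (rule Lim_null_comparison[OF always_eventually lim0], rule allI)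
    show "norm (l2_norm S3 (\<lambda>x. \<gamma> (u (\<sigma> n)) x - \<gamma> u0 x)) \<le> l2_norm S (\<lambda>x. \<gamma> (u (\<sigma> n)) x - \<gamma> u0 x)" for n
      using L2_S3(2)[OF L2_diff[OF trace_L2[OF u(1)] trace_L2[OF u(2)]]] by simp
  qed
  have "\<exists>\<rho>::nat\<Rightarrow>nat. strict_mono \<rho> \<and> (AE x in S3. (\<lambda>n. \<gamma> (u (\<sigma> (\<rho> n))) x - \<gamma> u0 x) \<longlonglongrightarrow> 0)"
  proof (rule tendsto_L1_AE_subseq)
    show "integrable S3 (\<lambda>x. \<gamma> (u (\<sigma> n)) x - \<gamma> u0 x)" for n
      by (intro S3.integrable_L2 L2_diff trace_L2_S3 u)
    show "(\<lambda>n. \<integral>x. norm (\<gamma> (u (\<sigma> n)) x - \<gamma> u0 x) \<partial>S3) \<longlonglongrightarrow> 0"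
    proof (rule Lim_null_comparison)
      show "(\<lambda>n. l2_norm S3 (\<lambda>x. \<gamma> (u (\<sigma> n)) x - \<gamma> u0 x) * sqrt (measure S3 (space S3))) \<longlonglongrightarrow> 0"
        using tendsto_mult_right[OF lim3] by fastforce
      show "\<forall>\<^sub>F n in sequentially. norm (\<integral>x. norm (\<gamma> (u (\<sigma> n)) x - \<gamma> u0 x) \<partial>S3)
          \<le> l2_norm S3 (\<lambda>x. \<gamma> (u (\<sigma> n)) x - \<gamma> u0 x) * sqrt (measure S3 (space S3))"
        using S3.integral_norm_le_l2_norm[OF L2_diff[OF trace_L2_S3[OF u(1)] trace_L2_S3[OF u(2)]]] by simp
    qed
  qed
  then obtain \<rho> where \<rho>: "strict_mono \<rho>" and ae: "AE x in S3. (\<lambda>n. \<gamma> (u (\<sigma> (\<rho> n))) x - \<gamma> u0 x) \<longlonglongrightarrow> 0"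
    by blast
  define \<tau> where "\<tau> = \<sigma> \<circ> \<rho>"
  have \<tau>: "strict_mono \<tau>" using \<sigma> \<rho> by (simp add: \<tau>_def strict_mono_o)
  show ?thesis
    unfolding hvi_solution_def
  proof (intro conjI ballI u0_V0)
    fix v assume v: "v \<in> V0 \<Omega> \<gamma> \<Gamma>\<^sub>1"
    have vH: "v \<in> H1 \<Omega>" by (rule V0_H1[OF v])
    \<comment> \<open>The inequality is solved for the boundary integral, leaving on the left a
      quantity whose limit is known.\<close>
    have "(L v - dirichlet_form \<Omega> u0 v) / \<alpha> \<le> J u0 v"
    proof (rule clarke_integral_limit)
      show "\<gamma> (u (\<tau> n)) \<in> L2 S3" "\<gamma> u0 \<in> L2 S3" "\<gamma> v \<in> L2 S3" for n by (intro trace_L2_S3 u vH)+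
      show "(\<lambda>n. l2_norm S3 (\<lambda>x. \<gamma> (u (\<tau> n)) x - \<gamma> u0 x)) \<longlonglongrightarrow> 0"
        using LIMSEQ_subseq_LIMSEQ[OF lim3 \<rho>] by (simp add: comp_def \<tau>_def)
      show "AE x in S3. (\<lambda>n. \<gamma> (u (\<tau> n)) x) \<longlonglongrightarrow> \<gamma> u0 x"
        using ae unfolding \<tau>_def by eventually_elim (auto intro: LIM_zero_cancel)
      show "(F (\<tau> n) v - dirichlet_form \<Omega> (u (\<tau> n)) v) / \<alpha> \<le> J (u (\<tau> n)) v" for n
        using solution_D(3)[OF sol v, of "\<tau> n"] alpha_pos by (simp add: field_simps)
      have "(\<lambda>n. dirichlet_form \<Omega> (u (\<tau> n)) v) \<longlonglongrightarrow> dirichlet_form \<Omega> u0 v"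
        using weak_sub[OF \<tau>] dirichlet_dual[OF vH] unfolding weakly_converges_h1_def by auto
      moreover have "(\<lambda>n. F (\<tau> n) v) \<longlonglongrightarrow> L v"
        using LIMSEQ_subseq_LIMSEQ[OF L[OF vH] \<tau>] by (simp add: comp_def)
      ultimately show "(\<lambda>n. (F (\<tau> n) v - dirichlet_form \<Omega> (u (\<tau> n)) v) / \<alpha>)
          \<longlonglongrightarrow> (L v - dirichlet_form \<Omega> u0 v) / \<alpha>"
        using alpha_pos by (intro tendsto_intros) auto
    qed
    then show "L v \<le> dirichlet_form \<Omega> u0 v + \<alpha> * J u0 v" using alpha_pos by (simp add: field_simps)
  qed
qed

theorem subsequence_converges:
  assumes L: "L \<in> h1_dual \<Omega>" and F: "\<And>n. F n \<in> h1_dual \<Omega>"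
    and conv: "\<And>e. e > 0 \<Longrightarrow> \<forall>\<^sub>F n in sequentially. \<forall>v\<in>H1 \<Omega>. \<bar>F n v - L v\<bar> \<le> e * h1_norm \<Omega> v"
    and sol: "\<And>n. solution (F n) (u n)"
  shows "\<exists>\<sigma> u0. strict_mono \<sigma> \<and> weakly_converges_h1 \<Omega> (\<lambda>n. u (\<sigma> n)) u0 \<and> solution L u0"
proof -
  obtain C where C: "\<And>v. v \<in> H1 \<Omega> \<Longrightarrow> \<bar>L v\<bar> \<le> C * h1_norm \<Omega> v"
    using h1_dual_linear(4)[OF L] by blast
  \<comment> \<open>From \<open>N\<close> on all functionals share the bound \<open>C + 1\<close>;
    the earlier terms are cut off by the shift \<open>n + N\<close>.\<close>
  obtain N where N: "\<And>n v. n \<ge> N \<Longrightarrow> v \<in> H1 \<Omega> \<Longrightarrow> \<bar>F n v - L v\<bar> \<le> 1 * h1_norm \<Omega> v"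
    using conv[of 1] unfolding eventually_sequentially by auto
  have FC: "\<bar>F n v\<bar> \<le> (C + 1) * h1_norm \<Omega> v" if "n \<ge> N" "v \<in> H1 \<Omega>" for n v
    using N[OF that] C[OF that(2)] by (simp add: distrib_right)
  obtain R where "\<And>l u. l \<in> h1_dual \<Omega> \<Longrightarrow> (\<And>v. v \<in> H1 \<Omega> \<Longrightarrow> \<bar>l v\<bar> \<le> (C + 1) * h1_norm \<Omega> v) \<Longrightarrow>
      solution l u \<Longrightarrow> h1_norm \<Omega> u \<le> R"
    using solution_bounded[of "C + 1"] by blast
  then have R: "h1_norm \<Omega> (u n) \<le> R" if "n \<ge> N" for n using F FC[OF that] sol by blast
  obtain \<sigma> u0 where \<sigma>: "strict_mono \<sigma>" and weak: "weakly_converges_h1 \<Omega> (\<lambda>n. u (\<sigma> n + N)) u0"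
    using h1_weak_compactness[of "\<lambda>n. u (n + N)" R] solution_D(2)[OF sol] R by auto
  define \<tau> where "\<tau> = (\<lambda>n. \<sigma> n + N)"
  have \<tau>: "strict_mono \<tau>" using \<sigma> by (simp add: \<tau>_def strict_mono_def)
  have "solution L u0"
  proof (rule solution_limit)
    show "solution (F (\<tau> n)) (u (\<tau> n))" for n by (rule sol)
    show "weakly_converges_h1 \<Omega> (\<lambda>n. u (\<tau> n)) u0" using weak by (simp add: \<tau>_def)
    show "h1_norm \<Omega> (u (\<tau> n)) \<le> R" for n by (rule R) (simp add: \<tau>_def)
    fix v assume v: "v \<in> H1 \<Omega>"
    have "(\<lambda>n. F n v) \<longlonglongrightarrow> L v"
    proof (rule tendstoI)
      fix e :: real assume e: "e > 0"
      define e' where "e' = e / (h1_norm \<Omega> v + 1)"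
      have pos: "h1_norm \<Omega> v + 1 > 0" by (simp add: add_nonneg_pos)
      then have e': "e' > 0" using e by (simp add: e'_def)
      have "e' * h1_norm \<Omega> v < e' * (h1_norm \<Omega> v + 1)" using e' by (intro mult_strict_left_mono) auto
      also have "\<dots> = e" using pos by (simp add: e'_def)
      finally have lt: "e' * h1_norm \<Omega> v < e" .
      show "\<forall>\<^sub>F n in sequentially. dist (F n v) (L v) < e"
        using conv[OF e'] by eventually_elim (use v lt in \<open>force simp: dist_real_def\<close>)
    qed
    from LIMSEQ_subseq_LIMSEQ[OF this \<tau>] show "(\<lambda>n. F (\<tau> n) v) \<longlonglongrightarrow> L v" by (simp add: comp_def)
  qed
  then show ?thesis using \<tau> weak unfolding \<tau>_def by blast
qed

text \<open>Testing the problem of \<open>u\<close> with \<open>w - u\<close> and that of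
  \<open>w\<close> with \<open>u - w\<close> and adding, the Clarke terms form the sum that
  \<open>mono\<close> controls. The trace norm turns their bound into a multiple of the squared
  $H^1$ norm, which coercivity absorbs.\<close>

lemma solution_stability:
  assumes mj: "m\<^sub>j \<ge> 0" and mono: "AE x in S3. \<forall>r s.
      clarke_dd (j x) r (s - r) + clarke_dd (j x) s (r - s) \<le> m\<^sub>j * \<bar>r - s\<bar>\<^sup>2"
    and l: "l \<in> h1_dual \<Omega>" "l' \<in> h1_dual \<Omega>" and u: "solution l u" and w: "solution l' w"
  shows "(m\<^sub>a - \<alpha> * m\<^sub>j * (trace_norm \<Omega> \<gamma>)\<^sup>2) * (h1_norm \<Omega> (u - w))\<^sup>2 \<le> l (u - w) - l' (u - w)"
proof -
  note uD = solution_D[OF u] and wD = solution_D[OF w]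
  have uw: "u - w \<in> V0 \<Omega> \<gamma> \<Gamma>\<^sub>1" "w - u \<in> V0 \<Omega> \<gamma> \<Gamma>\<^sub>1" using V0_diff uD(1) wD(1) by auto
  have uwH: "u - w \<in> H1 \<Omega>" "w - u \<in> H1 \<Omega>" using V0_H1 uw by auto
  have f: "\<gamma> u \<in> L2 S3" "\<gamma> w \<in> L2 S3" "\<gamma> (u - w) \<in> L2 S3" "\<gamma> (w - u) \<in> L2 S3"
    using trace_L2_S3 uD(2) wD(2) uwH by auto
  have "J u (w - u) + J w (u - w) = (\<integral>x. clarke_dd (j x) (\<gamma> u x) (\<gamma> (w - u) x) + clarke_dd (j x) (\<gamma> w x) (\<gamma> (u - w) x) \<partial>S3)"
    using integrable_clarke_dd f by simp
  also have "\<dots> \<le> (\<integral>x. m\<^sub>j * (norm (\<gamma> (u - w) x))\<^sup>2 \<partial>S3)"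
  proof (rule integral_mono_AE)
    show "integrable S3 (\<lambda>x. clarke_dd (j x) (\<gamma> u x) (\<gamma> (w - u) x) + clarke_dd (j x) (\<gamma> w x) (\<gamma> (u - w) x))"
      using integrable_clarke_dd f by simp
    show "integrable S3 (\<lambda>x. m\<^sub>j * (norm (\<gamma> (u - w) x))\<^sup>2)" using L2_D(2)[OF f(3)] by simp
    show "AE x in S3. clarke_dd (j x) (\<gamma> u x) (\<gamma> (w - u) x) + clarke_dd (j x) (\<gamma> w x) (\<gamma> (u - w) x)
        \<le> m\<^sub>j * (norm (\<gamma> (u - w) x))\<^sup>2"
      using mono AE_S3[OF trace_diff[OF uD(2) wD(2)]] AE_S3[OF trace_diff[OF wD(2) uD(2)]]
      by eventually_elim simp
  qed
  also have "\<dots> = m\<^sub>j * (l2_norm S3 (\<gamma> (u - w)))\<^sup>2" by (simp add: l2_norm_square)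
  also have "\<dots> \<le> m\<^sub>j * (trace_norm \<Omega> \<gamma> * h1_norm \<Omega> (u - w))\<^sup>2"
    using mj trace_norm_S3_le[OF uwH(1)] by (intro mult_left_mono power_mono) auto
  finally have JJ: "\<alpha> * (J u (w - u) + J w (u - w)) \<le> \<alpha> * (m\<^sub>j * (trace_norm \<Omega> \<gamma> * h1_norm \<Omega> (u - w))\<^sup>2)"
    using alpha_pos by (intro mult_left_mono) auto
  have "l (w - u) \<le> dirichlet_form \<Omega> u (w - u) + \<alpha> * J u (w - u)" by (rule uD(3)[OF uw(2)])
  moreover have "l' (u - w) \<le> dirichlet_form \<Omega> w (u - w) + \<alpha> * J w (u - w)" by (rule wD(3)[OF uw(1)])
  moreover have "l (w - u) = - l (u - w)" using h1_dual_linear(3)[OF l(1)] uD(2) wD(2) by simp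
  moreover have "dirichlet_form \<Omega> (u - w) (u - w) = - (dirichlet_form \<Omega> u (w - u) + dirichlet_form \<Omega> w (u - w))"
    using uD(2) wD(2) uwH by (simp add: dirichlet.ip_simps)
  moreover have "m\<^sub>a * (h1_norm \<Omega> (u - w))\<^sup>2 \<le> dirichlet_form \<Omega> (u - w) (u - w)" by (rule coercive[OF uw(1)])
  ultimately have "m\<^sub>a * (h1_norm \<Omega> (u - w))\<^sup>2 \<le> \<alpha> * (J u (w - u) + J w (u - w)) + (l (u - w) - l' (u - w))"
    unfolding distrib_left by linarith
  then have "m\<^sub>a * (h1_norm \<Omega> (u - w))\<^sup>2 \<le> \<alpha> * (m\<^sub>j * (trace_norm \<Omega> \<gamma> * h1_norm \<Omega> (u - w))\<^sup>2) + (l (u - w) - l' (u - w))"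
    using JJ by linarith
  then show ?thesis by (simp add: algebra_simps power_mult_distrib)
qed

end

theorem theorem9:
  fixes \<Omega> \<Gamma>\<^sub>1 \<Gamma>\<^sub>2 \<Gamma>\<^sub>3 :: "'a::euclidean_space set"
    and \<gamma> :: "('a \<Rightarrow> real) \<Rightarrow> ('a \<Rightarrow> real)"
    and j :: "'a \<Rightarrow> real \<Rightarrow> real"
    and m\<^sub>a \<alpha> b :: real
    and L :: "('a \<Rightarrow> real) \<Rightarrow> real"
    and Ln :: "nat \<Rightarrow> ('a \<Rightarrow> real) \<Rightarrow> real"
    and u :: "nat \<Rightarrow> 'a \<Rightarrow> real"
  assumes domain: "bounded_lipschitz_domain \<Omega>"
    and trace: "trace_operator \<Omega> \<gamma>" "compact_trace \<Omega> \<gamma>"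
    and portions: "\<Gamma>\<^sub>1 \<union> \<Gamma>\<^sub>2 \<union> \<Gamma>\<^sub>3 = frontier \<Omega>"
      "\<Gamma>\<^sub>1 \<inter> \<Gamma>\<^sub>2 = {}" "\<Gamma>\<^sub>1 \<inter> \<Gamma>\<^sub>3 = {}" "\<Gamma>\<^sub>2 \<inter> \<Gamma>\<^sub>3 = {}"
    and portions_measurable: "\<forall>\<Gamma> \<in> {\<Gamma>\<^sub>1, \<Gamma>\<^sub>2, \<Gamma>\<^sub>3}. \<Gamma> \<in> sets (hausdorff_measure (DIM('a) - 1))"
    and portions_positive: "\<forall>\<Gamma> \<in> {\<Gamma>\<^sub>1, \<Gamma>\<^sub>2, \<Gamma>\<^sub>3}. emeasure (hausdorff_measure (DIM('a) - 1)) \<Gamma> > 0"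
    and coercive: "m\<^sub>a > 0" "\<forall>v \<in> V0 \<Omega> \<gamma> \<Gamma>\<^sub>1. dirichlet_form \<Omega> v v \<ge> m\<^sub>a * (h1_norm \<Omega> v)\<^sup>2"
    and j_measurable: "\<forall>r. (\<lambda>x. j x r) \<in> borel_measurable (surface_measure \<Gamma>\<^sub>3)"
    and j_lipschitz: "AE x in surface_measure \<Gamma>\<^sub>3. locally_lipschitz (j x)"
    and j_growth: "\<exists>c\<^sub>0 \<ge> 0. \<exists>c\<^sub>1 \<ge> 0. AE x in surface_measure \<Gamma>\<^sub>3.
      \<forall>r. \<forall>\<zeta> \<in> clarke_subdiff (j x) r. \<bar>\<zeta>\<bar> \<le> c\<^sub>0 + c\<^sub>1 * \<bar>r\<bar>"
    and j_sign: "AE x in surface_measure \<Gamma>\<^sub>3. \<forall>r. clarke_dd (j x) r (b - r) \<le> 0"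
    and alpha: "\<alpha> > 0"
    and duals: "L \<in> h1_dual \<Omega>" "\<forall>n. Ln n \<in> h1_dual \<Omega>"
    and Ln_conv: "\<forall>z z0. weakly_converges_h1 \<Omega> z z0 \<longrightarrow> (\<lambda>n. Ln n (z n)) \<longlonglongrightarrow> L z0"
    and solutions: "\<forall>n. hvi_solution \<Omega> \<gamma> \<Gamma>\<^sub>1 \<Gamma>\<^sub>3 j \<alpha> (Ln n) (u n)"
  shows
    "(\<exists>\<sigma> u0. strict_mono \<sigma> \<and> weakly_converges_h1 \<Omega> (\<lambda>n. u (\<sigma> n)) u0 \<and>
        hvi_solution \<Omega> \<gamma> \<Gamma>\<^sub>1 \<Gamma>\<^sub>3 j \<alpha> L u0) \<and>
     ((\<exists>m\<^sub>j \<ge> 0.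
         (AE x in surface_measure \<Gamma>\<^sub>3. \<forall>r s.
            clarke_dd (j x) r (s - r) + clarke_dd (j x) s (r - s) \<le> m\<^sub>j * \<bar>r - s\<bar>\<^sup>2) \<and>
         m\<^sub>a > \<alpha> * m\<^sub>j * (trace_norm \<Omega> \<gamma>)\<^sup>2) \<longrightarrow>
      (\<exists>u0. hvi_unique_solution \<Omega> \<gamma> \<Gamma>\<^sub>1 \<Gamma>\<^sub>3 j \<alpha> L u0 \<and>
        (\<forall>n. hvi_unique_solution \<Omega> \<gamma> \<Gamma>\<^sub>1 \<Gamma>\<^sub>3 j \<alpha> (Ln n) (u n)) \<and>
        (\<lambda>n. h1_norm \<Omega> (\<lambda>x. u n x - u0 x)) \<longlonglongrightarrow> 0))"
proof -
  obtain c\<^sub>0 c\<^sub>1 where c: "c\<^sub>0 \<ge> 0" "c\<^sub>1 \<ge> 0" "AE x in surface_measure \<Gamma>\<^sub>3.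
      \<forall>r. \<forall>\<zeta> \<in> clarke_subdiff (j x) r. \<bar>\<zeta>\<bar> \<le> c\<^sub>0 + c\<^sub>1 * \<bar>r\<bar>"
    using j_growth by blast
  have frontier: "frontier \<Omega> \<in> sets (hausdorff_measure (DIM('a) - 1))"
    unfolding portions(1)[symmetric] using portions_measurable by (intro sets.Un) auto
  interpret hemivariational \<Omega> \<gamma> \<Gamma>\<^sub>1 \<Gamma>\<^sub>3 j m\<^sub>a \<alpha> b c\<^sub>0 c\<^sub>1
    by unfold_locales
      (use domain trace portions portions_measurable coercive j_measurable j_lipschitz j_sign alpha c frontier
        in \<open>auto simp: bounded_lipschitz_domain_def\<close>)
  have norm_conv: "\<forall>\<^sub>F n in sequentially. \<forall>v\<in>H1 \<Omega>. \<bar>Ln n v - L v\<bar> \<le> e * h1_norm \<Omega> v" if "e > 0" for e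
    using functional_norm_convergence[of L Ln e] duals Ln_conv that by blast
  have sub: "\<exists>\<sigma> u0. strict_mono \<sigma> \<and> weakly_converges_h1 \<Omega> (\<lambda>n. u (\<sigma> n)) u0 \<and> solution L u0"
    by (rule subsequence_converges[of L Ln]) (use duals norm_conv solutions in auto)
  have "\<exists>u0. hvi_unique_solution \<Omega> \<gamma> \<Gamma>\<^sub>1 \<Gamma>\<^sub>3 j \<alpha> L u0 \<and>
      (\<forall>n. hvi_unique_solution \<Omega> \<gamma> \<Gamma>\<^sub>1 \<Gamma>\<^sub>3 j \<alpha> (Ln n) (u n)) \<and>
      (\<lambda>n. h1_norm \<Omega> (\<lambda>x. u n x - u0 x)) \<longlonglongrightarrow> 0"
    if mj: "m\<^sub>j \<ge> 0" and mono: "AE x in surface_measure \<Gamma>\<^sub>3. \<forall>r s.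
        clarke_dd (j x) r (s - r) + clarke_dd (j x) s (r - s) \<le> m\<^sub>j * \<bar>r - s\<bar>\<^sup>2"
      and small: "m\<^sub>a > \<alpha> * m\<^sub>j * (trace_norm \<Omega> \<gamma>)\<^sup>2" for m\<^sub>j
  proof -
    \<comment> \<open>The part of the coercivity that survives the nonmonotone boundary
      term.\<close>
    define \<kappa> where "\<kappa> = m\<^sub>a - \<alpha> * m\<^sub>j * (trace_norm \<Omega> \<gamma>)\<^sup>2"
    have \<kappa>: "\<kappa> > 0" using small by (simp add: \<kappa>_def)
    note stab = solution_stability[OF mj mono, folded \<kappa>_def]
    have unique: "hvi_unique_solution \<Omega> \<gamma> \<Gamma>\<^sub>1 \<Gamma>\<^sub>3 j \<alpha> l w"
      if l: "l \<in> h1_dual \<Omega>" and w: "solution l w" for l w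
      unfolding hvi_unique_solution_def
    proof (intro conjI allI impI w)
      fix w' assume w': "solution l w'"
      have d: "w' - w \<in> H1 \<Omega>" using solution_D(2)[OF w] solution_D(2)[OF w'] by (intro h1.diff_V)
      have "\<kappa> * (h1_norm \<Omega> (w' - w))\<^sup>2 \<le> 0" using stab[OF l l w' w] by simp
      then have "h1_norm \<Omega> (w' - w) = 0" using \<kappa> by (simp add: mult_le_0_iff)
      then have "l2_norm (lebesgue_on \<Omega>) (w' - w) = 0"
        using l2_norm_le_h1_norm[of "w' - w"] l2_norm_nonneg[of "lebesgue_on \<Omega>" "w' - w"] by linarith
      then have "AE x in lebesgue_on \<Omega>. (w' - w) x = 0"
        using l2_norm_eq_0_iff[OF H1_L2(1)[OF d]] by simp
      then show "AE x in lebesgue_on \<Omega>. w' x = w x" by eventually_elim simp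
    qed
    \<comment> \<open>Existence for the limit problem is read off from the first part. Stability
      against this \<open>u0\<close> then treats the whole sequence at once.\<close>
    obtain u0 where u0: "solution L u0" using sub by blast
    have "(\<lambda>n. h1_norm \<Omega> (u n - u0)) \<longlonglongrightarrow> 0"
    proof (rule tendstoI)
      fix e :: real assume e: "e > 0"
      \<comment> \<open>With this tolerance in the dual norm, stability bounds the distance to
        \<open>u0\<close> by \<open>e / 2\<close>.\<close>
      have "\<kappa> * e / 2 > 0" using \<kappa> e by simp
      from norm_conv[OF this] show "\<forall>\<^sub>F n in sequentially. dist (h1_norm \<Omega> (u n - u0)) 0 < e"
      proof eventually_elim
        case (elim n)
        have sol: "solution (Ln n) (u n)" using solutions by blast
        define t where "t = h1_norm \<Omega> (u n - u0)"
        have d: "u n - u0 \<in> H1 \<Omega>"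
          using solution_D(2)[OF sol] solution_D(2)[OF u0] by (intro h1.diff_V)
        have "\<kappa> * t\<^sup>2 \<le> Ln n (u n - u0) - L (u n - u0)"
          unfolding t_def using stab[OF _ _ sol u0] duals by blast
        also have "\<dots> \<le> \<kappa> * e / 2 * t" using elim d abs_le_D1 unfolding t_def by blast
        finally have "\<kappa> * (t * t) \<le> \<kappa> * (e / 2 * t)" by (simp add: power2_eq_square)
        then have "t * t \<le> e / 2 * t" using \<kappa> by simp
        then have "t \<le> e / 2"
          using e mult_right_le_imp_le[of t t "e / 2"] by (cases "t > 0") auto
        then have "t < e" using e by linarith
        then show ?case by (simp add: t_def)
      qed
    qed
    then show ?thesis using unique u0 duals solutions by (auto simp: fun_diff_def)
  qed
  then show ?thesis using sub by blast
qed

end
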